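(* Every pseudo-umbilical biharmonic submanifold of dimension four in a six-dimensional Riemannian manifold of constant non-positive sectional curvature is minimal.
   Context: A submanifold $M^m$ of a Riemannian manifold means an $m$-dimensional smooth manifold with an isometric immersion. $B$ is the second fundamental form, $A_\xi$ the Weingarten (shape) operator in the normal direction $\xi$, $\nabla^\perp$ the normal connection, $\mathbf{H}=\frac1m\sum_{i=1}^m B(e_i,e_i)$ the mean curvature vector field for a local orthonormal frame $\{e_i\}$, and $\Delta^\perp=\sum_i\big(\nabla^\perp_{e_i}\nabla^\perp_{e_i}-\nabla^\perp_{\nabla_{e_i}e_i}\big)$ the (non-positive) normal Laplacian. $M$ is minimal if $\mathbf{H}\equiv 0$. $M$ is pseudo-umbilical if $A_{\mathbf{H}}=|\mathbf{H}|^2\,\mathrm{Id}$ everywhere on $M$ ($\mathbf{H}$ may vanish). A submanifold $M^m$ of a Riemannian manifold of constant sectional curvature $c$ is biharmonic if and only if both $$\Delta^\perp\mathbf{H}-\sum_{i=1}^mB(A_{\mathbf{H}}e_i,e_i)+mc\,\mathbf{H}=0,\qquad m\,\nabla|\mathbf{H}|^2+4\sum_{i=1}^mA_{\nabla^\perp_{e_i}\mathbf{H}}e_i=0$$ hold, where $\nabla|\mathbf H|^2$ is the gradient on $M$. *)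

theory Defs
  imports "HOL-Analysis.Analysis"
begin

section \<open>Smooth maps and smooth manifolds\<close>

abbreviation dirderiv ::
  "('a::real_normed_vector \<Rightarrow> 'b::real_normed_vector) \<Rightarrow> 'a \<Rightarrow> 'a \<Rightarrow> 'b"
  where "dirderiv f x v \<equiv> frechet_derivative f (at x) v"

text \<open>\<open>Ck_on k S f\<close> and \<open>smooth_on S f\<close> are only meant for open \<open>S\<close>.\<close>

fun Ck_on :: "nat \<Rightarrow> 'a set \<Rightarrow> ('a::real_normed_vector \<Rightarrow> 'b::real_normed_vector) \<Rightarrow> bool"
  where
    "Ck_on 0 S f \<longleftrightarrow> continuous_on S f"
  | "Ck_on (Suc k) S f \<longleftrightarrow>
       (\<forall>x\<in>S. f differentiable (at x)) \<and> (\<forall>v. Ck_on k S (\<lambda>x. dirderiv f x v))"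

definition smooth_on :: "'a set \<Rightarrow> ('a::real_normed_vector \<Rightarrow> 'b::real_normed_vector) \<Rightarrow> bool"
  where "smooth_on S f \<longleftrightarrow> (\<forall>k. Ck_on k S f)"

text \<open>A chart is a pair of its domain and its coordinate map; the values of the coordinate map
  outside the domain are irrelevant.\<close>

type_synonym ('a, 'n) chart = "'a set \<times> ('a \<Rightarrow> real^'n)"

abbreviation chart_inv :: "('a, 'n) chart \<Rightarrow> real^'n \<Rightarrow> 'a"
  where "chart_inv c \<equiv> inv_into (fst c) (snd c)"

definition transition :: "('a, 'n) chart \<Rightarrow> ('a, 'n) chart \<Rightarrow> real^'n \<Rightarrow> real^'n"
  where "transition c c' = snd c' \<circ> chart_inv c"

definition smooth_atlas :: "'a topology \<Rightarrow> ('a, 'n::finite) chart set \<Rightarrow> bool"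
  where "smooth_atlas X \<A> \<longleftrightarrow>
    (\<Union>c\<in>\<A>. fst c) = topspace X \<and>
    (\<forall>c\<in>\<A>. openin X (fst c) \<and> open (snd c ` fst c) \<and>
       homeomorphic_map (subtopology X (fst c)) (top_of_set (snd c ` fst c)) (snd c)) \<and>
    (\<forall>c\<in>\<A>. \<forall>c'\<in>\<A>. smooth_on (snd c ` (fst c \<inter> fst c')) (transition c c'))"

section \<open>Riemannian manifolds\<close>

text \<open>The Riemannian metric is given by its Gram matrices \<open>g\<^sub>i\<^sub>j\<close> in the charts of the atlas, as
  functions of the coordinates.\<close>

record ('a, 'n) riemannian =
  underlying :: "'a topology"
  atlas :: "('a, 'n) chart set"
  gram :: "('a, 'n) chart \<Rightarrow> real^'n \<Rightarrow> real^'n^'n"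

definition ip :: "real^'n^'n \<Rightarrow> real^'n \<Rightarrow> real^'n \<Rightarrow> real"
  where "ip g u v = u \<bullet> (g *v v)"

definition riemannian_manifold :: "('a, 'n::finite) riemannian \<Rightarrow> bool"
  where "riemannian_manifold M \<longleftrightarrow>
    Hausdorff_space (underlying M) \<and> second_countable (underlying M) \<and>
    smooth_atlas (underlying M) (atlas M) \<and>
    (\<forall>c\<in>atlas M. smooth_on (snd c ` fst c) (gram M c) \<and>
       (\<forall>x\<in>snd c ` fst c.
          (\<forall>u v. ip (gram M c x) u v = ip (gram M c x) v u) \<and>
          (\<forall>u. u \<noteq> 0 \<longrightarrow> ip (gram M c x) u u > 0))) \<and>
    (\<forall>c\<in>atlas M. \<forall>c'\<in>atlas M. \<forall>x\<in>snd c ` (fst c \<inter> fst c'). \<forall>u v.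
       ip (gram M c x) u v =
       ip (gram M c' (transition c c' x))
          (dirderiv (transition c c') x u) (dirderiv (transition c c') x v))"

text \<open>The vector representing the linear form \<open>\<lambda>\<close> with respect to \<open>g\<close> (raising the index).\<close>

definition sharp :: "real^'n^'n \<Rightarrow> (real^'n \<Rightarrow> real) \<Rightarrow> real^'n"
  where "sharp g l = matrix_inv g *v (\<chi> i. l (axis i 1))"

definition gradient :: "(real^'n \<Rightarrow> real^'n^'n) \<Rightarrow> (real^'n \<Rightarrow> real) \<Rightarrow> real^'n \<Rightarrow> real^'n"
  where "gradient g \<phi> x = sharp (g x) (dirderiv \<phi> x)"

text \<open>The trace \<open>g\<^sup>i\<^sup>j b\<^sub>i\<^sub>j\<close> of a bilinear map; by \<open>metric_trace_orthonormal\<close> below it is the sum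
  of \<open>b (e\<^sub>i, e\<^sub>i)\<close> over any \<open>g\<close>-orthonormal basis.\<close>

definition metric_trace :: "real^'n^'n \<Rightarrow> (real^'n \<Rightarrow> real^'n \<Rightarrow> 'v::real_vector) \<Rightarrow> 'v"
  where "metric_trace g b =
    (\<Sum>i\<in>UNIV. \<Sum>j\<in>UNIV. (matrix_inv g $ i $ j) *\<^sub>R b (axis i 1) (axis j 1))"

text \<open>The Levi-Civita connection: \<open>christoffel g x u v\<close> is the vector \<open>u\<^sup>i v\<^sup>j \<Gamma>\<^sup>k\<^sub>i\<^sub>j\<close>, given by the
  Koszul formula for the coordinate-constant vector fields \<open>u\<close> and \<open>v\<close>.\<close>

definition christoffel :: "(real^'n \<Rightarrow> real^'n^'n) \<Rightarrow> real^'n \<Rightarrow> real^'n \<Rightarrow> real^'n \<Rightarrow> real^'n"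
  where "christoffel g x u v = sharp (g x) (\<lambda>w.
    (dirderiv (\<lambda>y. ip (g y) v w) x u + dirderiv (\<lambda>y. ip (g y) u w) x v
      - dirderiv (\<lambda>y. ip (g y) u v) x w) / 2)"

definition cov :: "(real^'n \<Rightarrow> real^'n^'n) \<Rightarrow> real^'n \<Rightarrow> real^'n \<Rightarrow> (real^'n \<Rightarrow> real^'n) \<Rightarrow> real^'n"
  where "cov g x u W = dirderiv W x u + christoffel g x u (W x)"

text \<open>\<open>R(u,v)w = \<nabla>\<^sub>u \<nabla>\<^sub>v w - \<nabla>\<^sub>v \<nabla>\<^sub>u w\<close>, with \<open>u\<close>, \<open>v\<close>, \<open>w\<close> extended to constant (hence commuting)
  vector fields in the chart. With this sign, round spheres have positive sectional curvature.\<close>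

definition curvature ::
  "(real^'n \<Rightarrow> real^'n^'n) \<Rightarrow> real^'n \<Rightarrow> real^'n \<Rightarrow> real^'n \<Rightarrow> real^'n \<Rightarrow> real^'n"
  where "curvature g x u v w =
    cov g x u (\<lambda>y. cov g y v (\<lambda>_. w)) - cov g x v (\<lambda>y. cov g y u (\<lambda>_. w))"

definition sectional_curvature ::
  "(real^'n \<Rightarrow> real^'n^'n) \<Rightarrow> real^'n \<Rightarrow> real^'n \<Rightarrow> real^'n \<Rightarrow> real"
  where "sectional_curvature g x u v =
    ip (g x) (curvature g x u v v) u /
    (ip (g x) u u * ip (g x) v v - (ip (g x) u v)\<^sup>2)"

definition constant_sectional_curvature :: "('a, 'n::finite) riemannian \<Rightarrow> real \<Rightarrow> bool"
  where "constant_sectional_curvature N k \<longleftrightarrow>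
    (\<forall>d\<in>atlas N. \<forall>x\<in>snd d ` fst d. \<forall>u v. u \<noteq> v \<and> independent {u, v} \<longrightarrow>
       sectional_curvature (gram N d) x u v = k)"

section \<open>Submanifolds\<close>

definition local_dom :: "('a, 'm) chart \<Rightarrow> ('b, 'n) chart \<Rightarrow> ('a \<Rightarrow> 'b) \<Rightarrow> (real^'m) set"
  where "local_dom c d f = snd c ` (fst c \<inter> f -` fst d)"

definition local_rep :: "('a, 'm) chart \<Rightarrow> ('b, 'n) chart \<Rightarrow> ('a \<Rightarrow> 'b) \<Rightarrow> real^'m \<Rightarrow> real^'n"
  where "local_rep c d f = snd d \<circ> f \<circ> chart_inv c"

text \<open>A pointwise condition on (metric of \<open>M\<close>, metric of \<open>N\<close>, map) in coordinates,
  required in all charts at all points.\<close>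

definition in_charts ::
  "('a, 'm) riemannian \<Rightarrow> ('b, 'n) riemannian \<Rightarrow> ('a \<Rightarrow> 'b) \<Rightarrow>
   ((real^'m \<Rightarrow> real^'m^'m) \<Rightarrow> (real^'n \<Rightarrow> real^'n^'n) \<Rightarrow> (real^'m \<Rightarrow> real^'n) \<Rightarrow> real^'m \<Rightarrow> bool) \<Rightarrow> bool"
  where "in_charts M N f P \<longleftrightarrow>
    (\<forall>c\<in>atlas M. \<forall>d\<in>atlas N. \<forall>x\<in>local_dom c d f.
       P (gram M c) (gram N d) (local_rep c d f) x)"

definition smooth_map ::
  "('a, 'm::finite) riemannian \<Rightarrow> ('b, 'n::finite) riemannian \<Rightarrow> ('a \<Rightarrow> 'b) \<Rightarrow> bool"
  where "smooth_map M N f \<longleftrightarrow>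
    continuous_map (underlying M) (underlying N) f \<and>
    (\<forall>c\<in>atlas M. \<forall>d\<in>atlas N. smooth_on (local_dom c d f) (local_rep c d f))"

definition isometric_immersion ::
  "('a, 'm::finite) riemannian \<Rightarrow> ('b, 'n::finite) riemannian \<Rightarrow> ('a \<Rightarrow> 'b) \<Rightarrow> bool"
  where "isometric_immersion M N f \<longleftrightarrow> smooth_map M N f \<and>
    in_charts M N f (\<lambda>g h F x. inj (dirderiv F x) \<and>
      (\<forall>u v. ip (g x) u v = ip (h (F x)) (dirderiv F x u) (dirderiv F x v)))"

text \<open>In the rest of this section \<open>g\<close>, \<open>h\<close> are metrics in coordinates of the submanifold and the
  ambient manifold, \<open>F\<close> is the immersion in coordinates, and vector fields along \<open>F\<close> are functions
  of the coordinates of the submanifold.\<close>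

type_synonym 'n metric_field = "real^'n \<Rightarrow> real^'n^'n"

definition pullback_cov ::
  "'n metric_field \<Rightarrow> (real^'m \<Rightarrow> real^'n) \<Rightarrow> real^'m \<Rightarrow> real^'m \<Rightarrow> (real^'m \<Rightarrow> real^'n) \<Rightarrow> real^'n"
  where "pullback_cov h F x u W = dirderiv W x u + christoffel h (F x) (dirderiv F x u) (W x)"

definition normal_part ::
  "'m metric_field \<Rightarrow> 'n metric_field \<Rightarrow> (real^'m \<Rightarrow> real^'n) \<Rightarrow> real^'m \<Rightarrow> real^'n \<Rightarrow> real^'n"
  where "normal_part g h F x w =
    w - dirderiv F x (sharp (g x) (\<lambda>u. ip (h (F x)) w (dirderiv F x u)))"

definition second_ff ::
  "'m metric_field \<Rightarrow> 'n metric_field \<Rightarrow> (real^'m \<Rightarrow> real^'n) \<Rightarrow> real^'m \<Rightarrow> real^'m \<Rightarrow> real^'m \<Rightarrow> real^'n"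
  where "second_ff g h F x u v =
    normal_part g h F x (pullback_cov h F x u (\<lambda>y. dirderiv F y v))"

text \<open>\<open>A\<^sub>\<xi> u\<close> is determined by \<open>\<langle>A\<^sub>\<xi> u, v\<rangle> = \<langle>B(u,v), \<xi>\<rangle>\<close>.\<close>

definition shape_op ::
  "'m metric_field \<Rightarrow> 'n metric_field \<Rightarrow> (real^'m \<Rightarrow> real^'n) \<Rightarrow> real^'m \<Rightarrow> real^'n \<Rightarrow> real^'m \<Rightarrow> real^'m"
  where "shape_op g h F x \<xi> u = sharp (g x) (\<lambda>v. ip (h (F x)) (second_ff g h F x u v) \<xi>)"

definition normal_cov ::
  "'m metric_field \<Rightarrow> 'n metric_field \<Rightarrow> (real^'m \<Rightarrow> real^'n) \<Rightarrow> real^'m \<Rightarrow> real^'m \<Rightarrow>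
   (real^'m \<Rightarrow> real^'n) \<Rightarrow> real^'n"
  where "normal_cov g h F x u W = normal_part g h F x (pullback_cov h F x u W)"

definition mean_curvature ::
  "'m metric_field \<Rightarrow> 'n metric_field \<Rightarrow> (real^'m \<Rightarrow> real^'n) \<Rightarrow> real^'m \<Rightarrow> real^'n"
  where "mean_curvature g h F x = (1 / real CARD('m)) *\<^sub>R metric_trace (g x) (second_ff g h F x)"

text \<open>The trace of the second covariant derivative
  \<open>(u, v) \<mapsto> \<nabla>\<^sup>\<bottom>\<^sub>u \<nabla>\<^sup>\<bottom>\<^sub>v W - \<nabla>\<^sup>\<bottom>\<^bsub>\<nabla>\<^sub>u v\<^esub> W\<close>, which is tensorial in \<open>u\<close> and \<open>v\<close>, so that it may be
  computed with constant vector fields in the chart, for which \<open>\<nabla>\<^sub>u v\<close> is the Christoffel term.\<close>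

definition normal_laplacian ::
  "'m metric_field \<Rightarrow> 'n metric_field \<Rightarrow> (real^'m \<Rightarrow> real^'n) \<Rightarrow> (real^'m \<Rightarrow> real^'n) \<Rightarrow>
   real^'m \<Rightarrow> real^'n"
  where "normal_laplacian g h F W x = metric_trace (g x) (\<lambda>u v.
    normal_cov g h F x u (\<lambda>y. normal_cov g h F y v W)
    - normal_cov g h F x (cov g x u (\<lambda>_. v)) W)"

definition minimal_submanifold ::
  "('a, 'm::finite) riemannian \<Rightarrow> ('b, 'n::finite) riemannian \<Rightarrow> ('a \<Rightarrow> 'b) \<Rightarrow> bool"
  where "minimal_submanifold M N f \<longleftrightarrow>
    in_charts M N f (\<lambda>g h F x. mean_curvature g h F x = 0)"

definition pseudo_umbilical ::
  "('a, 'm::finite) riemannian \<Rightarrow> ('b, 'n::finite) riemannian \<Rightarrow> ('a \<Rightarrow> 'b) \<Rightarrow> bool"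
  where "pseudo_umbilical M N f \<longleftrightarrow>
    in_charts M N f (\<lambda>g h F x. let H = mean_curvature g h F x in
      \<forall>u. shape_op g h F x H u = ip (h (F x)) H H *\<^sub>R u)"

text \<open>Biharmonicity of a submanifold of a manifold of constant sectional curvature \<open>k\<close>: the normal
  and the tangential part of the vanishing of the bitension field.\<close>

definition biharmonic_submanifold ::
  "real \<Rightarrow> ('a, 'm::finite) riemannian \<Rightarrow> ('b, 'n::finite) riemannian \<Rightarrow> ('a \<Rightarrow> 'b) \<Rightarrow> bool"
  where "biharmonic_submanifold k M N f \<longleftrightarrow>
    in_charts M N f (\<lambda>g h F x. let H = mean_curvature g h F; m = real CARD('m) in
      normal_laplacian g h F H x
        - metric_trace (g x) (\<lambda>u v. second_ff g h F x (shape_op g h F x (H x) u) v)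
        + (m * k) *\<^sub>R H x = 0 \<and>
      m *\<^sub>R gradient g (\<lambda>y. ip (h (F y)) (H y) (H y)) x
        + 4 *\<^sub>R metric_trace (g x) (\<lambda>u v. shape_op g h F x (normal_cov g h F x u H) v) = 0)"

section \<open>The metric trace in orthonormal bases\<close>

lemma metric_trace_orthonormal:
  fixes g :: "real^'n^'n" and b :: "real^'n \<Rightarrow> real^'n \<Rightarrow> 'v::real_vector" and e :: "'n \<Rightarrow> real^'n"
  assumes b1: "\<And>v. linear (\<lambda>u. b u v)" and b2: "\<And>u. linear (b u)"
    and on: "\<And>i j. ip g (e i) (e j) = (if i = j then 1 else 0)"
  shows "metric_trace g b = (\<Sum>i\<in>UNIV. b (e i) (e i))"
proof -
  define E where "E = (\<chi> i j. e j $ i)"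
  have "(transpose E ** (g ** E)) $ i $ j = ip g (e i) (e j)" for i j
    by (simp add: E_def ip_def matrix_matrix_mult_def matrix_vector_mult_def transpose_def inner_vec_def)
  then have 1: "transpose E ** (g ** E) = mat 1"
    by (simp add: vec_eq_iff mat_def on)
  then have "(g ** E) ** transpose E = mat 1"
    by (rule matrix_left_right_inverse1)
  then have 2: "g ** (E ** transpose E) = mat 1"
    by (simp add: matrix_mul_assoc)
  then have 3: "(E ** transpose E) ** g = mat 1"
    by (rule matrix_left_right_inverse1)
  have "matrix_inv g ** g = mat 1"
    unfolding matrix_inv_def using someI[of "\<lambda>A'. g ** A' = mat 1 \<and> A' ** g = mat 1"] 2 3 by blast
  then have inv: "matrix_inv g = E ** transpose E"
    using 2 by (metis matrix_mul_assoc matrix_mul_lid matrix_mul_rid)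
  have exp: "e k = (\<Sum>i\<in>UNIV. (e k $ i) *\<^sub>R axis i 1)" for k
    by (simp add: vec_eq_iff axis_def if_distrib cong: if_cong)
  have "b (e k) (e k) =
    (\<Sum>i\<in>UNIV. \<Sum>j\<in>UNIV. (e k $ i * e k $ j) *\<^sub>R b (axis i 1) (axis j 1))" for k
  proof -
    have "b (e k) (e k) = (\<Sum>i\<in>UNIV. (e k $ i) *\<^sub>R b (axis i 1) (e k))"
      by (subst exp) (simp add: linear_sum[OF b1] linear_cmul[OF b1])
    moreover have "b u (e k) = (\<Sum>j\<in>UNIV. (e k $ j) *\<^sub>R b u (axis j 1))" for u
      by (subst exp) (simp add: linear_sum[OF b2] linear_cmul[OF b2])
    ultimately show ?thesis
      by (simp add: scaleR_sum_right)
  qed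
  then have "(\<Sum>k\<in>UNIV. b (e k) (e k)) =
    (\<Sum>k\<in>UNIV. \<Sum>i\<in>UNIV. \<Sum>j\<in>UNIV. (e k $ i * e k $ j) *\<^sub>R b (axis i 1) (axis j 1))"
    by simp
  also have "\<dots> = (\<Sum>i\<in>UNIV. \<Sum>k\<in>UNIV. \<Sum>j\<in>UNIV. (e k $ i * e k $ j) *\<^sub>R b (axis i 1) (axis j 1))"
    by (rule sum.swap)
  also have "\<dots> = (\<Sum>i\<in>UNIV. \<Sum>j\<in>UNIV. \<Sum>k\<in>UNIV. (e k $ i * e k $ j) *\<^sub>R b (axis i 1) (axis j 1))"
    by (intro sum.cong refl sum.swap)
  also have "\<dots> = metric_trace g b"
    by (simp add: metric_trace_def inv E_def matrix_matrix_mult_def transpose_def scaleR_sum_left)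
  finally show ?thesis by simp
qed

end

(* The normal part of the biharmonic equation and pseudo-umbilicity make H a solution of an
   overdetermined system wherever H does not vanish. Suppose H is not identically 0 and restrict to
   an open set where r = |H| > 0 and dr is nowhere 0 (r cannot be locally constant: pairing the
   normal equation with H would give 0 >= 4 r^2 (r^2 - k) > 0). In codimension two there is an
   adapted normal frame e5 = H/r, e6; write D e5 = - r dF + w eta e6 with a unit form eta dual to E.
   The Codazzi equations force dr = t w eta and A_6 = t (Id - 4 eta eta), then
   nabla E = q (Id - eta eta), so along E
     r' = t w,  t' = - r w - 4 t q,  w' = - 3 q w - 2 t w^2 / r,  q' = 3 t^2 - r^2 - k - q^2,
   and the component of the normal equation along H becomes the algebraic constraint
     w^2 (r^2 + t^2) + 2 t q w r + 2 r^2 (r^2 - k) = 0.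
   Differentiating the constraint twice along E leaves a polynomial relation between
   x = (t/r)^2 and m = 1 + x + 2 t q / (r w) that no admissible signs satisfy when k <= 0. *)

theory Submission
  imports Defs
begin

section \<open>Smooth maps\<close>

text \<open>The contradiction is local: it suffices that a chart domain on which \<open>H\<close>
  has no zeros is empty, and every later shrinking of the domain only has to keep one point.
  Derivatives are taken with the ambient connection \<open>D\<close> along \<open>F\<close>; the
  Weingarten, Codazzi and Gauss identities are components of \<open>D e5\<close>,
  \<open>D e6\<close>, \<open>D Eh\<close> and of their commutators, which constant curvature makes
  explicit. No orthonormal frame of the submanifold is chosen: traces are split into multiples of
  the metric, whose trace is 4, and rank-one terms. The direction E is not chosen either; it is dual
  to the connection form of the normal bundle, which cannot vanish because Codazzi would then kill
  dr. The sign of k enters twice, in the nonconstancy of r and at the very end. After scaling, four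
  unknowns remain at a point, and the constraint with its two derivatives gives three equations; the
  curve of solutions left in the (x, m) plane misses the region that the signs of r^2 and k
  allow.\<close>

lemma dirderiv_works: "f differentiable (at x) \<Longrightarrow> (f has_derivative (dirderiv f x)) (at x)"
  using frechet_derivative_works by blast

lemma dirderiv_eq: "(f has_derivative f') (at x) \<Longrightarrow> dirderiv f x v = f' v"
  using frechet_derivative_at by metis

lemma linear_dirderiv: "f differentiable (at x) \<Longrightarrow> linear (dirderiv f x)"
  by (rule linear_frechet_derivative)

text \<open>\<open>frechet_derivative\<close> is a choice among all candidates, and locally equal
  functions have the same candidates; so the equality holds even where neither function is
  differentiable.\<close>

lemma dirderiv_cong:
  assumes "open S" "x \<in> S" "\<And>y. y \<in> S \<Longrightarrow> f y = g y"
  shows "dirderiv f x v = dirderiv g x v"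
proof -
  have "(f has_derivative D) (at x) \<longleftrightarrow> (g has_derivative D) (at x)" for D
    using assms has_derivative_transform_within_open[of f D x UNIV S g]
      has_derivative_transform_within_open[of g D x UNIV S f] by auto
  then show ?thesis by (simp add: frechet_derivative_def)
qed

lemma differentiable_cong:
  assumes "open S" "x \<in> S" "\<And>y. y \<in> S \<Longrightarrow> f y = g y" "f differentiable (at x)"
  shows "g differentiable (at x)"
  using assms has_derivative_transform_within_open[of f _ x UNIV S g]
  unfolding differentiable_def by blast

lemma dirderiv_bounded_linear:
  assumes "bounded_linear L" "f differentiable (at x)"
  shows "dirderiv (\<lambda>x. L (f x)) x v = L (dirderiv f x v)"
  using dirderiv_eq[OF bounded_linear.has_derivative[OF assms(1) dirderiv_works[OF assms(2)]]] .

lemma dirderiv_bilinear: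
  assumes "bounded_bilinear p" "f differentiable (at x)" "g differentiable (at x)"
  shows "dirderiv (\<lambda>x. p (f x) (g x)) x v = p (f x) (dirderiv g x v) + p (dirderiv f x v) (g x)"
  using dirderiv_eq[OF bounded_bilinear.FDERIV[OF assms(1) dirderiv_works[OF assms(2)]
    dirderiv_works[OF assms(3)]]] .

lemma dirderiv_add:
  assumes "f differentiable (at x)" "g differentiable (at x)"
  shows "dirderiv (\<lambda>x. f x + g x) x v = dirderiv f x v + dirderiv g x v"
  using dirderiv_eq[OF has_derivative_add[OF dirderiv_works[OF assms(1)] dirderiv_works[OF assms(2)]]] .

lemma dirderiv_compose:
  assumes "f differentiable (at x)" "g differentiable (at (f x))"
  shows "dirderiv (\<lambda>x. g (f x)) x v = dirderiv g (f x) (dirderiv f x v)"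
  using dirderiv_eq[OF has_derivative_compose[OF dirderiv_works[OF assms(1)] dirderiv_works[OF assms(2)]]] .

text \<open>\<open>Ck_on\<close> differentiates in constant directions only; this expansion reduces
  a direction that varies with the point to finitely many constant ones.\<close>

lemma dirderiv_euclidean_expansion:
  fixes f :: "'a::euclidean_space \<Rightarrow> 'b::real_normed_vector"
  assumes "f differentiable (at x)"
  shows "dirderiv f x v = (\<Sum>b\<in>Basis. (v \<bullet> b) *\<^sub>R dirderiv f x b)"
proof -
  interpret linear "dirderiv f x" using assms by (rule linear_dirderiv)
  have "dirderiv f x v = dirderiv f x (\<Sum>b\<in>Basis. (v \<bullet> b) *\<^sub>R b)"
    by (simp add: euclidean_representation)
  then show ?thesis by (simp add: sum scale)
qed

section \<open>Closure properties of maps of finite differentiability order\<close>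

lemma Ck_on_cong:
  assumes "open S" "\<And>x. x \<in> S \<Longrightarrow> f x = g x" "Ck_on k S f"
  shows "Ck_on k S g"
  using assms(2,3)
proof (induction k arbitrary: f g)
  case 0
  then show ?case using continuous_on_cong by force
next
  case (Suc k)
  have "Ck_on k S (\<lambda>x. dirderiv g x v)" for v
  proof (rule Suc.IH)
    show "dirderiv f x v = dirderiv g x v" if "x \<in> S" for x
      by (rule dirderiv_cong[OF assms(1) that Suc.prems(1)])
    show "Ck_on k S (\<lambda>x. dirderiv f x v)" using Suc.prems(2) by simp
  qed
  then show ?case
    using Suc.prems differentiable_cong[OF assms(1), of _ f g] by auto
qed

lemma Ck_on_SucD: "Ck_on (Suc k) S f \<Longrightarrow> Ck_on k S f"
proof (induction k arbitrary: f)
  case 0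
  then show ?case
    by (auto intro!: continuous_at_imp_continuous_on differentiable_imp_continuous_within)
next
  case (Suc k)
  then have "\<forall>v. Ck_on k S (\<lambda>x. dirderiv f x v)"
    using Ck_on.simps(2) by blast
  then show ?case using Suc.prems by simp
qed

lemma Ck_on_bounded_linear:
  assumes "open S" "bounded_linear L"
  shows "Ck_on k S f \<Longrightarrow> Ck_on k S (\<lambda>x. L (f x))"
proof (induction k arbitrary: f)
  case 0
  then show ?case using bounded_linear.continuous_on[OF assms(2)] by auto
next
  case (Suc k)
  have "Ck_on k S (\<lambda>x. dirderiv (\<lambda>x. L (f x)) x v)" for v
    by (rule Ck_on_cong[OF assms(1) _ Suc.IH[of "\<lambda>x. dirderiv f x v"]])
      (use Suc.prems in \<open>simp_all add: dirderiv_bounded_linear[OF assms(2)]\<close>)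
  moreover have "(\<lambda>x. L (f x)) differentiable at x" if "x \<in> S" for x
    by (rule Derivative.differentiableI[OF bounded_linear.has_derivative[OF assms(2) dirderiv_works]])
      (use Suc.prems that in auto)
  ultimately show ?case by auto
qed

lemma Ck_on_const: "Ck_on k S (\<lambda>_. c)"
  by (induction k arbitrary: c) auto

lemma Ck_on_add:
  assumes "open S"
  shows "Ck_on k S f \<Longrightarrow> Ck_on k S g \<Longrightarrow> Ck_on k S (\<lambda>x. f x + g x)"
proof (induction k arbitrary: f g)
  case 0
  then show ?case by (auto intro: continuous_intros)
next
  case (Suc k)
  have "Ck_on k S (\<lambda>x. dirderiv (\<lambda>x. f x + g x) x v)" for v
    by (rule Ck_on_cong[OF assms _ Suc.IH[of "\<lambda>x. dirderiv f x v" "\<lambda>x. dirderiv g x v"]])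
      (use Suc.prems in \<open>simp_all add: dirderiv_add\<close>)
  then show ?case using Suc.prems by auto
qed

text \<open>The Leibniz rule keeps an undifferentiated factor in each term, so the induction uses at
  order \<open>k\<close> both the derivatives and, through \<open>Ck_on_SucD\<close>, the factors
  themselves.\<close>

lemma Ck_on_bilinear:
  assumes "open S" "bounded_bilinear p"
  shows "Ck_on k S f \<Longrightarrow> Ck_on k S g \<Longrightarrow> Ck_on k S (\<lambda>x. p (f x) (g x))"
proof (induction k arbitrary: f g)
  case 0
  then show ?case using bounded_bilinear.continuous_on[OF assms(2)] by auto
next
  case (Suc k)
  have "Ck_on k S (\<lambda>x. p (f x) (dirderiv g x v) + p (dirderiv f x v) (g x))" for v
  proof (intro Ck_on_add[OF assms(1)] Suc.IH)
    show "Ck_on k S f" "Ck_on k S g" using Suc.prems Ck_on_SucD by blast+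
    show "Ck_on k S (\<lambda>x. dirderiv f x v)" "Ck_on k S (\<lambda>x. dirderiv g x v)" using Suc.prems by simp_all
  qed
  then have "Ck_on k S (\<lambda>x. dirderiv (\<lambda>x. p (f x) (g x)) x v)" for v
    by (rule Ck_on_cong[OF assms(1), rotated])
      (use Suc.prems in \<open>auto simp: dirderiv_bilinear[OF assms(2)]\<close>)
  moreover have "(\<lambda>x. p (f x) (g x)) differentiable at x" if "x \<in> S" for x
    by (rule Derivative.differentiableI[OF bounded_bilinear.FDERIV[OF assms(2) dirderiv_works dirderiv_works]])
      (use Suc.prems that in auto)
  ultimately show ?case by auto
qed

lemma Ck_on_sum:
  assumes "open S" "\<And>i. i \<in> I \<Longrightarrow> Ck_on k S (f i)"
  shows "Ck_on k S (\<lambda>x. \<Sum>i\<in>I. f i x)"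
  using assms(2)
  by (induction I rule: infinite_finite_induct) (auto intro: Ck_on_const Ck_on_add[OF assms(1)])

text \<open>The chain rule differentiates \<open>g\<close> in the direction
  \<open>dirderiv f x v\<close>, which moves with \<open>x\<close>; expanding it in
  \<open>Basis\<close> is why the middle space is Euclidean.\<close>

lemma Ck_on_compose:
  fixes f :: "'a::real_normed_vector \<Rightarrow> 'b::euclidean_space" and g :: "'b \<Rightarrow> 'c::real_normed_vector"
  assumes "open S" "f ` S \<subseteq> T"
  shows "Ck_on k S f \<Longrightarrow> Ck_on k T g \<Longrightarrow> Ck_on k S (\<lambda>x. g (f x))"
proof (induction k arbitrary: g)
  case 0
  then show ?case using assms(2) by (auto intro: continuous_on_compose2)
next
  case (Suc k)
  have d: "f differentiable at x" "g differentiable at (f x)" if "x \<in> S" for x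
    using Suc.prems assms(2) that by auto
  have "Ck_on k S (\<lambda>x. \<Sum>b\<in>Basis. (dirderiv f x v \<bullet> b) *\<^sub>R dirderiv g (f x) b)" for v
  proof (intro Ck_on_sum[OF assms(1)] Ck_on_bilinear[OF assms(1) bounded_bilinear_scaleR])
    fix b :: 'b
    show "Ck_on k S (\<lambda>x. dirderiv f x v \<bullet> b)"
      by (rule Ck_on_bounded_linear[OF assms(1) bounded_linear_inner_left]) (use Suc.prems in simp)
    show "Ck_on k S (\<lambda>x. dirderiv g (f x) b)"
      by (rule Suc.IH) (use Suc.prems Ck_on_SucD[of k S f] in simp_all)
  qed
  then have "Ck_on k S (\<lambda>x. dirderiv (\<lambda>x. g (f x)) x v)" for v
    by (rule Ck_on_cong[OF assms(1), rotated])
      (simp add: d dirderiv_compose flip: dirderiv_euclidean_expansion)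
  moreover have "(\<lambda>x. g (f x)) differentiable at x" if "x \<in> S" for x
    by (rule Derivative.differentiableI[OF has_derivative_compose[OF dirderiv_works dirderiv_works]])
      (use d that in auto)
  ultimately show ?case by auto
qed

text \<open>The derivative is a product of \<open>dirderiv f x v\<close> and two copies of the
  inverse itself, so the statement at order \<open>k\<close> feeds the step to
  \<open>Suc k\<close>.\<close>

lemma Ck_on_inverse:
  fixes f :: "'a::real_normed_vector \<Rightarrow> real"
  assumes "open S" "\<And>x. x \<in> S \<Longrightarrow> f x \<noteq> 0"
  shows "Ck_on k S f \<Longrightarrow> Ck_on k S (\<lambda>x. inverse (f x))"
proof (induction k)
  case 0
  then show ?case using assms by (auto intro: continuous_intros)
next
  case (Suc k)
  have d: "((\<lambda>x. inverse (f x)) has_derivative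
      (\<lambda>v. - (inverse (f x) * dirderiv f x v * inverse (f x)))) (at x)" if "x \<in> S" for x
    by (rule Deriv.has_derivative_inverse[where f = f, OF assms(2)[OF that] dirderiv_works])
      (use Suc.prems that in simp)
  have i: "Ck_on k S (\<lambda>x. inverse (f x))" using Suc Ck_on_SucD by blast
  have i': "Ck_on k S (\<lambda>x. (- 1) * (inverse (f x) * dirderiv f x v * inverse (f x)))" for v
    by (intro Ck_on_bilinear[OF assms(1) bounded_bilinear_mult] Ck_on_const i)
      (use Suc.prems in simp)
  have "Ck_on k S (\<lambda>x. dirderiv (\<lambda>x. inverse (f x)) x v)" for v
    by (rule Ck_on_cong[OF assms(1) _ i'[of v]]) (simp add: dirderiv_eq[OF d])
  then show ?case using d by (auto simp: differentiable_def)
qed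

text \<open>As for the inverse: the derivative \<open>f' / (2 sqrt f)\<close> involves the root
  itself only at the previous order.\<close>

lemma Ck_on_sqrt:
  fixes f :: "'a::real_normed_vector \<Rightarrow> real"
  assumes "open S" "\<And>x. x \<in> S \<Longrightarrow> f x > 0"
  shows "Ck_on k S f \<Longrightarrow> Ck_on k S (\<lambda>x. sqrt (f x))"
proof (induction k)
  case 0
  then show ?case using assms by (auto intro: continuous_intros)
next
  case (Suc k)
  have d: "((\<lambda>x. sqrt (f x)) has_derivative
      (\<lambda>v. dirderiv f x v * (inverse (sqrt (f x)) / 2))) (at x)" if "x \<in> S" for x
    by (rule has_derivative_real_sqrt[of f x "dirderiv f x" UNIV, OF assms(2)[OF that] dirderiv_works])
      (use Suc.prems that in simp)
  have i: "Ck_on k S (\<lambda>x. sqrt (f x))" using Suc Ck_on_SucD by blast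
  have i': "Ck_on k S (\<lambda>x. dirderiv f x v * (inverse (sqrt (f x)) * (1 / 2)))" for v
    by (intro Ck_on_bilinear[OF assms(1) bounded_bilinear_mult] Ck_on_const Ck_on_inverse[OF assms(1)] i)
      (use Suc.prems assms(2) less_imp_neq in fastforce)+
  have "Ck_on k S (\<lambda>x. dirderiv (\<lambda>x. sqrt (f x)) x v)" for v
    by (rule Ck_on_cong[OF assms(1) _ i'[of v]]) (simp add: dirderiv_eq[OF d])
  then show ?case using d by (auto simp: differentiable_def)
qed

section \<open>Smooth maps\<close>

lemma Ck_on_subset: "Ck_on k S f \<Longrightarrow> T \<subseteq> S \<Longrightarrow> Ck_on k T f"
  by (induction k arbitrary: f) (auto intro: continuous_on_subset)

lemma smooth_on_subset: "smooth_on S f \<Longrightarrow> T \<subseteq> S \<Longrightarrow> smooth_on T f"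
  by (auto simp: smooth_on_def intro: Ck_on_subset)

lemma smooth_on_differentiable: "smooth_on S f \<Longrightarrow> x \<in> S \<Longrightarrow> f differentiable (at x)"
  unfolding smooth_on_def by (metis Ck_on.simps(2))

lemma smooth_on_continuous: "smooth_on S f \<Longrightarrow> continuous_on S f"
  unfolding smooth_on_def by (metis Ck_on.simps(1))

lemma smooth_on_dirderiv: "smooth_on S f \<Longrightarrow> smooth_on S (\<lambda>x. dirderiv f x v)"
  unfolding smooth_on_def by (metis Ck_on.simps(2))

lemma smooth_on_cong: "smooth_on S f \<Longrightarrow> open S \<Longrightarrow> (\<And>x. x \<in> S \<Longrightarrow> f x = g x) \<Longrightarrow> smooth_on S g"
  unfolding smooth_on_def using Ck_on_cong by blast

lemma smooth_on_const: "smooth_on S (\<lambda>_. c)"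
  by (simp add: smooth_on_def Ck_on_const)

lemma smooth_on_ident: "smooth_on S (\<lambda>x. x)"
proof -
  have "Ck_on k S (\<lambda>x. x)" for k
    by (cases k) (auto simp: Ck_on_const)
  then show ?thesis by (simp add: smooth_on_def)
qed

lemma smooth_on_bounded_linear:
  "smooth_on S f \<Longrightarrow> open S \<Longrightarrow> bounded_linear L \<Longrightarrow> smooth_on S (\<lambda>x. L (f x))"
  unfolding smooth_on_def using Ck_on_bounded_linear by blast

lemma smooth_on_bilinear:
  "bounded_bilinear p \<Longrightarrow> open S \<Longrightarrow> smooth_on S f \<Longrightarrow> smooth_on S g \<Longrightarrow> smooth_on S (\<lambda>x. p (f x) (g x))"
  unfolding smooth_on_def using Ck_on_bilinear by blast

lemmas smooth_on_scaleR = smooth_on_bilinear[OF bounded_bilinear_scaleR]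
lemmas smooth_on_mult = smooth_on_bilinear[OF bounded_bilinear_mult]
lemmas smooth_on_inner = smooth_on_bilinear[OF bounded_bilinear_inner]

lemma smooth_on_add: "open S \<Longrightarrow> smooth_on S f \<Longrightarrow> smooth_on S g \<Longrightarrow> smooth_on S (\<lambda>x. f x + g x)"
  unfolding smooth_on_def using Ck_on_add by blast

lemma smooth_on_minus: "open S \<Longrightarrow> smooth_on S f \<Longrightarrow> smooth_on S (\<lambda>x. - f x)"
  by (rule smooth_on_bounded_linear[OF _ _ bounded_linear_minus[OF bounded_linear_ident]])

lemma smooth_on_diff: "open S \<Longrightarrow> smooth_on S f \<Longrightarrow> smooth_on S g \<Longrightarrow> smooth_on S (\<lambda>x. f x - g x)"
  using smooth_on_add[of S f "\<lambda>x. - g x"] smooth_on_minus[of S g] by simp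

lemma smooth_on_sum: "open S \<Longrightarrow> (\<And>i. i \<in> I \<Longrightarrow> smooth_on S (f i)) \<Longrightarrow> smooth_on S (\<lambda>x. \<Sum>i\<in>I. f i x)"
  unfolding smooth_on_def by (auto intro: Ck_on_sum)

lemma smooth_on_prod:
  fixes f :: "'i \<Rightarrow> 'a::real_normed_vector \<Rightarrow> real"
  assumes "open S" "\<And>i. i \<in> I \<Longrightarrow> smooth_on S (f i)"
  shows "smooth_on S (\<lambda>x. \<Prod>i\<in>I. f i x)"
  using assms(2)
  by (induction I rule: infinite_finite_induct) (auto intro: smooth_on_const smooth_on_mult[OF assms(1)])

lemma smooth_on_compose:
  fixes f :: "'a::real_normed_vector \<Rightarrow> 'b::euclidean_space" and g :: "'b \<Rightarrow> 'c::real_normed_vector"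
  shows "open S \<Longrightarrow> smooth_on S f \<Longrightarrow> smooth_on T g \<Longrightarrow> f ` S \<subseteq> T \<Longrightarrow> smooth_on S (\<lambda>x. g (f x))"
  unfolding smooth_on_def using Ck_on_compose by blast

lemma smooth_on_inverse:
  fixes f :: "'a::real_normed_vector \<Rightarrow> real"
  shows "open S \<Longrightarrow> smooth_on S f \<Longrightarrow> (\<And>x. x \<in> S \<Longrightarrow> f x \<noteq> 0) \<Longrightarrow> smooth_on S (\<lambda>x. inverse (f x))"
  unfolding smooth_on_def using Ck_on_inverse by blast

lemma smooth_on_divide:
  fixes f g :: "'a::real_normed_vector \<Rightarrow> real"
  assumes "open S" "smooth_on S f" "smooth_on S g" "\<And>x. x \<in> S \<Longrightarrow> g x \<noteq> 0"
  shows "smooth_on S (\<lambda>x. f x / g x)"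
  unfolding divide_inverse by (intro smooth_on_mult smooth_on_inverse assms)

lemma smooth_on_sqrt:
  fixes f :: "'a::real_normed_vector \<Rightarrow> real"
  shows "open S \<Longrightarrow> smooth_on S f \<Longrightarrow> (\<And>x. x \<in> S \<Longrightarrow> f x > 0) \<Longrightarrow> smooth_on S (\<lambda>x. sqrt (f x))"
  unfolding smooth_on_def using Ck_on_sqrt by blast

lemma smooth_on_nth: "open S \<Longrightarrow> smooth_on S f \<Longrightarrow> smooth_on S (\<lambda>x. f x $ i)"
  by (rule smooth_on_bounded_linear[OF _ _ bounded_linear_vec_nth])

lemma smooth_on_vec:
  fixes f :: "'a::real_normed_vector \<Rightarrow> real^'n"
  assumes "open S" "\<And>i. smooth_on S (\<lambda>x. f x $ i)"
  shows "smooth_on S f"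
proof -
  have "f x = (\<Sum>i\<in>UNIV. (f x $ i) *\<^sub>R axis i 1)" for x
    by (simp add: vec_eq_iff axis_def if_distrib cong: if_cong)
  then have "f = (\<lambda>x. \<Sum>i\<in>UNIV. (f x $ i) *\<^sub>R axis i 1)" by blast
  moreover have "smooth_on S (\<lambda>x. \<Sum>i\<in>UNIV. (f x $ i) *\<^sub>R axis i (1::real))"
    by (intro smooth_on_sum smooth_on_scaleR assms smooth_on_const)
  ultimately show ?thesis by metis
qed

lemma smooth_on_dirderiv_field:
  fixes f :: "'a::euclidean_space \<Rightarrow> 'b::real_normed_vector"
  assumes "open S" "smooth_on S f" "smooth_on S v"
  shows "smooth_on S (\<lambda>x. dirderiv f x (v x))"
proof (rule smooth_on_cong[OF _ assms(1)])
  show "smooth_on S (\<lambda>x. \<Sum>b\<in>Basis. (v x \<bullet> b) *\<^sub>R dirderiv f x b)"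
    by (intro smooth_on_sum smooth_on_scaleR smooth_on_inner smooth_on_const smooth_on_dirderiv assms)
  show "(\<Sum>b\<in>Basis. (v x \<bullet> b) *\<^sub>R dirderiv f x b) = dirderiv f x (v x)" if "x \<in> S" for x
    using dirderiv_euclidean_expansion[OF smooth_on_differentiable[OF assms(2) that]] by metis
qed

lemma linear_dirderiv_on: "x \<in> S \<Longrightarrow> smooth_on S \<phi> \<Longrightarrow> linear (dirderiv \<phi> x)"
  by (intro linear_dirderiv smooth_on_differentiable)

lemma dirderiv_mult:
  fixes \<phi> \<psi> :: "'a::real_normed_vector \<Rightarrow> real"
  assumes "x \<in> S" "smooth_on S \<phi>" "smooth_on S \<psi>"
  shows "dirderiv (\<lambda>y. \<phi> y * \<psi> y) x u = \<phi> x * dirderiv \<psi> x u + dirderiv \<phi> x u * \<psi> x"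
  by (rule dirderiv_bilinear[OF bounded_bilinear_mult]) (rule smooth_on_differentiable[OF assms(2,1)]
    smooth_on_differentiable[OF assms(3,1)])+

lemma dirderiv_minus:
  fixes \<phi> :: "'a::real_normed_vector \<Rightarrow> real"
  assumes "x \<in> S" "smooth_on S \<phi>"
  shows "dirderiv (\<lambda>y. - \<phi> y) x u = - dirderiv \<phi> x u"
  by (rule dirderiv_bounded_linear[OF bounded_linear_minus[OF bounded_linear_ident]
    smooth_on_differentiable[OF assms(2,1)]])

section \<open>Symmetry of second derivatives\<close>

lemma second_difference_mean_value:
  fixes f :: "'a::real_normed_vector \<Rightarrow> real"
  assumes "s > 0" and inS: "\<And>a b. 0 \<le> a \<Longrightarrow> a \<le> s \<Longrightarrow> 0 \<le> b \<Longrightarrow> b \<le> s \<Longrightarrow> x + a *\<^sub>R u + b *\<^sub>R v \<in> S"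
    and df: "\<And>y. y \<in> S \<Longrightarrow> f differentiable (at y)"
    and df': "\<And>y. y \<in> S \<Longrightarrow> (\<lambda>y. dirderiv f y u) differentiable (at y)"
  shows "\<exists>a b. 0 < a \<and> a < s \<and> 0 < b \<and> b < s \<and>
    f (x + s *\<^sub>R u + s *\<^sub>R v) - f (x + s *\<^sub>R u) - f (x + s *\<^sub>R v) + f x =
    s * s * dirderiv (\<lambda>y. dirderiv f y u) (x + a *\<^sub>R u + b *\<^sub>R v) v"
proof -
  have d1: "((\<lambda>a. f (x + a *\<^sub>R u + b *\<^sub>R v)) has_real_derivative dirderiv f (x + a *\<^sub>R u + b *\<^sub>R v) u) (at a)"
    if "0 \<le> a" "a \<le> s" "0 \<le> b" "b \<le> s" for a b
  proof -
    have L: "linear (dirderiv f (x + a *\<^sub>R u + b *\<^sub>R v))"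
      by (rule linear_dirderiv[OF df[OF inS[OF that]]])
    have "((\<lambda>a. x + a *\<^sub>R u + b *\<^sub>R v) has_derivative (\<lambda>c. c *\<^sub>R u)) (at a)"
      by (auto intro!: derivative_eq_intros)
    from has_derivative_compose[OF this dirderiv_works[OF df[OF inS[OF that]]]]
    show ?thesis by (simp add: has_field_derivative_def linear_cmul[OF L] mult_commute_abs)
  qed
  \<comment> \<open>The mean value theorem is applied to the difference of \<open>f\<close> along
    the two sides parallel to \<open>u\<close>, and afterwards to the \<open>u\<close>-derivative
    along \<open>v\<close>.\<close>
  have "((\<lambda>a. f (x + a *\<^sub>R u + s *\<^sub>R v) - f (x + a *\<^sub>R u)) has_real_derivative
      dirderiv f (x + a *\<^sub>R u + s *\<^sub>R v) u - dirderiv f (x + a *\<^sub>R u) u) (at a)"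
    if "0 \<le> a" "a \<le> s" for a
    using DERIV_diff[OF d1[of a s] d1[of a 0]] that \<open>s > 0\<close> by simp
  from MVT2[OF \<open>s > 0\<close> this] obtain a where a: "0 < a" "a < s"
    "f (x + s *\<^sub>R u + s *\<^sub>R v) - f (x + s *\<^sub>R u) - f (x + s *\<^sub>R v) + f x =
     s * (dirderiv f (x + a *\<^sub>R u + s *\<^sub>R v) u - dirderiv f (x + a *\<^sub>R u) u)"
    by (auto simp: algebra_simps)
  have "((\<lambda>b. dirderiv f (x + a *\<^sub>R u + b *\<^sub>R v) u) has_real_derivative
      dirderiv (\<lambda>y. dirderiv f y u) (x + a *\<^sub>R u + b *\<^sub>R v) v) (at b)"
    if "0 \<le> b" "b \<le> s" for b
  proof -
    have i: "x + a *\<^sub>R u + b *\<^sub>R v \<in> S" using inS a that by auto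
    have L: "linear (dirderiv (\<lambda>y. dirderiv f y u) (x + a *\<^sub>R u + b *\<^sub>R v))"
      by (rule linear_dirderiv[OF df'[OF i]])
    have "((\<lambda>b. x + a *\<^sub>R u + b *\<^sub>R v) has_derivative (\<lambda>c. c *\<^sub>R v)) (at b)"
      by (auto intro!: derivative_eq_intros)
    from has_derivative_compose[OF this dirderiv_works[OF df'[OF i]]]
    show ?thesis by (simp add: has_field_derivative_def linear_cmul[OF L] mult_commute_abs)
  qed
  from MVT2[OF \<open>s > 0\<close> this] obtain b where "0 < b" "b < s"
    "dirderiv f (x + a *\<^sub>R u + s *\<^sub>R v) u - dirderiv f (x + a *\<^sub>R u) u =
      s * dirderiv (\<lambda>y. dirderiv f y u) (x + a *\<^sub>R u + b *\<^sub>R v) v"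
    by auto
  with a show ?thesis by (intro exI[of _ a] exI[of _ b]) simp
qed

text \<open>The second difference over a small parallelogram is symmetric in \<open>u\<close> and
  \<open>v\<close> and equals \<open>s * s\<close> times either mixed derivative at some interior
  point; continuity forces the two to agree at \<open>x\<close>.\<close>

lemma dirderiv_commute_real:
  fixes f :: "'a::real_normed_vector \<Rightarrow> real"
  assumes "open S" "x \<in> S" "smooth_on S f"
  shows "dirderiv (\<lambda>y. dirderiv f y u) x v = dirderiv (\<lambda>y. dirderiv f y v) x u"
proof (rule ccontr)
  define P where "P = (\<lambda>y. dirderiv (\<lambda>y. dirderiv f y u) y v)"
  define Q where "Q = (\<lambda>y. dirderiv (\<lambda>y. dirderiv f y v) y u)"
  assume "\<not> ?thesis"
  then have ne: "\<bar>P x - Q x\<bar> / 2 > 0" by (simp add: P_def Q_def)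
  have "continuous_on S P" "continuous_on S Q"
    unfolding P_def Q_def by (intro smooth_on_continuous smooth_on_dirderiv assms)+
  then have "isCont P x" "isCont Q x" using assms continuous_on_eq_continuous_at by blast+
  then obtain d1 d2 where d: "d1 > 0" "\<And>y. dist y x < d1 \<Longrightarrow> \<bar>P y - P x\<bar> < \<bar>P x - Q x\<bar> / 2"
    "d2 > 0" "\<And>y. dist y x < d2 \<Longrightarrow> \<bar>Q y - Q x\<bar> < \<bar>P x - Q x\<bar> / 2"
    using ne unfolding continuous_at_eps_delta dist_real_def by blast
  obtain d3 where d3: "d3 > 0" "ball x d3 \<subseteq> S" using assms open_contains_ball by blast
  define d where "d = min d1 (min d2 d3)"
  \<comment> \<open>Small enough that the whole parallelogram stays within distance \<open>d\<close>
    of \<open>x\<close>; the summand 1 keeps the denominator positive when \<open>u\<close> and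
    \<open>v\<close> are both 0.\<close>
  define s where "s = d / (2 * (norm u + norm v + 1))"
  have "d > 0" using d d3 by (simp add: d_def)
  have pos: "norm u + norm v + 1 > 0" by (smt (verit) norm_ge_zero)
  have s: "s > 0" using \<open>d > 0\<close> pos by (simp add: s_def)
  have near: "dist (x + a *\<^sub>R u + b *\<^sub>R v) x < d" if "0 \<le> a" "a \<le> s" "0 \<le> b" "b \<le> s" for a b
  proof -
    have "dist (x + a *\<^sub>R u + b *\<^sub>R v) x = norm (a *\<^sub>R u + b *\<^sub>R v)"
      by (simp add: dist_norm algebra_simps)
    also have "\<dots> \<le> a * norm u + b * norm v"
      using norm_triangle_ineq[of "a *\<^sub>R u" "b *\<^sub>R v"] that by simp
    also have "\<dots> \<le> s * norm u + s * norm v"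
      using that by (intro add_mono mult_right_mono) auto
    also have "\<dots> < s * (2 * (norm u + norm v + 1))"
    proof -
      have "s * norm u \<ge> 0" "s * norm v \<ge> 0" using s by auto
      then show ?thesis using s unfolding distrib_left by linarith
    qed
    also have "\<dots> = d" using pos by (simp add: s_def)
    finally show ?thesis .
  qed
  have inS: "x + a *\<^sub>R u + b *\<^sub>R v \<in> S" if "0 \<le> a" "a \<le> s" "0 \<le> b" "b \<le> s" for a b
    using near[OF that] d3 by (auto simp: d_def dist_commute)
  have inS': "x + a *\<^sub>R v + b *\<^sub>R u \<in> S" if "0 \<le> a" "a \<le> s" "0 \<le> b" "b \<le> s" for a b
    using inS[of b a] that by (simp add: algebra_simps)
  note df = smooth_on_differentiable[OF assms(3)]
    and df' = smooth_on_differentiable[OF smooth_on_dirderiv[OF assms(3)]]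
  obtain a b where ab: "0 < a" "a < s" "0 < b" "b < s"
    "f (x + s *\<^sub>R u + s *\<^sub>R v) - f (x + s *\<^sub>R u) - f (x + s *\<^sub>R v) + f x =
      s * s * P (x + a *\<^sub>R u + b *\<^sub>R v)"
    using second_difference_mean_value[OF s inS df df'] unfolding P_def by blast
  obtain a' b' where ab': "0 < a'" "a' < s" "0 < b'" "b' < s"
    "f (x + s *\<^sub>R v + s *\<^sub>R u) - f (x + s *\<^sub>R v) - f (x + s *\<^sub>R u) + f x =
      s * s * Q (x + a' *\<^sub>R v + b' *\<^sub>R u)"
    using second_difference_mean_value[OF s inS' df df'] unfolding Q_def by blast
  have "s * s * P (x + a *\<^sub>R u + b *\<^sub>R v) = s * s * Q (x + b' *\<^sub>R u + a' *\<^sub>R v)"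
    using ab(5) ab'(5) by (simp add: algebra_simps)
  then have "P (x + a *\<^sub>R u + b *\<^sub>R v) = Q (x + b' *\<^sub>R u + a' *\<^sub>R v)" using s by simp
  moreover have "\<bar>P (x + a *\<^sub>R u + b *\<^sub>R v) - P x\<bar> < \<bar>P x - Q x\<bar> / 2"
    using near[of a b] ab by (intro d) (auto simp: d_def)
  moreover have "\<bar>Q (x + b' *\<^sub>R u + a' *\<^sub>R v) - Q x\<bar> < \<bar>P x - Q x\<bar> / 2"
    using near[of b' a'] ab' by (intro d) (auto simp: d_def)
  ultimately show False by (smt (verit) field_sum_of_halves)
qed

lemma dirderiv_commute:
  fixes f :: "'a::real_normed_vector \<Rightarrow> 'b::euclidean_space"
  assumes "open S" "x \<in> S" "smooth_on S f"
  shows "dirderiv (\<lambda>y. dirderiv f y u) x v = dirderiv (\<lambda>y. dirderiv f y v) x u"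
proof (rule euclidean_eqI)
  fix b :: 'b
  have c: "dirderiv (\<lambda>y. dirderiv f y u) x v \<bullet> b = dirderiv (\<lambda>y. dirderiv (\<lambda>y. f y \<bullet> b) y u) x v" for u v
  proof -
    have "dirderiv (\<lambda>y. dirderiv f y u) x v \<bullet> b = dirderiv (\<lambda>y. dirderiv f y u \<bullet> b) x v"
      by (rule dirderiv_bounded_linear[OF bounded_linear_inner_left, symmetric])
        (rule smooth_on_differentiable[OF smooth_on_dirderiv[OF assms(3)] assms(2)])
    also have "\<dots> = dirderiv (\<lambda>y. dirderiv (\<lambda>y. f y \<bullet> b) y u) x v"
      by (rule dirderiv_cong[OF assms(1,2)])
        (simp add: dirderiv_bounded_linear[OF bounded_linear_inner_left smooth_on_differentiable[OF assms(3)]])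
    finally show ?thesis .
  qed
  have "smooth_on S (\<lambda>y. f y \<bullet> b)"
    by (rule smooth_on_bounded_linear[OF assms(3,1) bounded_linear_inner_left])
  then show "dirderiv (\<lambda>y. dirderiv f y u) x v \<bullet> b = dirderiv (\<lambda>y. dirderiv f y v) x u \<bullet> b"
    unfolding c using dirderiv_commute_real assms by blast
qed

section \<open>Metrics in coordinates\<close>

definition metric_matrix :: "real^'n^'n \<Rightarrow> bool"
  where "metric_matrix g \<longleftrightarrow> (\<forall>u v. ip g u v = ip g v u) \<and> (\<forall>u. u \<noteq> 0 \<longrightarrow> ip g u u > 0)"

lemma ip_commute: "metric_matrix g \<Longrightarrow> ip g u v = ip g v u"
  by (simp add: metric_matrix_def)

lemma ip_pos: "metric_matrix g \<Longrightarrow> u \<noteq> 0 \<Longrightarrow> ip g u u > 0"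
  by (simp add: metric_matrix_def)

lemma bilinear_ip: "bilinear (ip g)"
  by (auto simp: bilinear_def ip_def inner_simps matrix_vector_right_distrib matrix_vector_mult_scaleR
    intro!: linearI)

lemmas ip_simps = bilinear_ladd[OF bilinear_ip] bilinear_radd[OF bilinear_ip]
  bilinear_lmul[OF bilinear_ip] bilinear_rmul[OF bilinear_ip]
  bilinear_lneg[OF bilinear_ip] bilinear_rneg[OF bilinear_ip]
  bilinear_lzero[OF bilinear_ip] bilinear_rzero[OF bilinear_ip]
  bilinear_lsub[OF bilinear_ip] bilinear_rsub[OF bilinear_ip]

lemma ip_nonneg: "metric_matrix g \<Longrightarrow> ip g u u \<ge> 0"
  using ip_pos[of g u] by (cases "u = 0") (auto simp: ip_simps)

lemma ip_eq_0: "metric_matrix g \<Longrightarrow> ip g u u = 0 \<longleftrightarrow> u = 0"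
  using ip_pos[of g u] by (cases "u = 0") (auto simp: ip_simps)

lemma ip_eqI:
  assumes "metric_matrix g" "\<And>w. ip g w u = ip g w v"
  shows "u = v"
  using ip_eq_0[OF assms(1), of "u - v"] assms(2)[of "u - v"] by (simp add: ip_simps)

lemma invertible_metric_matrix:
  assumes "metric_matrix g"
  shows "invertible g"
proof -
  have "x = 0" if "g *v x = 0" for x
    using ip_eq_0[OF assms, of x] that by (simp add: ip_def)
  then show ?thesis
    by (simp add: invertible_left_inverse matrix_left_invertible_ker)
qed

lemma matrix_inv_mult:
  fixes g :: "real^'n^'n"
  assumes "invertible g"
  shows "g ** matrix_inv g = mat 1" "matrix_inv g ** g = mat 1"
  using someI_ex[OF assms[unfolded invertible_def]] unfolding matrix_inv_def by auto

lemma sharp_eqI: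
  assumes "metric_matrix g" "\<And>w. ip g w z = l w"
  shows "sharp g l = z"
proof -
  have "(\<chi> i. l (axis i 1)) = g *v z"
    unfolding assms(2)[symmetric] ip_def by (simp add: vec_eq_iff inner_axis')
  then show ?thesis
    by (simp add: sharp_def matrix_vector_mul_assoc matrix_inv_mult invertible_metric_matrix[OF assms(1)])
qed

text \<open>\<open>sharp\<close> reads \<open>l\<close> on the standard basis only, so its value at
  a general \<open>w\<close> is recovered by linearity.\<close>

lemma ip_sharp:
  assumes "metric_matrix g" "linear l"
  shows "ip g w (sharp g l) = l w"
proof -
  have "w = (\<Sum>i\<in>UNIV. (w $ i) *\<^sub>R axis i 1)"
    by (simp add: vec_eq_iff axis_def if_distrib cong: if_cong)
  then have "l w = l (\<Sum>i\<in>UNIV. (w $ i) *\<^sub>R axis i 1)" by simp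
  also have "\<dots> = (\<Sum>i\<in>UNIV. (w $ i) * l (axis i 1))"
    by (simp add: linear_sum[OF assms(2)] linear_cmul[OF assms(2)])
  finally have "l w = (\<Sum>i\<in>UNIV. (w $ i) * l (axis i 1))" .
  then show ?thesis
    by (simp add: ip_def sharp_def matrix_vector_mul_assoc matrix_inv_mult
      invertible_metric_matrix[OF assms(1)] inner_vec_def)
qed

lemma metric_trace_ip:
  fixes g :: "real^'n^'n"
  assumes "metric_matrix g"
  shows "metric_trace g (ip g) = real CARD('n)"
proof -
  \<comment> \<open>Symmetry of \<open>g\<close> turns the double sum into the matrix trace of
    \<open>matrix_inv g ** g\<close>, the identity.\<close>
  have "g $ i $ j = g $ j $ i" for i j
    using ip_commute[OF assms, of "axis i 1" "axis j 1"]
    by (simp add: ip_def inner_axis' matrix_vector_mul_component inner_axis)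
  then have "metric_trace g (ip g) = (\<Sum>i\<in>UNIV. (matrix_inv g ** g) $ i $ i)"
    by (simp add: metric_trace_def ip_def matrix_matrix_mult_def inner_axis' matrix_vector_mul_component
      inner_axis)
  then show ?thesis
    by (simp add: matrix_inv_mult invertible_metric_matrix[OF assms] mat_def)
qed

text \<open>Contracting the inverse metric with \<open>l\<close> raises its index. This evaluates
  traces with a linear form as a factor without an orthonormal basis.\<close>

lemma metric_trace_rank_one:
  fixes b :: "real^'n \<Rightarrow> 'v::real_vector"
  assumes "linear b"
  shows "metric_trace g (\<lambda>u v. l v *\<^sub>R b u) = b (sharp g l)"
proof -
  have "sharp g l = (\<Sum>i\<in>UNIV. (\<Sum>j\<in>UNIV. matrix_inv g $ i $ j * l (axis j 1)) *\<^sub>R axis i 1)"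
    by (simp add: vec_eq_iff axis_def if_distrib sharp_def matrix_vector_mult_def cong: if_cong)
  then have "b (sharp g l) = (\<Sum>i\<in>UNIV. (\<Sum>j\<in>UNIV. matrix_inv g $ i $ j * l (axis j 1)) *\<^sub>R b (axis i 1))"
    by (simp add: linear_sum[OF assms] linear_cmul[OF assms])
  then show ?thesis
    by (simp add: metric_trace_def scaleR_sum_left)
qed

lemma metric_trace_add:
  "metric_trace g (\<lambda>u v. a u v + b u v) = metric_trace g a + metric_trace g b"
  by (simp add: metric_trace_def scaleR_add_right sum.distrib)

lemma metric_trace_linear:
  assumes "linear L"
  shows "metric_trace g (\<lambda>u v. L (b u v)) = L (metric_trace g b)"
  by (simp add: metric_trace_def linear_sum[OF assms] linear_cmul[OF assms])

lemma metric_trace_scale: "metric_trace g (\<lambda>u v. c *\<^sub>R b u v) = c *\<^sub>R metric_trace g b"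
  by (simp add: metric_trace_def scaleR_sum_right mult.commute)

lemma smooth_on_matrix_vector_mult:
  fixes A :: "'a::real_normed_vector \<Rightarrow> real^'n^'m"
  assumes "open S" "smooth_on S A" "smooth_on S v"
  shows "smooth_on S (\<lambda>x. A x *v v x)"
proof (rule smooth_on_bilinear[OF _ assms])
  show "bounded_bilinear ((*v) :: real^'n^'m \<Rightarrow> _)"
    unfolding bilinear_conv_bounded_bilinear[symmetric] bilinear_def
    by (auto intro!: linearI simp: matrix_vector_mult_add_rdistrib matrix_vector_right_distrib
      matrix_vector_mult_scaleR scaleR_matrix_vector_assoc)
qed

lemma smooth_on_ip:
  assumes "open S" "smooth_on S g" "smooth_on S u" "smooth_on S v"
  shows "smooth_on S (\<lambda>x. ip (g x) (u x) (v x))"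
  unfolding ip_def by (intro smooth_on_inner smooth_on_matrix_vector_mult assms)

lemma smooth_on_det:
  fixes A :: "'a::real_normed_vector \<Rightarrow> real^'n^'n"
  assumes "open S" "\<And>i j. smooth_on S (\<lambda>x. A x $ i $ j)"
  shows "smooth_on S (\<lambda>x. det (A x))"
  unfolding det_def
  by (intro smooth_on_sum smooth_on_mult smooth_on_prod smooth_on_const assms)

text \<open>Cramer's rule writes each component as a quotient of determinants, which are polynomials
  in the entries; so the matrix inverse never has to be differentiated.\<close>

lemma smooth_on_sharp:
  assumes "open S" "smooth_on S g" "\<And>x. x \<in> S \<Longrightarrow> metric_matrix (g x)" "\<And>w. smooth_on S (\<lambda>x. l x w)"
  shows "smooth_on S (\<lambda>x. sharp (g x) (l x))"
proof -
  define c where "c x k = det (\<chi> i j. if j = k then l x (axis i 1) else g x $ i $ j) / det (g x)" for x k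
  have g: "smooth_on S (\<lambda>x. g x $ i $ j)" for i j
    by (intro smooth_on_nth assms)
  have "smooth_on S (\<lambda>x. det (\<chi> i j. if j = k then l x (axis i 1) else g x $ i $ j))" for k
  proof (intro smooth_on_det assms(1))
    fix i j show "smooth_on S (\<lambda>x. (\<chi> i j. if j = k then l x (axis i 1) else g x $ i $ j) $ i $ j)"
      using assms(4) g by (cases "j = k") auto
  qed
  moreover have "det (g x) \<noteq> 0" if "x \<in> S" for x
    using invertible_metric_matrix[OF assms(3)[OF that]] by (simp add: invertible_det_nz)
  ultimately have "smooth_on S (\<lambda>x. c x k)" for k
    unfolding c_def using smooth_on_det[OF assms(1), of g] g by (intro smooth_on_divide assms(1)) auto
  then have "smooth_on S (\<lambda>x. \<chi> k. c x k)"
    by (intro smooth_on_vec assms(1)) simp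
  then show ?thesis
  proof (rule smooth_on_cong[OF _ assms(1)])
    fix x assume "x \<in> S"
    note i = invertible_metric_matrix[OF assms(3)[OF this]]
    have "g x *v sharp (g x) (l x) = (\<chi> i. l x (axis i 1))"
      by (simp add: sharp_def matrix_vector_mul_assoc matrix_inv_mult i)
    then show "(\<chi> k. c x k) = sharp (g x) (l x)"
      using cramer[of "g x" "sharp (g x) (l x)" "\<chi> i. l x (axis i 1)"] i
      by (simp add: c_def invertible_det_nz cong: if_cong)
  qed
qed

lemma dirderiv_ip:
  fixes g :: "'a::real_normed_vector \<Rightarrow> real^'n^'n"
  assumes "g differentiable (at x)" "v differentiable (at x)" "w differentiable (at x)"
  shows "dirderiv (\<lambda>y. ip (g y) (v y) (w y)) x u =
    ip (dirderiv g x u) (v x) (w x) + ip (g x) (dirderiv v x u) (w x) + ip (g x) (v x) (dirderiv w x u)"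
proof -
  have b: "bounded_bilinear ((*v) :: real^'n^'n \<Rightarrow> _)"
    unfolding bilinear_conv_bounded_bilinear[symmetric] bilinear_def
    by (auto intro!: linearI simp: matrix_vector_mult_add_rdistrib matrix_vector_right_distrib
      matrix_vector_mult_scaleR scaleR_matrix_vector_assoc)
  have d: "(\<lambda>y. g y *v w y) differentiable (at x)"
    by (rule Derivative.differentiableI[OF bounded_bilinear.FDERIV[OF b dirderiv_works dirderiv_works]])
      (rule assms)+
  show ?thesis
    unfolding ip_def dirderiv_bilinear[OF bounded_bilinear_inner assms(2) d]
      dirderiv_bilinear[OF b assms(1,3)] by (simp add: inner_add_right)
qed

lemma ip_add_matrix: "ip (a + b) u v = ip a u v + ip b u v"
  and ip_scaleR_matrix: "ip (c *\<^sub>R a) u v = c * ip a u v"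
  by (auto simp: ip_def matrix_vector_mult_add_rdistrib inner_add_right
    simp flip: scaleR_matrix_vector_assoc)

lemma bilinear_expansion:
  fixes p :: "'a::euclidean_space \<Rightarrow> 'b::euclidean_space \<Rightarrow> 'c::real_vector"
  assumes "bilinear p"
  shows "p a b = (\<Sum>i\<in>Basis. \<Sum>j\<in>Basis. ((a \<bullet> i) * (b \<bullet> j)) *\<^sub>R p i j)"
proof -
  have l: "linear (\<lambda>a. p a b)" "linear (p a)" for a b using assms by (auto simp: bilinear_def)
  have "p a b = p (\<Sum>i\<in>Basis. (a \<bullet> i) *\<^sub>R i) b" by (simp add: euclidean_representation)
  also have "\<dots> = (\<Sum>i\<in>Basis. (a \<bullet> i) *\<^sub>R p i b)"
    by (simp add: linear_sum[OF l(1)] linear_cmul[OF l(1)])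
  also have "\<dots> = (\<Sum>i\<in>Basis. (a \<bullet> i) *\<^sub>R p i (\<Sum>j\<in>Basis. (b \<bullet> j) *\<^sub>R j))"
    by (simp add: euclidean_representation)
  also have "\<dots> = (\<Sum>i\<in>Basis. \<Sum>j\<in>Basis. ((a \<bullet> i) * (b \<bullet> j)) *\<^sub>R p i j)"
    by (simp add: linear_sum[OF l(2)] linear_cmul[OF l(2)] scaleR_sum_right)
  finally show ?thesis .
qed

text \<open>Product rule for a bilinear map that itself depends on the point, meant for the
  Christoffel symbols along \<open>F\<close>. Expansion in bases reduces it to sums of scalar
  functions times \<open>p z i j\<close>; \<open>T\<close> is open because bilinearity is known only
  there.\<close>

lemma has_derivative_bilinear_family:
  fixes p :: "'x::euclidean_space \<Rightarrow> 'a::euclidean_space \<Rightarrow> 'b::euclidean_space \<Rightarrow> 'c::real_normed_vector"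
    and F :: "'y::real_normed_vector \<Rightarrow> 'x"
  assumes "open S" "x \<in> S" "open T" "F ` S \<subseteq> T" "\<And>z. z \<in> T \<Longrightarrow> bilinear (p z)"
    and p: "\<And>a b. (\<lambda>z. p z a b) differentiable (at (F x))"
    and F: "F differentiable (at x)" and a: "a differentiable (at x)" and b: "b differentiable (at x)"
  shows "((\<lambda>y. p (F y) (a y) (b y)) has_derivative
    (\<lambda>u. dirderiv (\<lambda>z. p z (a x) (b x)) (F x) (dirderiv F x u)
      + p (F x) (dirderiv a x u) (b x) + p (F x) (a x) (dirderiv b x u))) (at x)"
proof -
  have Fx: "F x \<in> T" using assms by auto
  have bl: "bilinear (p (F x))" using assms(5)[OF Fx] .
  have "((\<lambda>z. \<Sum>i\<in>Basis. \<Sum>j\<in>Basis. ((a x \<bullet> i) * (b x \<bullet> j)) *\<^sub>R p z i j) has_derivative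
    (\<lambda>u. \<Sum>i\<in>Basis. \<Sum>j\<in>Basis. ((a x \<bullet> i) * (b x \<bullet> j)) *\<^sub>R dirderiv (\<lambda>z. p z i j) (F x) u)) (at (F x))"
    by (intro has_derivative_sum bounded_linear.has_derivative[OF bounded_linear_scaleR_right]
      dirderiv_works p)
  then have "((\<lambda>z. p z (a x) (b x)) has_derivative
    (\<lambda>u. \<Sum>i\<in>Basis. \<Sum>j\<in>Basis. ((a x \<bullet> i) * (b x \<bullet> j)) *\<^sub>R dirderiv (\<lambda>z. p z i j) (F x) u)) (at (F x))"
    by (rule has_derivative_transform_within_open[OF _ assms(3) Fx])
      (simp flip: bilinear_expansion[OF assms(5)])
  then have 1: "dirderiv (\<lambda>z. p z (a x) (b x)) (F x) u =
    (\<Sum>i\<in>Basis. \<Sum>j\<in>Basis. ((a x \<bullet> i) * (b x \<bullet> j)) *\<^sub>R dirderiv (\<lambda>z. p z i j) (F x) u)" for u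
    by (rule dirderiv_eq)
  have "((\<lambda>y. \<Sum>i\<in>Basis. \<Sum>j\<in>Basis. ((a y \<bullet> i) * (b y \<bullet> j)) *\<^sub>R p (F y) i j) has_derivative
    (\<lambda>u. \<Sum>i\<in>Basis. \<Sum>j\<in>Basis. ((a x \<bullet> i) * (b x \<bullet> j)) *\<^sub>R dirderiv (\<lambda>z. p z i j) (F x) (dirderiv F x u)
       + ((a x \<bullet> i) * (dirderiv b x u \<bullet> j) + (dirderiv a x u \<bullet> i) * (b x \<bullet> j)) *\<^sub>R p (F x) i j)) (at x)"
    by (intro has_derivative_sum has_derivative_scaleR has_derivative_mult has_derivative_inner_left
      dirderiv_works[OF a] dirderiv_works[OF b]
      has_derivative_compose[OF dirderiv_works[OF F] dirderiv_works[OF p]])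
  also have "(\<lambda>u. \<Sum>i\<in>Basis. \<Sum>j\<in>Basis. ((a x \<bullet> i) * (b x \<bullet> j)) *\<^sub>R dirderiv (\<lambda>z. p z i j) (F x) (dirderiv F x u)
       + ((a x \<bullet> i) * (dirderiv b x u \<bullet> j) + (dirderiv a x u \<bullet> i) * (b x \<bullet> j)) *\<^sub>R p (F x) i j) =
    (\<lambda>u. dirderiv (\<lambda>z. p z (a x) (b x)) (F x) (dirderiv F x u)
      + p (F x) (dirderiv a x u) (b x) + p (F x) (a x) (dirderiv b x u))"
    unfolding 1 bilinear_expansion[OF bl, of "dirderiv a x _"] bilinear_expansion[OF bl, of "a x" "dirderiv b x _"]
    by (simp add: fun_eq_iff sum.distrib scaleR_add_left algebra_simps)
  finally show ?thesis
    by (rule has_derivative_transform_within_open[OF _ assms(1,2)])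
      (use assms(4,5) in \<open>simp add: image_subset_iff flip: bilinear_expansion\<close>)
qed

section \<open>The Levi-Civita connection along a map\<close>

locale metric_chart =
  fixes h :: "real^'n \<Rightarrow> real^'n^'n" and T :: "(real^'n) set"
  assumes open_T: "open T" and smooth_metric: "smooth_on T h"
    and metric: "y \<in> T \<Longrightarrow> metric_matrix (h y)"
begin

lemma dirderiv_metric: "y \<in> T \<Longrightarrow> dirderiv (\<lambda>y. ip (h y) a b) y u = ip (dirderiv h y u) a b"
  using dirderiv_ip[OF smooth_on_differentiable[OF smooth_metric], of y "\<lambda>_. a" "\<lambda>_. b"]
  by (simp add: ip_simps)

lemma dirderiv_metric_commute: "y \<in> T \<Longrightarrow> ip (dirderiv h y u) a b = ip (dirderiv h y u) b a"
  unfolding dirderiv_metric[symmetric]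
  by (rule dirderiv_cong[OF open_T]) (auto simp: ip_commute[OF metric])

lemma dirderiv_metric_simps:
  assumes "y \<in> T"
  shows "ip (dirderiv h y (u + v)) a b = ip (dirderiv h y u) a b + ip (dirderiv h y v) a b"
    and "ip (dirderiv h y (r *\<^sub>R u)) a b = r * ip (dirderiv h y u) a b"
  using linear_dirderiv[OF smooth_on_differentiable[OF smooth_metric assms]]
  by (simp_all add: linear_add linear_cmul ip_add_matrix ip_scaleR_matrix)

lemma ip_christoffel:
  assumes "y \<in> T"
  shows "ip (h y) w (christoffel h y a b) =
    (ip (dirderiv h y a) b w + ip (dirderiv h y b) a w - ip (dirderiv h y w) a b) / 2"
  unfolding christoffel_def dirderiv_metric[OF assms]
  by (rule ip_sharp[OF metric[OF assms]], rule linearI)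
    (simp_all add: dirderiv_metric_simps[OF assms] ip_simps field_simps)

lemma christoffel_commute: "y \<in> T \<Longrightarrow> christoffel h y a b = christoffel h y b a"
  by (rule ip_eqI[OF metric]) (auto simp: ip_christoffel dirderiv_metric_commute)

lemma bilinear_christoffel:
  assumes "y \<in> T"
  shows "bilinear (christoffel h y)"
proof -
  have l: "linear (christoffel h y a)" for a
  proof (rule linearI; rule ip_eqI[OF metric[OF assms]])
    fix b c w and r :: real
    show "ip (h y) w (christoffel h y a (b + c)) = ip (h y) w (christoffel h y a b + christoffel h y a c)"
      "ip (h y) w (christoffel h y a (r *\<^sub>R b)) = ip (h y) w (r *\<^sub>R christoffel h y a b)"
      by (simp_all add: ip_simps ip_christoffel[OF assms] dirderiv_metric_simps[OF assms] field_simps)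
  qed
  then show ?thesis
    using christoffel_commute[OF assms] unfolding bilinear_def by (metis (full_types) ext)
qed

lemma christoffel_metric:
  assumes "y \<in> T"
  shows "ip (dirderiv h y u) a b =
    ip (h y) (christoffel h y u a) b + ip (h y) a (christoffel h y u b)"
  unfolding ip_commute[OF metric[OF assms], of _ b] ip_christoffel[OF assms]
  using dirderiv_metric_commute[OF assms] by (simp add: add_divide_distrib diff_divide_distrib)

end

text \<open>The source carries no metric and \<open>F\<close> is an arbitrary smooth map, so that
  the identity of \<open>T\<close> is an instance as well as an immersion.\<close>

locale map_chart = metric_chart h T
  for h :: "real^'n \<Rightarrow> real^'n^'n" and T :: "(real^'n) set" +
  fixes F :: "real^'m \<Rightarrow> real^'n" and S :: "(real^'m) set"
  assumes open_S: "open S" and smooth_F: "smooth_on S F" and F_image: "F ` S \<subseteq> T"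
begin

abbreviation G :: "real^'m \<Rightarrow> real^'n \<Rightarrow> real^'n \<Rightarrow> real"
  where "G x \<equiv> ip (h (F x))"

abbreviation D :: "real^'m \<Rightarrow> real^'m \<Rightarrow> (real^'m \<Rightarrow> real^'n) \<Rightarrow> real^'n"
  where "D \<equiv> pullback_cov h F"

abbreviation dF :: "real^'m \<Rightarrow> real^'m \<Rightarrow> real^'n"
  where "dF \<equiv> \<lambda>x. dirderiv F x"

lemma F_in [simp]: "x \<in> S \<Longrightarrow> F x \<in> T"
  using F_image by auto

lemma metric_F [simp]: "x \<in> S \<Longrightarrow> metric_matrix (h (F x))"
  by (simp add: metric)

lemma smooth_hF: "smooth_on S (\<lambda>x. h (F x))"
  by (rule smooth_on_compose[OF open_S smooth_F smooth_metric F_image])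

lemma smooth_G: "smooth_on S V \<Longrightarrow> smooth_on S W \<Longrightarrow> smooth_on S (\<lambda>x. G x (V x) (W x))"
  by (intro smooth_on_ip open_S smooth_hF)

lemma linear_dF: "x \<in> S \<Longrightarrow> linear (dF x)"
  by (intro linear_dirderiv smooth_on_differentiable[OF smooth_F])

lemma smooth_dF: "smooth_on S (\<lambda>x. dF x u)"
  by (intro smooth_on_dirderiv smooth_F)

lemma smooth_dF_field: "smooth_on S E \<Longrightarrow> smooth_on S (\<lambda>x. dF x (E x))"
  by (rule smooth_on_dirderiv_field[OF open_S smooth_F])

lemma smooth_christoffel_along:
  assumes a: "smooth_on S a" and b: "smooth_on S b"
  shows "smooth_on S (\<lambda>x. christoffel h (F x) (a x) (b x))"
proof -
  have dh: "smooth_on S (\<lambda>x. dirderiv h (F x) (c x))" if "smooth_on S c" for c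
  proof (rule smooth_on_cong[OF _ open_S])
    show "smooth_on S (\<lambda>x. \<Sum>i\<in>Basis. (c x \<bullet> i) *\<^sub>R dirderiv h (F x) i)"
      by (intro smooth_on_sum smooth_on_scaleR smooth_on_inner smooth_on_const open_S that
        smooth_on_compose[OF open_S smooth_F smooth_on_dirderiv[OF smooth_metric] F_image])
    show "(\<Sum>i\<in>Basis. (c x \<bullet> i) *\<^sub>R dirderiv h (F x) i) = dirderiv h (F x) (c x)" if "x \<in> S" for x
      using dirderiv_euclidean_expansion[OF smooth_on_differentiable[OF smooth_metric F_in[OF that]]]
      by metis
  qed
  have "smooth_on S (\<lambda>x. sharp (h (F x)) (\<lambda>w. (1 / 2) * (ip (dirderiv h (F x) (a x)) (b x) w
      + ip (dirderiv h (F x) (b x)) (a x) w - ip (dirderiv h (F x) w) (a x) (b x))))"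
    by (intro smooth_on_sharp smooth_on_mult smooth_on_add smooth_on_diff smooth_on_ip
      smooth_on_const open_S smooth_hF metric_F dh a b)
  then show ?thesis
    by (rule smooth_on_cong[OF _ open_S]) (simp add: christoffel_def dirderiv_metric)
qed

lemma smooth_D: "smooth_on S W \<Longrightarrow> smooth_on S (\<lambda>x. D x u W)"
  unfolding pullback_cov_def
  by (intro smooth_on_add smooth_christoffel_along smooth_on_dirderiv open_S smooth_F)

lemma christoffel_simps:
  "x \<in> S \<Longrightarrow> christoffel h (F x) (a + b) c = christoffel h (F x) a c + christoffel h (F x) b c"
  "x \<in> S \<Longrightarrow> christoffel h (F x) c (a + b) = christoffel h (F x) c a + christoffel h (F x) c b"
  "x \<in> S \<Longrightarrow> christoffel h (F x) (r *\<^sub>R a) c = r *\<^sub>R christoffel h (F x) a c"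
  "x \<in> S \<Longrightarrow> christoffel h (F x) a (r *\<^sub>R c) = r *\<^sub>R christoffel h (F x) a c"
  by (auto simp: bilinear_ladd bilinear_radd bilinear_lmul bilinear_rmul bilinear_christoffel)

lemma linear_D:
  assumes "x \<in> S" "smooth_on S W"
  shows "linear (\<lambda>u. D x u W)"
proof -
  note l = linear_dirderiv[OF smooth_on_differentiable[OF assms(2,1)]] linear_dF[OF assms(1)]
  show ?thesis
    by (rule linearI) (simp_all add: pullback_cov_def linear_add[OF l(1)] linear_cmul[OF l(1)]
      linear_add[OF l(2)] linear_cmul[OF l(2)] christoffel_simps[OF assms(1)] scaleR_add_right)
qed

lemma D_cong:
  assumes "x \<in> S" "\<And>y. y \<in> S \<Longrightarrow> V y = W y"
  shows "D x u V = D x u W"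
  unfolding pullback_cov_def using dirderiv_cong[OF open_S assms] assms by simp

lemma D_add:
  assumes "x \<in> S" "smooth_on S V" "smooth_on S W"
  shows "D x u (\<lambda>y. V y + W y) = D x u V + D x u W"
  unfolding pullback_cov_def
  by (simp add: dirderiv_add smooth_on_differentiable[OF _ assms(1)] assms christoffel_simps)

lemma D_scaleR:
  assumes "x \<in> S" "smooth_on S \<phi>" "smooth_on S W"
  shows "D x u (\<lambda>y. \<phi> y *\<^sub>R W y) = dirderiv \<phi> x u *\<^sub>R W x + \<phi> x *\<^sub>R D x u W"
  unfolding pullback_cov_def
  by (simp add: dirderiv_bilinear[OF bounded_bilinear_scaleR] smooth_on_differentiable[OF _ assms(1)]
    assms christoffel_simps algebra_simps)

lemma D_metric:
  assumes "x \<in> S" "smooth_on S V" "smooth_on S W"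
  shows "dirderiv (\<lambda>y. G y (V y) (W y)) x u = G x (D x u V) (W x) + G x (V x) (D x u W)"
proof -
  have F: "F differentiable at x" and h: "h differentiable at (F x)"
    using smooth_on_differentiable[OF smooth_F] smooth_on_differentiable[OF smooth_metric] assms(1) by auto
  have "dirderiv (\<lambda>y. h (F y)) x u = dirderiv h (F x) (dF x u)"
    by (rule dirderiv_compose[OF F h])
  then show ?thesis
    using dirderiv_ip[OF smooth_on_differentiable[OF smooth_hF assms(1)]
      smooth_on_differentiable[OF assms(2,1)] smooth_on_differentiable[OF assms(3,1)]]
    by (simp add: christoffel_metric assms(1) pullback_cov_def ip_simps)
qed

lemma D_dF_commute: "x \<in> S \<Longrightarrow> D x u (\<lambda>y. dF y v) = D x v (\<lambda>y. dF y u)"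
  unfolding pullback_cov_def
  by (simp add: dirderiv_commute[OF open_S _ smooth_F] christoffel_commute)

text \<open>The curvature of the pulled-back connection is the pull-back of the curvature: the
  second derivatives of \<open>F\<close> and of \<open>W\<close> are symmetric and cancel, leaving
  only the derivative of the Christoffel symbols and their squares.\<close>

lemma D_curvature:
  assumes x: "x \<in> S" and W: "smooth_on S W"
  shows "D x u (\<lambda>y. D y v W) - D x v (\<lambda>y. D y u W) = curvature h (F x) (dF x u) (dF x v) (W x)"
proof -
  interpret id: map_chart h T "\<lambda>x. x" T
    using open_T by unfold_locales (auto intro: smooth_on_ident)
  have "(\<lambda>z. christoffel h z a b) differentiable at (F x)" for a b
    using smooth_on_differentiable[OF id.smooth_christoffel_along[OF smooth_on_const smooth_on_const]] x by auto
  note christ = dirderiv_eq[OF has_derivative_bilinear_family[OF open_S x open_T F_image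
    bilinear_christoffel this smooth_on_differentiable[OF smooth_F x]
    smooth_on_differentiable[OF smooth_dF x] smooth_on_differentiable[OF W x]]]
  have 1: "D x u (\<lambda>y. D y v W) =
    dirderiv (\<lambda>y. dirderiv W y v) x u
    + (dirderiv (\<lambda>z. christoffel h z (dF x v) (W x)) (F x) (dF x u)
      + christoffel h (F x) (dirderiv (\<lambda>y. dF y v) x u) (W x)
      + christoffel h (F x) (dF x v) (dirderiv W x u))
    + christoffel h (F x) (dF x u) (dirderiv W x v)
    + christoffel h (F x) (dF x u) (christoffel h (F x) (dF x v) (W x))" for u v
    unfolding pullback_cov_def
    by (subst dirderiv_add)
      (simp_all add: christ smooth_on_differentiable[OF smooth_on_dirderiv[OF W] x] christoffel_simps x
        smooth_on_differentiable[OF smooth_christoffel_along[OF smooth_dF W] x])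
  have 2: "dirderiv (\<lambda>z. cov h z b (\<lambda>_. w)) (F x) a = dirderiv (\<lambda>z. christoffel h z b w) (F x) a" for a b w
    by (simp add: cov_def)
  show ?thesis
    unfolding 1 curvature_def cov_def
    by (simp add: dirderiv_commute[OF open_S x smooth_F, of u v] dirderiv_commute[OF open_S x W, of u v])
qed

text \<open>Differentiate the function \<open>G y (V y) (W y)\<close> twice with the metric product
  rule and antisymmetrize; the mixed first-order terms cancel.\<close>

lemma D_curvature_skew:
  assumes x: "x \<in> S" and V: "smooth_on S V" and W: "smooth_on S W"
  shows "G x (D x u (\<lambda>y. D y v V) - D x v (\<lambda>y. D y u V)) (W x) +
    G x (V x) (D x u (\<lambda>y. D y v W) - D x v (\<lambda>y. D y u W)) = 0"
proof -
  have "dirderiv (\<lambda>y. dirderiv (\<lambda>y. G y (V y) (W y)) y v) x u =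
    G x (D x u (\<lambda>y. D y v V)) (W x) + G x (D x v V) (D x u W)
    + (G x (D x u V) (D x v W) + G x (V x) (D x u (\<lambda>y. D y v W)))" for u v
  proof -
    have "dirderiv (\<lambda>y. dirderiv (\<lambda>y. G y (V y) (W y)) y v) x u =
      dirderiv (\<lambda>y. G y (D y v V) (W y) + G y (V y) (D y v W)) x u"
      by (rule dirderiv_cong[OF open_S x]) (rule D_metric[OF _ V W])
    also have "\<dots> = dirderiv (\<lambda>y. G y (D y v V) (W y)) x u + dirderiv (\<lambda>y. G y (V y) (D y v W)) x u"
      by (intro dirderiv_add smooth_on_differentiable[OF _ x] smooth_G smooth_D V W)
    finally show ?thesis
      by (simp add: D_metric x V W smooth_D)
  qed
  from this[of v u] this[of u v] dirderiv_commute[OF open_S x smooth_G[OF V W], of u v]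
  show ?thesis by (simp add: ip_simps)
qed

end

section \<open>Constant sectional curvature\<close>

context metric_chart
begin

lemma curvature_swap: "curvature h y b a w = - curvature h y a b w"
  by (simp add: curvature_def)

lemma curvature_Bianchi:
  assumes "y \<in> T"
  shows "curvature h y a b c + curvature h y b c a + curvature h y c a b = 0"
proof -
  have "cov h y u (\<lambda>z. cov h z v (\<lambda>_. w)) = cov h y u (\<lambda>z. cov h z w (\<lambda>_. v))" for u v w
    unfolding cov_def using dirderiv_cong[OF open_T assms, of "\<lambda>z. christoffel h z v w" "\<lambda>z. christoffel h z w v"]
    by (simp add: christoffel_commute assms)
  from this[of a b c] this[of b c a] this[of c a b] show ?thesis by (simp add: curvature_def)
qed

text \<open>For the identity map, \<open>D\<close> is the Levi-Civita connection of \<open>h\<close>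
  itself, so the symmetries of \<open>curvature\<close> follow from the identities for connections
  along maps.\<close>

lemma map_chart_id: "map_chart h T (\<lambda>x. x) T"
  using open_T by unfold_locales (auto intro: smooth_on_ident)

lemma curvature_skew:
  assumes "y \<in> T"
  shows "ip (h y) (curvature h y a b v) w = - ip (h y) (curvature h y a b w) v"
proof -
  interpret id: map_chart h T "\<lambda>x. x" T by (rule map_chart_id)
  show ?thesis
    using id.D_curvature_skew[OF assms smooth_on_const smooth_on_const, of a b v w]
    by (simp add: id.D_curvature assms smooth_on_const ip_commute[OF metric[OF assms], of v])
qed

lemma linear_curvature:
  assumes "y \<in> T"
  shows "linear (\<lambda>a. curvature h y a b w)"
proof -
  interpret id: map_chart h T "\<lambda>x. x" T by (rule map_chart_id)
  let ?W = "\<lambda>_::real^'n. w"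
  have lin: "linear (\<lambda>u. id.D z u ?W)" if "z \<in> T" for z
    by (rule id.linear_D[OF that smooth_on_const])
  have "id.D y b (\<lambda>z. id.D z (u + v) ?W) = id.D y b (\<lambda>z. id.D z u ?W) + id.D y b (\<lambda>z. id.D z v ?W)" for u v
  proof -
    have "id.D y b (\<lambda>z. id.D z (u + v) ?W) = id.D y b (\<lambda>z. id.D z u ?W + id.D z v ?W)"
      by (rule id.D_cong[OF assms]) (rule linear_add[OF lin])
    then show ?thesis
      by (simp add: id.D_add assms id.smooth_D smooth_on_const)
  qed
  moreover have "id.D y b (\<lambda>z. id.D z (r *\<^sub>R u) ?W) = r *\<^sub>R id.D y b (\<lambda>z. id.D z u ?W)" for r u
  proof -
    have "id.D y b (\<lambda>z. id.D z (r *\<^sub>R u) ?W) = id.D y b (\<lambda>z. r *\<^sub>R id.D z u ?W)"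
      by (rule id.D_cong[OF assms]) (rule linear_cmul[OF lin])
    then show ?thesis
      by (simp add: id.D_scaleR assms id.smooth_D smooth_on_const)
  qed
  ultimately have "linear (\<lambda>a. id.D y b (\<lambda>z. id.D z a ?W))" by (rule linearI)
  from linear_compose_sub[OF id.linear_D[OF assms id.smooth_D[of ?W b, OF smooth_on_const]] this]
  show ?thesis by (simp add: id.D_curvature assms smooth_on_const)
qed

end

text \<open>The octahedron argument gives pair symmetry; polarizing the diagonal does the rest.\<close>

lemma curvature_like_tensor_eq_0:
  fixes Q :: "'a::ab_group_add \<Rightarrow> 'a \<Rightarrow> 'a \<Rightarrow> 'a \<Rightarrow> real"
  assumes add: "\<And>u u' v w z. Q (u + u') v w z = Q u v w z + Q u' v w z"
    and swap: "\<And>u v w z. Q v u w z = - Q u v w z"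
    and skew: "\<And>u v w z. Q u v z w = - Q u v w z"
    and Bianchi: "\<And>u v w z. Q u v w z + Q v w u z + Q w u v z = 0"
    and diag: "\<And>u v. Q u v v u = 0"
  shows "Q u v w z = 0"
proof -
  have pair: "Q u v w z = Q w z u v" for u v w z
    using Bianchi[of u v w z] Bianchi[of v w z u] Bianchi[of w z u v] Bianchi[of z u v w]
      skew[of v w u z] skew[of w z u v] swap[of v z w u] swap[of u z w v] skew[of u z v w]
      swap[of w u z v] skew[of w u v z] swap[of u z v w] skew[of u v w z] skew[of v z w u]
    by linarith
  have add4: "Q u v w (z + z') = Q u v w z + Q u v w z'" for u v w z z'
    using pair[of u v w "z + z'"] pair[of u v w z] pair[of u v w z'] swap[of w "z + z'" u v]
      swap[of w z u v] swap[of w z' u v] add[of z z' w u v] by linarith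
  have 1: "Q u v v z = 0" for u v z
    using diag[of "u + z" v] diag[of u v] diag[of z v] pair[of z v v u] swap[of v u v z] skew[of u v v z]
      swap[of u v z v] skew[of v u z v] add[of u z v v "u + z"] add4[of u v v u z] add4[of z v v u z]
    by linarith
  have add2: "Q u (v + v') w z = Q u v w z + Q u v' w z" for u v v' w z
    using swap[of u "v + v'" w z] swap[of u v w z] swap[of u v' w z] add[of v v' u w z] by linarith
  have add3: "Q u v (w + w') z = Q u v w z + Q u v w' z" for u v w w' z
    using pair[of u v "w + w'" z] pair[of u v w z] pair[of u v w' z] add[of w w' z u v] by linarith
  have 2: "Q u v w z = - Q u w v z" for u v w z
    using 1[of u "v + w" z] 1[of u v z] 1[of u w z] by (simp add: add2 add3)
  \<comment> \<open>Antisymmetry in the middle slots makes the three terms of the Bianchi sum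
    equal.\<close>
  show ?thesis
    using Bianchi[of u v w z] 2[of u v w z] 2[of w v u z] swap[of w v u z] swap[of u w v z] by linarith
qed

context metric_chart
begin

text \<open>The difference from the model tensor has all curvature symmetries, so it is zero once it
  vanishes on the diagonal. The hypothesis gives this for independent pairs; dependent pairs follow
  from antisymmetry.\<close>

lemma constant_curvature:
  assumes y: "y \<in> T"
    and sec: "\<And>u v. u \<noteq> v \<and> independent {u, v} \<Longrightarrow> sectional_curvature h y u v = k"
  shows "curvature h y a b w = k *\<^sub>R (ip (h y) b w *\<^sub>R a - ip (h y) a w *\<^sub>R b)"
proof (rule ip_eqI[OF metric[OF y]])
  fix z
  note comm = ip_commute[OF metric[OF y]]
  define Q where "Q u v w z = ip (h y) (curvature h y u v w) z
    - k * (ip (h y) v w * ip (h y) u z - ip (h y) u w * ip (h y) v z)" for u v w z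
  have "Q a b w z = 0"
  proof (rule curvature_like_tensor_eq_0[of Q])
    fix u u' v w z :: "real^'n"
    show "Q (u + u') v w z = Q u v w z + Q u' v w z"
      by (simp add: Q_def linear_add[OF linear_curvature[OF y]] ip_simps algebra_simps)
    show "Q v u w z = - Q u v w z"
      by (simp add: Q_def curvature_swap[of y v u] ip_simps algebra_simps)
    show "Q u v z w = - Q u v w z"
      by (simp add: Q_def curvature_skew[OF y, of u v w z] algebra_simps)
    have "ip (h y) (curvature h y u v w) z + ip (h y) (curvature h y v w u) z + ip (h y) (curvature h y w u v) z = 0"
      unfolding bilinear_ladd[OF bilinear_ip, symmetric] curvature_Bianchi[OF y] by (simp add: ip_simps)
    then show "Q u v w z + Q v w u z + Q w u v z = 0"
      using comm[of u v] comm[of u w] comm[of v w] by (simp add: Q_def algebra_simps)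
  next
    fix u v :: "real^'n"
    consider "v = 0" | c where "v \<noteq> 0" "u = c *\<^sub>R v" | "v \<noteq> 0" "u \<notin> span {v}"
      by (auto simp: span_singleton)
    then show "Q u v v u = 0"
    proof cases
      case 1
      have "curvature h y u 0 0 = 0"
        using linear_0[OF linear_curvature[OF y, of u 0]] curvature_swap[of y u 0 0] by simp
      then show ?thesis using 1 by (simp add: Q_def ip_simps)
    next
      case 2
      have "curvature h y v v v = 0" by (simp add: curvature_def)
      then show ?thesis using 2
        by (simp add: Q_def ip_simps linear_cmul[OF linear_curvature[OF y]] algebra_simps)
    next
      case 3
      then have "independent {u, v}" "u \<noteq> v"
        by (auto simp: independent_insert span_base)
      \<comment> \<open>The coefficient of the projection of \<open>u\<close> to \<open>v\<close>.
        The Gram determinant is then a product of two positive squared lengths, so the quotient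
        defining the sectional curvature can be cleared.\<close>
      define r where "r = ip (h y) u v / ip (h y) v v"
      have v: "ip (h y) v v > 0" by (rule ip_pos[OF metric[OF y] 3(1)])
      have "u - r *\<^sub>R v \<noteq> 0" using 3(2) by (auto simp: span_singleton)
      then have "0 < ip (h y) v v * ip (h y) (u - r *\<^sub>R v) (u - r *\<^sub>R v)"
        using v ip_pos[OF metric[OF y]] by simp
      also have "\<dots> = ip (h y) u u * ip (h y) v v - (ip (h y) u v)\<^sup>2"
        using v comm[of v u] by (simp add: ip_simps r_def field_simps power2_eq_square)
      finally have "ip (h y) u u * ip (h y) v v - (ip (h y) u v)\<^sup>2 \<noteq> 0" by simp
      with sec[of u v] \<open>independent {u, v}\<close> \<open>u \<noteq> v\<close> show ?thesis
        by (simp add: sectional_curvature_def Q_def power2_eq_square comm[of v u] field_simps)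
    qed
  qed
  then show "ip (h y) z (curvature h y a b w) = ip (h y) z (k *\<^sub>R (ip (h y) b w *\<^sub>R a - ip (h y) a w *\<^sub>R b))"
    by (simp add: Q_def ip_simps comm[of z])
qed

end

section \<open>Isometric immersions in coordinates\<close>

locale immersed_chart = map_chart h T F S
  for h :: "real^'n \<Rightarrow> real^'n^'n" and T and F :: "real^'m \<Rightarrow> real^'n" and S +
  fixes g :: "real^'m \<Rightarrow> real^'m^'m"
  assumes smooth_g: "smooth_on S g" and metric_g [simp]: "x \<in> S \<Longrightarrow> metric_matrix (g x)"
    and isometric: "x \<in> S \<Longrightarrow> ip (g x) u v = ip (h (F x)) (dirderiv F x u) (dirderiv F x v)"
begin

sublocale M: metric_chart g S
  by unfold_locales (simp_all add: open_S smooth_g)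

abbreviation B where "B \<equiv> second_ff g h F"
abbreviation NC where "NC \<equiv> normal_cov g h F"
abbreviation H where "H \<equiv> mean_curvature g h F"

definition normal :: "real^'m \<Rightarrow> real^'n \<Rightarrow> bool"
  where "normal x n \<longleftrightarrow> (\<forall>w. G x n (dF x w) = 0)"

lemma normalD: "normal x n \<Longrightarrow> G x n (dF x w) = 0"
  by (simp add: normal_def)

lemma G_commute: "x \<in> S \<Longrightarrow> G x v w = G x w v"
  by (simp add: ip_commute)

lemma normalD': "x \<in> S \<Longrightarrow> normal x n \<Longrightarrow> G x (dF x w) n = 0"
  by (simp add: normal_def G_commute)

lemma linear_G: "linear (\<lambda>w. G x w n)" "linear (G x n)"
  by (auto intro!: linearI simp: ip_simps)

text \<open>\<open>D\<close> is metric and \<open>D_dF_commute\<close> says that it is free of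
  torsion on coordinate fields; hence the Koszul computation for the induced metric gives its
  tangential part.\<close>

lemma D_dF_tangential:
  assumes x: "x \<in> S"
  shows "G x (D x u (\<lambda>y. dF y v)) (dF x w) = ip (g x) (christoffel g x u v) w"
proof -
  have "ip (dirderiv g x u) v w = G x (D x u (\<lambda>y. dF y v)) (dF x w) + G x (dF x v) (D x u (\<lambda>y. dF y w))" for u v w
  proof -
    have "ip (dirderiv g x u) v w = dirderiv (\<lambda>y. G y (dF y v) (dF y w)) x u"
      unfolding M.dirderiv_metric[OF x, symmetric] by (rule dirderiv_cong[OF open_S x]) (simp add: isometric)
    then show ?thesis by (simp add: D_metric x smooth_dF)
  qed
  then show ?thesis
    using M.ip_christoffel[OF x, of w u v] D_dF_commute[OF x, of u v] D_dF_commute[OF x, of u w]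
      D_dF_commute[OF x, of v w]
    by (simp add: ip_commute[OF metric_g[OF x], of _ w] G_commute[OF x])
qed

lemma tangential_part:
  assumes x: "x \<in> S"
  shows "ip (g x) (sharp (g x) (\<lambda>u. G x w (dF x u))) u = G x w (dF x u)"
proof -
  have "linear (\<lambda>u. G x w (dF x u))"
    using linear_compose[OF linear_dF[OF x] linear_G(2)] by (simp add: o_def)
  from ip_sharp[OF metric_g[OF x] this] show ?thesis
    by (simp add: ip_commute[OF metric_g[OF x], of "sharp _ _"])
qed

lemma normal_normal_part: "x \<in> S \<Longrightarrow> normal x (normal_part g h F x w)"
  by (simp add: normal_def normal_part_def ip_simps tangential_part flip: isometric)

lemma G_normal_part: "x \<in> S \<Longrightarrow> normal x n \<Longrightarrow> G x (normal_part g h F x w) n = G x w n"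
  by (simp add: normal_part_def ip_simps normalD')

lemma normal_part_eqI:
  assumes x: "x \<in> S" and "\<And>u. G x w (dF x u) = ip (g x) z u"
  shows "normal_part g h F x w = w - dF x z"
  unfolding normal_part_def
  by (subst sharp_eqI[OF metric_g[OF x], of z]) (simp_all add: assms ip_commute[OF metric_g[OF x], of _ z])

lemma smooth_normal_part:
  assumes "smooth_on S W"
  shows "smooth_on S (\<lambda>x. normal_part g h F x (W x))"
  unfolding normal_part_def
  by (intro smooth_on_diff smooth_dF_field smooth_on_sharp smooth_G smooth_dF smooth_g open_S assms metric_g)

lemma linear_normal_part:
  assumes x: "x \<in> S"
  shows "linear (normal_part g h F x)"
proof (rule linearI)
  fix v w and c :: real
  let ?z = "\<lambda>w. sharp (g x) (\<lambda>u. G x w (dF x u))"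
  note eq = normal_part_eqI[OF x]
  have "normal_part g h F x (v + w) = v + w - dF x (?z v + ?z w)"
    "normal_part g h F x (c *\<^sub>R v) = c *\<^sub>R v - dF x (c *\<^sub>R ?z v)"
    by (rule eq; simp add: ip_simps tangential_part[OF x])+
  then show "normal_part g h F x (v + w) = normal_part g h F x v + normal_part g h F x w"
    "normal_part g h F x (c *\<^sub>R v) = c *\<^sub>R normal_part g h F x v"
    by (simp_all add: normal_part_def linear_add[OF linear_dF[OF x]] linear_cmul[OF linear_dF[OF x]]
      scaleR_diff_right)
qed

lemma smooth_NC: "smooth_on S W \<Longrightarrow> smooth_on S (\<lambda>x. NC x u W)"
  unfolding normal_cov_def by (intro smooth_normal_part smooth_D)

lemma normal_NC: "x \<in> S \<Longrightarrow> normal x (NC x u W)"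
  unfolding normal_cov_def by (rule normal_normal_part)

lemma G_NC: "x \<in> S \<Longrightarrow> normal x n \<Longrightarrow> G x (NC x u W) n = G x (D x u W) n"
  unfolding normal_cov_def by (rule G_normal_part)

text \<open>The Gauss formula.\<close>

lemma second_ff_eq: "x \<in> S \<Longrightarrow> B x u v = D x u (\<lambda>y. dF y v) - dF x (christoffel g x u v)"
  unfolding second_ff_def by (rule normal_part_eqI) (simp_all add: D_dF_tangential)

lemma G_second_ff: "x \<in> S \<Longrightarrow> normal x n \<Longrightarrow> G x (B x u v) n = G x (D x u (\<lambda>y. dF y v)) n"
  by (simp add: second_ff_eq ip_simps normalD')

lemma smooth_second_ff: "smooth_on S (\<lambda>x. B x u v)"
  unfolding second_ff_def by (intro smooth_normal_part smooth_D smooth_dF)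

lemma second_ff_commute: "x \<in> S \<Longrightarrow> B x u v = B x v u"
  unfolding second_ff_def by (simp add: D_dF_commute)

lemma linear_second_ff:
  assumes x: "x \<in> S"
  shows "linear (\<lambda>u. B x u v)" "linear (B x u)"
proof -
  show *: "linear (\<lambda>u. B x u v)" for v
    unfolding second_ff_def
    using linear_compose[OF linear_D[OF x smooth_dF] linear_normal_part[OF x]] by (simp add: o_def)
  have "B x u = (\<lambda>v. B x v u)" using second_ff_commute[OF x] by blast
  with * show "linear (B x u)" by simp
qed

lemma cov_const: "cov g x u (\<lambda>_. v) = christoffel g x u v"
  by (simp add: cov_def)

text \<open>The entries of the inverse metric are the components of \<open>sharp\<close> of the
  coordinate forms, so \<open>smooth_on_sharp\<close> applies to them.\<close>

lemma smooth_on_metric_trace: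
  assumes "\<And>u v. smooth_on S (\<lambda>x. b x u v)"
  shows "smooth_on S (\<lambda>x. metric_trace (g x) (b x))"
proof -
  have "(\<chi> i. axis i (1::real) $ j) = axis j 1" for j :: 'm
    by (auto simp: vec_eq_iff axis_def)
  then have "matrix_inv A $ i $ j = sharp A (\<lambda>w. w $ j) $ i" for A :: "real^'m^'m" and i j
    by (simp add: sharp_def matrix_vector_mul_component inner_axis)
  moreover have "smooth_on S (\<lambda>x. sharp (g x) (\<lambda>w. w $ j) $ i)" for i j
    by (intro smooth_on_nth smooth_on_sharp smooth_on_const open_S smooth_g metric_g)
  ultimately show ?thesis
    unfolding metric_trace_def by (intro smooth_on_sum smooth_on_scaleR open_S assms) simp
qed

lemma smooth_H: "smooth_on S H"
  unfolding mean_curvature_def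
  by (intro smooth_on_scaleR smooth_on_const smooth_on_metric_trace smooth_second_ff open_S)

lemma normal_H: "x \<in> S \<Longrightarrow> normal x (H x)"
proof -
  assume x: "x \<in> S"
  have "G x (metric_trace (g x) (B x)) (dF x w) = 0" for w
    unfolding metric_trace_linear[OF linear_G(1), symmetric]
    using normal_normal_part[OF x] by (simp add: second_ff_def normal_def metric_trace_def)
  then show ?thesis by (simp add: normal_def mean_curvature_def ip_simps)
qed

lemma metric_trace_second_ff: "metric_trace (g x) (B x) = real CARD('m) *\<^sub>R H x"
  by (simp add: mean_curvature_def)

end

section \<open>Pseudo-umbilical biharmonic charts on which H has no zeros\<close>

locale pseudo_umbilical_chart = immersed_chart h T F S g
  for h :: "real^6 \<Rightarrow> real^6^6" and T and F :: "real^4 \<Rightarrow> real^6" and S and g +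
  fixes k :: real
  assumes curvature: "y \<in> T \<Longrightarrow> curvature h y a b w = k *\<^sub>R (ip (h y) b w *\<^sub>R a - ip (h y) a w *\<^sub>R b)"
    and k: "k \<le> 0"
    and H_nz: "x \<in> S \<Longrightarrow> H x \<noteq> 0"
    and umbilical: "x \<in> S \<Longrightarrow> shape_op g h F x (H x) u = ip (h (F x)) (H x) (H x) *\<^sub>R u"
    and biharmonic: "x \<in> S \<Longrightarrow> normal_laplacian g h F H x
        - metric_trace (g x) (\<lambda>u v. B x (shape_op g h F x (H x) u) v) + (4 * k) *\<^sub>R H x = 0"
begin

definition r :: "real^4 \<Rightarrow> real"
  where "r x = sqrt (G x (H x) (H x))"

definition e5 :: "real^4 \<Rightarrow> real^6"
  where "e5 x = (1 / r x) *\<^sub>R H x"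

lemma r_pos [simp]: "x \<in> S \<Longrightarrow> r x > 0"
  by (simp add: r_def ip_pos H_nz)

lemma r_nz [simp]: "x \<in> S \<Longrightarrow> r x \<noteq> 0"
  using r_pos by fastforce

lemma r_square: "x \<in> S \<Longrightarrow> G x (H x) (H x) = (r x)\<^sup>2"
  by (simp add: r_def ip_nonneg)

lemma smooth_r: "smooth_on S r"
  unfolding r_def by (intro smooth_on_sqrt smooth_G smooth_H open_S) (simp add: ip_pos H_nz)

lemma smooth_e5: "smooth_on S e5"
  unfolding e5_def
  by (intro smooth_on_scaleR smooth_on_divide smooth_on_const smooth_H smooth_r open_S r_nz)

lemma H_eq: "x \<in> S \<Longrightarrow> H x = r x *\<^sub>R e5 x"
  by (simp add: e5_def)

lemma normal_e5: "x \<in> S \<Longrightarrow> normal x (e5 x)"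
  using normal_H by (simp add: e5_def normal_def ip_simps)

lemma e5_unit: "x \<in> S \<Longrightarrow> G x (e5 x) (e5 x) = 1"
  by (simp add: e5_def ip_simps r_square power2_eq_square)

lemma D_e5_orthogonal: "x \<in> S \<Longrightarrow> G x (D x u e5) (e5 x) = 0"
  using D_metric[OF _ smooth_e5 smooth_e5, of x u] dirderiv_cong[OF open_S, of x "\<lambda>y. G y (e5 y) (e5 y)" "\<lambda>_. 1" u]
  by (simp add: e5_unit G_commute[of x "e5 x"])

text \<open>Dividing the pseudo-umbilical condition by \<open>r\<close> says that the shape operator
  in the unit direction \<open>e5\<close> is \<open>r\<close> times the identity.\<close>

lemma G_D_dF_e5:
  assumes x: "x \<in> S"
  shows "G x (D x u (\<lambda>y. dF y v)) (e5 x) = r x * ip (g x) u v"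
proof -
  have "linear (\<lambda>v. G x (B x u v) (H x))"
    using linear_compose[OF linear_second_ff(2)[OF x] linear_G(1)] by (simp add: o_def)
  from ip_sharp[OF metric_g[OF x] this, of v]
  have "G x (B x u v) (H x) = ip (g x) v (shape_op g h F x (H x) u)"
    by (simp add: shape_op_def)
  then have "G x (D x u (\<lambda>y. dF y v)) (H x) = (r x)\<^sup>2 * ip (g x) u v"
    by (simp add: umbilical r_square x ip_simps G_second_ff normal_H ip_commute[OF metric_g[OF x], of v u])
  then show ?thesis
    by (simp add: e5_def ip_simps power2_eq_square x)
qed

lemma D_e5_dF:
  assumes x: "x \<in> S"
  shows "G x (D x u e5) (dF x v) = - r x * ip (g x) u v"
  using D_metric[OF x smooth_e5 smooth_dF[of v], of u] G_D_dF_e5[OF x, of u v]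
    dirderiv_cong[OF open_S x, of "\<lambda>y. G y (e5 y) (dF y v)" "\<lambda>_. 0" u]
    G_commute[OF x, of "e5 x" "D x u (\<lambda>y. dF y v)"]
  by (simp add: normalD normal_e5)

text \<open>Pseudo-umbilicity turns the trace term of the normal equation into
  \<open>4 r^2 H\<close>. For \<open>k \<le> 0\<close> the normal Laplacian of \<open>H\<close> is
  thus a positive multiple of \<open>H\<close>.\<close>

lemma normal_laplacian_eq:
  assumes x: "x \<in> S"
  shows "normal_laplacian g h F H x = (4 * ((r x)\<^sup>2 - k) * r x) *\<^sub>R e5 x"
proof -
  have "metric_trace (g x) (\<lambda>u v. B x (shape_op g h F x (H x) u) v) = (r x)\<^sup>2 *\<^sub>R (4 *\<^sub>R H x)"
    using metric_trace_second_ff[of x]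
    by (simp add: umbilical x r_square linear_cmul[OF linear_second_ff(1)[OF x]] metric_trace_scale)
  with biharmonic[OF x] show ?thesis
    by (simp add: H_eq x algebra_simps)
qed

text \<open>This is where codimension two enters.\<close>

lemma eq_if_components_eq:
  assumes x: "x \<in> S" and n: "normal x n" "G x n n = 1" "G x n (e5 x) = 0"
    and dF: "\<And>w. G x V (dF x w) = G x W (dF x w)" and e5: "G x V (e5 x) = G x W (e5 x)" and nn: "G x V n = G x W n"
  shows "V = W"
proof -
  \<comment> \<open>Tangent space, \<open>e5\<close> and \<open>n\<close> account for 4 + 1 + 1 = 6
    dimensions, so the injective \<open>L\<close> is onto and \<open>V - W\<close> becomes
    orthogonal to itself.\<close>
  define L :: "(real^4) \<times> real \<times> real \<Rightarrow> real^6"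
    where "L = (\<lambda>(u, a, b). dF x u + a *\<^sub>R e5 x + b *\<^sub>R n)"
  have "linear L"
    by (rule linearI) (auto simp: L_def linear_add[OF linear_dF[OF x]] linear_cmul[OF linear_dF[OF x]] algebra_simps)
  moreover have "inj L"
  proof (rule linear_injective_0[THEN iffD2, OF \<open>linear L\<close>], clarify)
    fix u a b assume L: "L (u, a, b) = 0"
    have "G x (e5 x) n = 0" using n G_commute[OF x] by metis
    then have "G x (L (u, a, b)) (dF x u) = ip (g x) u u" "G x (L (u, a, b)) (e5 x) = a" "G x (L (u, a, b)) n = b"
      using n by (simp_all add: L_def ip_simps isometric x normalD normalD' normal_e5 e5_unit)
    then show "(u, a, b) = 0"
      unfolding L using ip_eq_0[OF metric_g[OF x], of u] by (simp add: ip_simps zero_prod_def)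
  qed
  ultimately have "surj L"
    by (rule linear_injective_imp_surjective) (simp add: DIM_prod)
  then obtain u a b where "V - W = L (u, a, b)" by (metis surjD prod_cases3)
  moreover have "G x (V - W) (L (u, a, b)) = 0"
    using dF e5 nn by (simp add: L_def ip_simps)
  ultimately have "G x (V - W) (V - W) = 0" by simp
  then have "V - W = 0" using ip_eq_0[OF metric_F[OF x]] by blast
  then show ?thesis by simp
qed

text \<open>Normal vectors orthogonal to \<open>e5\<close> form a line. So \<open>Z\<close> is a
  scalar form times a fixed unit vector \<open>n\<close>, and the trace is the squared length of
  that form.\<close>

lemma metric_trace_G_nonneg:
  assumes x: "x \<in> S" and Z: "linear Z" "\<And>u. normal x (Z u)" "\<And>u. G x (Z u) (e5 x) = 0"
  shows "metric_trace (g x) (\<lambda>u v. G x (Z v) (Z u)) \<ge> 0"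
proof (cases "\<forall>u. Z u = 0")
  case True
  then show ?thesis by (simp add: metric_trace_def ip_simps)
next
  case False
  then obtain u0 where u0: "Z u0 \<noteq> 0" by blast
  define n where "n = (1 / sqrt (G x (Z u0) (Z u0))) *\<^sub>R Z u0"
  have pos: "G x (Z u0) (Z u0) > 0" using u0 x by (simp add: ip_pos)
  then have n: "normal x n" "G x n n = 1" "G x n (e5 x) = 0"
    using Z by (simp_all add: n_def normal_def ip_simps)
  define \<omega> where "\<omega> u = G x (Z u) n" for u
  have Zn: "Z u = \<omega> u *\<^sub>R n" for u
    by (rule eq_if_components_eq[OF x n]) (use Z n in \<open>simp_all add: normalD ip_simps \<omega>_def\<close>)
  have "G x (Z v) (Z u) = \<omega> v *\<^sub>R \<omega> u" for u v
    by (simp add: Zn ip_simps n)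
  moreover have "linear \<omega>"
    using linear_compose[OF Z(1) linear_G(1)] unfolding \<omega>_def[abs_def] by (simp add: o_def)
  ultimately have "metric_trace (g x) (\<lambda>u v. G x (Z v) (Z u)) = \<omega> (sharp (g x) \<omega>)"
    using metric_trace_rank_one[of \<omega> "g x" \<omega>] by simp
  also have "\<dots> = ip (g x) (sharp (g x) \<omega>) (sharp (g x) \<omega>)"
    by (rule ip_sharp[OF metric_g[OF x] \<open>linear \<omega>\<close>, symmetric])
  finally show ?thesis by (simp add: ip_nonneg x)
qed

text \<open>If \<open>dr\<close> vanished, the normal derivative of \<open>H\<close> would be
  orthogonal to \<open>e5\<close>, and the \<open>e5\<close> component of the Laplacian would be
  \<open>- 1 / r\<close> times its squared length. By \<open>normal_laplacian_eq\<close> that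
  component is positive.\<close>

lemma r_not_constant:
  assumes "S \<noteq> {}"
  shows "\<exists>x\<in>S. \<exists>u. dirderiv r x u \<noteq> 0"
proof (rule ccontr)
  assume "\<not> ?thesis"
  then have dr: "dirderiv r x u = 0" if "x \<in> S" for x u using that by blast
  obtain x where x: "x \<in> S" using assms by blast
  have DH: "D y v H = r y *\<^sub>R D y v e5" if "y \<in> S" for y v
  proof -
    have "D y v H = D y v (\<lambda>z. r z *\<^sub>R e5 z)" by (rule D_cong[OF that H_eq])
    then show ?thesis by (simp add: D_scaleR that smooth_r smooth_e5 dr)
  qed
  have NC_e5: "G y (NC y v H) (e5 y) = 0" if "y \<in> S" for y v
    by (simp add: G_NC that normal_e5 DH ip_simps D_e5_orthogonal)
  \<comment> \<open>Differentiating the orthogonality \<open>NC_e5\<close> moves the outer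
    derivative onto \<open>e5\<close>, and for constant \<open>r\<close> the derivative of
    \<open>e5\<close> is that of \<open>H\<close> divided by \<open>r\<close>.\<close>
  have 1: "G x (NC x u (\<lambda>y. NC y v H)) (e5 x) = - (1 / r x) * G x (NC x v H) (NC x u H)" for u v
  proof -
    have "G x (NC x u (\<lambda>y. NC y v H)) (e5 x) = - G x (NC x v H) (D x u e5)"
      using D_metric[OF x smooth_NC[OF smooth_H, of v] smooth_e5, of u]
        dirderiv_cong[OF open_S x, of "\<lambda>y. G y (NC y v H) (e5 y)" "\<lambda>_. 0" u, OF NC_e5]
      by (simp add: G_NC x normal_e5)
    also have "G x (NC x v H) (D x u e5) = (1 / r x) * G x (D x u H) (NC x v H)"
      using x G_commute[OF x, of "D x u e5"] by (simp add: DH ip_simps)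
    also have "G x (D x u H) (NC x v H) = G x (NC x v H) (NC x u H)"
      using G_NC[OF x normal_NC[OF x], of u H v H] G_commute[OF x] by metis
    finally show ?thesis by simp
  qed
  have "4 * ((r x)\<^sup>2 - k) * r x = G x (normal_laplacian g h F H x) (e5 x)"
    by (simp add: normal_laplacian_eq x ip_simps e5_unit)
  also have "\<dots> = metric_trace (g x) (\<lambda>u v. G x (NC x u (\<lambda>y. NC y v H) - NC x (cov g x u (\<lambda>_. v)) H) (e5 x))"
    unfolding normal_laplacian_def by (rule metric_trace_linear[OF linear_G(1), symmetric])
  also have "\<dots> = metric_trace (g x) (\<lambda>u v. (- (1 / r x)) *\<^sub>R G x (NC x v H) (NC x u H))"
    by (simp add: ip_simps 1 NC_e5 x)
  also have "\<dots> = - (1 / r x) * metric_trace (g x) (\<lambda>u v. G x (NC x v H) (NC x u H))"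
    unfolding metric_trace_scale by simp
  also have "\<dots> \<le> 0"
  proof -
    have "linear (\<lambda>u. NC x u H)"
      unfolding normal_cov_def
      using linear_compose[OF linear_D[OF x smooth_H] linear_normal_part[OF x]] by (simp add: o_def)
    from metric_trace_G_nonneg[OF x this normal_NC[OF x] NC_e5[OF x]]
    show ?thesis using r_pos[OF x] by (simp add: divide_nonneg_pos)
  qed
  finally show False
    using r_pos[OF x] k by (smt (verit) mult_pos_pos zero_less_power)
qed

text \<open>The field \<open>D y v e5 + r y *\<^sub>R dF y v\<close> is the normal derivative of
  \<open>e5\<close>. Written with it, the Codazzi equation mentions no second normal vector; it can
  therefore be used both to construct \<open>e6\<close> and, afterwards, in the adapted
  frame.\<close>

lemma Codazzi_e5:
  assumes x: "x \<in> S"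
  shows "- dirderiv r x u * ip (g x) v w + dirderiv r x v * ip (g x) u w
    + G x (D x u (\<lambda>y. D y v e5 + r y *\<^sub>R dF y v) - D x v (\<lambda>y. D y u e5 + r y *\<^sub>R dF y u)) (dF x w) = 0"
proof -
  have "D x u (\<lambda>y. D y v e5 + r y *\<^sub>R dF y v) =
    D x u (\<lambda>y. D y v e5) + dirderiv r x u *\<^sub>R dF x v + r x *\<^sub>R D x u (\<lambda>y. dF y v)" for u v
    by (simp add: D_add D_scaleR x smooth_D smooth_e5 smooth_r smooth_dF smooth_on_scaleR open_S)
  moreover have "D x u (\<lambda>y. D y v e5) - D x v (\<lambda>y. D y u e5) = 0"
    by (simp add: D_curvature x smooth_e5 curvature normalD' normal_e5)
  ultimately show ?thesis
    by (simp add: D_dF_commute[OF x, of u v] isometric[OF x] ip_simps algebra_simps)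
qed

end

section \<open>The overdetermined system\<close>

text \<open>The polynomial is the second derivative of the constraint after elimination. The bounds
  on \<open>m\<close> express \<open>b > 0\<close> and \<open>c \<le> 0\<close> in the variables of
  \<open>constrained_flow_empty\<close>.\<close>

lemma cubic_system_no_solution:
  fixes x m :: real
  assumes x: "x > 0" and m: "m < 0" "4 * m + 3 * x - 4 < 0" "3 * x\<^sup>2 + 4 * m + 3 * x - 4 \<ge> 0"
  shows "m\<^sup>2 * (16 - 33 * x) + m * (6 * x\<^sup>2 + 63 * x - 24) + 9 * x ^ 3 - 9 * x\<^sup>2 - 24 * x + 8 < 0"
proof -
  have "3 * x\<^sup>2 + 3 * x > 4" using m by linarith
  \<comment> \<open>At \<open>x = 3 / 4\<close> the increasing expression \<open>3 x^2 + 3 x\<close>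
    is only 63/16.\<close>
  then have x1: "x > 3 / 4"
  proof -
    have "False" if "x \<le> 3 / 4"
      using mult_mono[of x "3/4" x "3/4"] that x \<open>3 * x\<^sup>2 + 3 * x > 4\<close> by (simp add: power2_eq_square)
    then show ?thesis by force
  qed
  have lin: "6 * x\<^sup>2 + 63 * x - 24 > 0" using x1 zero_le_power2[of x] by linarith
  \<comment> \<open>Of the two upper bounds 0 and \<open>(4 - 3 x) / 4\<close> for \<open>m\<close>,
    the first is the stronger one up to \<open>x = 4 / 3\<close>, the second beyond.\<close>
  show ?thesis
  proof (cases "x \<le> 4 / 3")
    case True
    have "m\<^sup>2 * (16 - 33 * x) \<le> 0" using x1 by (intro mult_nonneg_nonpos) auto
    moreover have "m * (6 * x\<^sup>2 + 63 * x - 24) \<le> 0" using lin m by (intro mult_nonpos_nonneg) auto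
    moreover have "9 * x ^ 3 \<le> 12 * x\<^sup>2"
      using mult_right_mono[OF True, of "x\<^sup>2"] by (simp add: power3_eq_cube power2_eq_square)
    moreover have "3 * x\<^sup>2 \<le> 4 * x" using mult_right_mono[OF True, of x] x by (simp add: power2_eq_square)
    ultimately show ?thesis using x1 by linarith
  next
    case False
    \<comment> \<open>The distance of \<open>m\<close> below its bound. Expanded in powers of
      \<open>d\<close>, the polynomial has only nonpositive coefficients and a negative constant
      term.\<close>
    define d where "d = (4 - 3 * x) / 4 - m"
    have d: "d > 0" "m = (4 - 3 * x) / 4 - d" using m by (auto simp: d_def)
    have "m\<^sup>2 * (16 - 33 * x) + m * (6 * x\<^sup>2 + 63 * x - 24) + 9 * x ^ 3 - 9 * x\<^sup>2 - 24 * x + 8 =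
      - (x\<^sup>2 * (225 * x - 132) / 16) - d * ((3 * x - 4) * (33 * x - 16) / 2 + (6 * x\<^sup>2 + 63 * x - 24))
      - d\<^sup>2 * (33 * x - 16)"
      unfolding d(2) by (simp add: power2_eq_square power3_eq_cube field_simps)
    moreover have "x\<^sup>2 * (225 * x - 132) / 16 > 0" using False by simp
    moreover have "d * ((3 * x - 4) * (33 * x - 16) / 2 + (6 * x\<^sup>2 + 63 * x - 24)) \<ge> 0"
      using False d(1) lin by (intro mult_nonneg_nonneg add_nonneg_nonneg) auto
    moreover have "d\<^sup>2 * (33 * x - 16) \<ge> 0" using False by simp
    ultimately show ?thesis by linarith
  qed
qed

text \<open>To be applied to \<open>s = t/r\<close>, \<open>p = q/w\<close>, \<open>b = r\<^sup>2/w\<^sup>2\<close>, \<open>c = k/w\<^sup>2\<close> and \<open>V = E/w\<close>, in which the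
  system along \<open>E\<close> becomes polynomial. The constraint and its derivative are solved for
  \<open>p\<close>, \<open>b\<close>, \<open>c\<close> in terms of \<open>x = s\<^sup>2\<close> and \<open>m = 1 + s\<^sup>2 + 2 s p\<close>.\<close>

lemma constrained_flow_empty:
  fixes s p b c :: "'a::real_normed_vector \<Rightarrow> real"
  assumes "open S" "x0 \<in> S"
    and diff: "\<And>y. y \<in> S \<Longrightarrow> s differentiable (at y)" "\<And>y. y \<in> S \<Longrightarrow> p differentiable (at y)"
      "\<And>y. y \<in> S \<Longrightarrow> b differentiable (at y)" "\<And>y. y \<in> S \<Longrightarrow> c differentiable (at y)"
    and ds: "\<And>y. y \<in> S \<Longrightarrow> dirderiv s y (V y) = - (1 + (s y)\<^sup>2) - 4 * s y * p y"
    and dp: "\<And>y. y \<in> S \<Longrightarrow> dirderiv p y (V y) = b y * (3 * (s y)\<^sup>2 - 1) - c y + 2 * (p y)\<^sup>2 + 2 * s y * p y"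
    and db: "\<And>y. y \<in> S \<Longrightarrow> dirderiv b y (V y) = 6 * b y * (s y + p y)"
    and dc: "\<And>y. y \<in> S \<Longrightarrow> dirderiv c y (V y) = c y * (6 * p y + 4 * s y)"
    and constraint: "\<And>y. y \<in> S \<Longrightarrow> 1 + (s y)\<^sup>2 + 2 * s y * p y + 2 * b y - 2 * c y = 0"
    and sign: "b x0 > 0" "c x0 \<le> 0" "s x0 \<noteq> 0"
  shows False
proof -
  have Q: "6 * (s y)^3 * b y - (1 + (s y)\<^sup>2 + 2 * s y * p y) * (7 * s y + 8 * p y) = 0" if y: "y \<in> S" for y
  proof -
    note d = dirderiv_works[OF diff(1)[OF y]] dirderiv_works[OF diff(2)[OF y]]
      dirderiv_works[OF diff(3)[OF y]] dirderiv_works[OF diff(4)[OF y]]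
    have "((\<lambda>y. 1 + (s y)\<^sup>2 + 2 * s y * p y + 2 * b y - 2 * c y) has_derivative
      (\<lambda>u. 2 * s y * dirderiv s y u + 2 * (s y * dirderiv p y u + dirderiv s y u * p y)
        + 2 * dirderiv b y u - 2 * dirderiv c y u)) (at y)"
      by (auto intro!: derivative_eq_intros d simp: algebra_simps)
    from dirderiv_eq[OF this, of "V y"] dirderiv_cong[OF assms(1) y constraint, where v = "V y"]
    have "2 * s y * dirderiv s y (V y) + 2 * (s y * dirderiv p y (V y) + dirderiv s y (V y) * p y)
        + 2 * dirderiv b y (V y) - 2 * dirderiv c y (V y) = 0" by simp
    \<comment> \<open>The multiplier \<open>5 s + 6 p\<close> is the one that cancels all terms in
      \<open>c\<close>; it also removes \<open>b\<close> except for \<open>6 s^3 b\<close>.\<close>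
    then have "(2 * s y * dirderiv s y (V y) + 2 * (s y * dirderiv p y (V y) + dirderiv s y (V y) * p y)
        + 2 * dirderiv b y (V y) - 2 * dirderiv c y (V y))
      - (5 * s y + 6 * p y) * (1 + (s y)\<^sup>2 + 2 * s y * p y + 2 * b y - 2 * c y) = 0"
      using constraint[OF y] by simp
    then show ?thesis
      unfolding ds[OF y] dp[OF y] db[OF y] dc[OF y]
      by (simp add: power2_eq_square power3_eq_cube algebra_simps)
  qed
  define s0 p0 b0 where "s0 = s x0" and "p0 = p x0" and "b0 = b x0"
  define x m where "x = s0\<^sup>2" and "m = 1 + s0\<^sup>2 + 2 * s0 * p0"
  have "s0 \<noteq> 0" using sign by (simp add: s0_def)
  then have x: "x > 0" by (simp add: x_def)
  note y = assms(2)
  have c0: "c x0 = m / 2 + b0" using constraint[OF y] by (simp add: m_def s0_def p0_def b0_def field_simps)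
  have p0: "2 * s0 * p0 = m - 1 - x" by (simp add: m_def x_def)
  \<comment> \<open>The extra factor \<open>s0\<close> makes \<open>s0\<close> and \<open>p0\<close>
    occur only through \<open>s0^2\<close> and \<open>2 s0 p0\<close>, that is through
    \<open>x\<close> and \<open>m\<close>.\<close>
  have "6 * x\<^sup>2 * b0 = (6 * s0 ^ 3 * b0) * s0"
    by (simp add: x_def power2_eq_square power3_eq_cube)
  also have "6 * s0 ^ 3 * b0 = m * (7 * s0 + 8 * p0)"
    using Q[OF y] by (simp add: m_def s0_def p0_def b0_def)
  also have "m * (7 * s0 + 8 * p0) * s0 = m * (7 * x + 4 * (2 * s0 * p0))"
    by (simp add: x_def power2_eq_square algebra_simps)
  also have "7 * x + 4 * (2 * s0 * p0) = 4 * m + 3 * x - 4" unfolding p0 by simp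
  finally have b0: "6 * x\<^sup>2 * b0 = m * (4 * m + 3 * x - 4)" .
  \<comment> \<open>From \<open>c x0 \<le> 0 < b0\<close>. Division by the negative \<open>m\<close>
    then turns the signs of \<open>b0\<close> and \<open>c x0\<close> into the remaining two
    inequalities.\<close>
  have m: "m < 0" using c0 sign by (simp add: b0_def)
  have "m * (4 * m + 3 * x - 4) > 0" unfolding b0[symmetric] using x sign by (simp add: b0_def)
  then have 1: "4 * m + 3 * x - 4 < 0" using m by (simp add: zero_less_mult_iff)
  have "6 * x\<^sup>2 * (m + 2 * b0) \<le> 0" using c0 sign by (intro mult_nonneg_nonpos) auto
  then have "m * (3 * x\<^sup>2 + 4 * m + 3 * x - 4) \<le> 0" using b0 by (simp add: algebra_simps)
  then have 2: "3 * x\<^sup>2 + 4 * m + 3 * x - 4 \<ge> 0" using m by (simp add: mult_le_0_iff)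
  note d = dirderiv_works[OF diff(1)[OF y]] dirderiv_works[OF diff(2)[OF y]]
      dirderiv_works[OF diff(3)[OF y]]
  have "((\<lambda>y. 6 * (s y)^3 * b y - (1 + (s y)\<^sup>2 + 2 * s y * p y) * (7 * s y + 8 * p y)) has_derivative
    (\<lambda>u. 18 * s0\<^sup>2 * b0 * dirderiv s x0 u + 6 * s0 ^ 3 * dirderiv b x0 u
      - (2 * s0 * dirderiv s x0 u + 2 * (s0 * dirderiv p x0 u + dirderiv s x0 u * p0)) * (7 * s0 + 8 * p0)
      - m * (7 * dirderiv s x0 u + 8 * dirderiv p x0 u))) (at x0)"
    by (auto intro!: derivative_eq_intros d simp: s0_def p0_def b0_def m_def algebra_simps power2_eq_square
      power3_eq_cube)
  from dirderiv_eq[OF this, of "V x0"] dirderiv_cong[OF assms(1) y Q, where v = "V x0"]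
  have EQ: "18 * s0\<^sup>2 * b0 * (- (1 + s0\<^sup>2) - 4 * s0 * p0) + 6 * s0 ^ 3 * (6 * b0 * (s0 + p0))
      - (2 * s0 * (- (1 + s0\<^sup>2) - 4 * s0 * p0) + 2 * (s0 * (b0 * (3 * s0\<^sup>2 - 1) - (m / 2 + b0) + 2 * p0\<^sup>2 + 2 * s0 * p0)
      + (- (1 + s0\<^sup>2) - 4 * s0 * p0) * p0)) * (7 * s0 + 8 * p0)
      - m * (7 * (- (1 + s0\<^sup>2) - 4 * s0 * p0) + 8 * (b0 * (3 * s0\<^sup>2 - 1) - (m / 2 + b0) + 2 * p0\<^sup>2 + 2 * s0 * p0)) = 0"
    unfolding ds[OF y] dp[OF y] db[OF y] c0 s0_def[symmetric] p0_def[symmetric] b0_def[symmetric] by simp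
  \<comment> \<open>The coefficient of \<open>b0\<close> in \<open>EQ\<close>, which is affine in
    \<open>b0\<close>. Scaling by \<open>3 s0^4\<close> and subtracting \<open>?A / 2\<close> times
    the relation \<open>b0\<close> eliminates \<open>b0\<close>; the rest depends on
    \<open>x\<close> and \<open>m\<close> only and has the nonzero factor \<open>m\<close>.\<close>
  let ?A = "18 * s0\<^sup>2 * (- (1 + s0\<^sup>2) - 4 * s0 * p0) + 36 * s0 ^ 3 * (s0 + p0)
    - 2 * s0 * (3 * s0\<^sup>2 - 2) * (7 * s0 + 8 * p0) - 8 * m * (3 * s0\<^sup>2 - 2)"
  have "3 * s0 ^ 4 * (18 * s0\<^sup>2 * b0 * (- (1 + s0\<^sup>2) - 4 * s0 * p0) + 6 * s0 ^ 3 * (6 * b0 * (s0 + p0))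
      - (2 * s0 * (- (1 + s0\<^sup>2) - 4 * s0 * p0) + 2 * (s0 * (b0 * (3 * s0\<^sup>2 - 1) - (m / 2 + b0) + 2 * p0\<^sup>2 + 2 * s0 * p0)
      + (- (1 + s0\<^sup>2) - 4 * s0 * p0) * p0)) * (7 * s0 + 8 * p0)
      - m * (7 * (- (1 + s0\<^sup>2) - 4 * s0 * p0) + 8 * (b0 * (3 * s0\<^sup>2 - 1) - (m / 2 + b0) + 2 * p0\<^sup>2 + 2 * s0 * p0)))
      - ?A / 2 * (6 * (s0\<^sup>2)\<^sup>2 * b0 - m * (4 * m + 3 * s0\<^sup>2 - 4)) =
    4 * (m * (m\<^sup>2 * (16 - 33 * s0\<^sup>2) + m * (6 * (s0\<^sup>2)\<^sup>2 + 63 * s0\<^sup>2 - 24) + 9 * (s0\<^sup>2) ^ 3 - 9 * (s0\<^sup>2)\<^sup>2 - 24 * s0\<^sup>2 + 8))"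
    unfolding m_def by (simp add: field_simps) algebra
  then have "m * (m\<^sup>2 * (16 - 33 * x) + m * (6 * x\<^sup>2 + 63 * x - 24) + 9 * x ^ 3 - 9 * x\<^sup>2 - 24 * x + 8) = 0"
    unfolding EQ using b0 by (simp add: x_def)
  then have "m\<^sup>2 * (16 - 33 * x) + m * (6 * x\<^sup>2 + 63 * x - 24) + 9 * x ^ 3 - 9 * x\<^sup>2 - 24 * x + 8 = 0"
    using m by (simp add: x_def)
  with cubic_system_no_solution[OF x m 1 2] show False by simp
qed

section \<open>Algebraic consequences of the Codazzi equations\<close>

text \<open>Two linear conditions in dimension four have a nonzero solution; Euclidean orthogonality
  to \<open>g *v a\<close> is \<open>g\<close>-orthogonality to \<open>a\<close>.\<close>

lemma exists_orthogonal_vector: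
  fixes g :: "real^4^4"
  assumes "metric_matrix g"
  obtains v where "v \<noteq> 0" "ip g a v = 0" "ip g b v = 0"
proof -
  have "dim {g *v a, g *v b} \<le> card {g *v a, g *v b}" by (rule dim_le_card') simp
  also have "\<dots> \<le> 2" by (simp add: card_insert_if)
  finally have "dim {g *v a, g *v b} < DIM(real^4)" by simp
  then obtain v where "v \<noteq> 0" and v: "\<And>y. y \<in> span {g *v a, g *v b} \<Longrightarrow> orthogonal v y"
    using orthogonal_to_subspace_exists by blast
  moreover have "ip g v a = 0" "ip g v b = 0"
    using v[of "g *v a"] v[of "g *v b"] by (simp_all add: span_base orthogonal_def ip_def)
  ultimately show ?thesis
    using that ip_commute[OF assms] by metis
qed

lemma orthogonal_split:
  assumes "ip g E E = 1"
  shows "ip g E (u - ip g E u *\<^sub>R E) = 0"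
  by (simp add: ip_simps assms)

lemma metric_trace_eta:
  assumes "metric_matrix g" "linear b"
  shows "metric_trace g (\<lambda>u v. ip g E v *\<^sub>R b u) = b E"
  unfolding metric_trace_rank_one[OF assms(2)]
  by (subst sharp_eqI[OF assms(1), of E]) (simp_all add: ip_commute[OF assms(1), of _ E])

lemma linear_form_eq:
  assumes "linear l" "ip g E E = 1" "\<And>u. ip g E u = 0 \<Longrightarrow> l u = 0"
  shows "l u = l E * ip g E u"
  using assms(3)[OF orthogonal_split[OF assms(2), of u]]
  by (simp add: linear_diff[OF assms(1)] linear_cmul[OF assms(1)])

text \<open>Choose \<open>v\<close> orthogonal to \<open>E\<close> and \<open>u\<close> and set
  \<open>z = v\<close>: the right-hand side disappears. With 0 in place of \<open>E\<close> the
  statement covers all vectors.\<close>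

lemma linear_form_vanishes:
  fixes g :: "real^4^4"
  assumes g: "metric_matrix g"
    and "\<And>u v z. ip g E u = 0 \<Longrightarrow> ip g E v = 0 \<Longrightarrow> ip g E z = 0 \<Longrightarrow> l u * ip g v z = l v * ip g u z"
    and "ip g E u = 0"
  shows "(l u :: real) = 0"
proof -
  obtain v where v: "v \<noteq> 0" "ip g E v = 0" "ip g u v = 0"
    using exists_orthogonal_vector[OF g] by blast
  then have "l u * ip g v v = 0" using assms(2)[of u v v] assms(3) by simp
  then show ?thesis using v ip_eq_0[OF g] by simp
qed

text \<open>On the complement of \<open>E\<close> the equation kills \<open>l\<close>. Inserting
  \<open>E\<close> in the first slot then gives \<open>\<beta>\<close> up to the number
  \<open>\<beta> E E\<close>, and the vanishing trace fixes it as \<open>- 3 * (l E / w)\<close>;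
  the 4 in the conclusion is the dimension.\<close>

lemma Codazzi_traceless:
  fixes g :: "real^4^4" and l :: "real^4 \<Rightarrow> real" and \<beta> :: "real^4 \<Rightarrow> real^4 \<Rightarrow> real"
  assumes g: "metric_matrix g" and l: "linear l" and \<beta>: "bilinear \<beta>" "\<And>u v. \<beta> u v = \<beta> v u"
    and trace: "metric_trace g \<beta> = 0" and E: "ip g E E = 1" and w: "w > 0"
    and eq: "\<And>u v z. - l u * ip g v z + l v * ip g u z - w * ip g E v * \<beta> u z + w * ip g E u * \<beta> v z = 0"
  shows "l u = l E * ip g E u"
    and "\<beta> u v = l E / w * (ip g u v - 4 * ip g E u * ip g E v)"
proof -
  show l_eq: "l u = l E * ip g E u" for u
  proof (rule linear_form_eq[OF l E], rule linear_form_vanishes[OF g])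
    show "l u * ip g v z = l v * ip g u z" if "ip g E u = 0" "ip g E v = 0" for u v z
      using eq[of u v z] that by simp
  qed
  have lin: "linear (\<beta> v)" "linear (\<lambda>u. \<beta> u v)" for v using \<beta>(1) by (auto simp: bilinear_def)
  define b where "b = \<beta> E E"
  have \<beta>E: "\<beta> E v = b * ip g E v" for v
    unfolding b_def
  proof (rule linear_form_eq[OF lin(1) E])
    fix u assume "ip g E u = 0"
    then show "\<beta> E u = 0"
      using eq[of E u E] w E l_eq[of u] \<beta>(2)[of E u] ip_commute[OF g, of u E] by simp
  qed
  have \<beta>_eq: "\<beta> u v = l E / w * ip g u v + (b - l E / w) * (ip g E v * ip g E u)" for u v
    using eq[of E u v] w E l_eq[of u] \<beta>E[of v] by (simp add: field_simps)
  have "linear (ip g E)" using bilinear_ip[of g] by (simp add: bilinear_def)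
  from metric_trace_eta[OF g this, of E] have tr: "metric_trace g (\<lambda>u v. ip g E v * ip g E u) = 1"
    by (simp add: E)
  have "metric_trace g \<beta> = metric_trace g (\<lambda>u v. (l E / w) *\<^sub>R ip g u v + (b - l E / w) *\<^sub>R (ip g E v *\<^sub>R ip g E u))"
    by (simp add: metric_trace_def \<beta>_eq)
  also have "\<dots> = 4 * (l E / w) + (b - l E / w)"
    unfolding metric_trace_add metric_trace_scale by (simp add: metric_trace_ip[OF g] tr)
  finally have "b = - 3 * (l E / w)" using trace by simp
  then show "\<beta> u v = l E / w * (ip g u v - 4 * ip g E u * ip g E v)"
    using \<beta>_eq[of u v] by (simp add: algebra_simps)
qed

text \<open>To be used with \<open>l = dt\<close>, \<open>c = r w\<close> and the covariant
  derivative of E as \<open>K\<close>. Vectors orthogonal to \<open>E\<close> show that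
  \<open>l\<close> is a multiple of the dual form; \<open>z = E\<close> makes \<open>K\<close>
  symmetric, so it vanishes whenever one slot is \<open>E\<close>; \<open>v = E\<close> then gives
  its values on the complement.\<close>

lemma Codazzi_second:
  fixes g :: "real^4^4" and l :: "real^4 \<Rightarrow> real" and K :: "real^4 \<Rightarrow> real^4 \<Rightarrow> real"
  assumes g: "metric_matrix g" and l: "linear l" and K: "bilinear K" "\<And>u. K u E = 0"
    and E: "ip g E E = 1" and t: "t \<noteq> 0"
    and eq: "\<And>u v z. - l u * ip g v z + l v * ip g u z
      + 4 * (l u * ip g E v - l v * ip g E u + t * (K u v - K v u)) * ip g E z
      + 4 * t * (ip g E v * K u z - ip g E u * K v z)
      + c * (ip g E v * ip g u z - ip g E u * ip g v z) = 0"
  shows "K u v = - (l E + c) / (4 * t) * (ip g u v - ip g E u * ip g E v)"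
proof -
  have l_eq: "l u = l E * ip g E u" for u
  proof (rule linear_form_eq[OF l E], rule linear_form_vanishes[OF g])
    show "l u * ip g v z = l v * ip g u z" if "ip g E u = 0" "ip g E v = 0" "ip g E z = 0" for u v z
      using eq[of u v z] that by simp
  qed
  have sym: "K u v = K v u" for u v
    using eq[of u v E] E K(2) t l_eq[of u] l_eq[of v] ip_commute[OF g, of u E] ip_commute[OF g, of v E]
    by (simp add: algebra_simps)
  have KE: "K E v = 0" for v using sym[of E v] K(2)[of v] by simp
  have *: "K u v = - (l E + c) / (4 * t) * ip g u v" if "ip g E u = 0" for u v
    using eq[of u E v] that E KE l_eq[of u] K(2) t by (simp add: field_simps)
  have "K u v = K (u - ip g E u *\<^sub>R E) v"
    using K(1) KE by (simp add: bilinear_lsub bilinear_lmul)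
  then show ?thesis
    using *[OF orthogonal_split[OF E], of u v] by (simp add: ip_simps)
qed

section \<open>The adapted frame\<close>

text \<open>The field \<open>e6\<close> is constructed under Globalization. The condition on
  \<open>dr\<close> is what makes both \<open>\<omega>\<close> and \<open>t\<close> nowhere
  zero.\<close>

locale framed_chart = pseudo_umbilical_chart +
  fixes e6 :: "real^4 \<Rightarrow> real^6"
  assumes smooth_e6: "smooth_on S e6" and normal_e6: "x \<in> S \<Longrightarrow> normal x (e6 x)"
    and e6_unit: "x \<in> S \<Longrightarrow> G x (e6 x) (e6 x) = 1" and e6_e5: "x \<in> S \<Longrightarrow> G x (e6 x) (e5 x) = 0"
    and dr_nz: "x \<in> S \<Longrightarrow> \<exists>u. dirderiv r x u \<noteq> 0"
begin

lemma e5_e6: "x \<in> S \<Longrightarrow> G x (e5 x) (e6 x) = 0"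
  using e6_e5 G_commute by simp

lemmas frame_eqI = eq_if_components_eq[OF _ normal_e6 e6_unit e6_e5]

lemmas frame_simps = ip_simps normalD[OF normal_e5] normalD[OF normal_e6] normalD'[OF _ normal_e5]
  normalD'[OF _ normal_e6] e5_unit e6_unit e5_e6 e6_e5

text \<open>The connection form of the normal bundle: the normal derivative of \<open>e5\<close> is
  \<open>\<omega>\<close> times \<open>e6\<close>.\<close>

definition \<omega> :: "real^4 \<Rightarrow> real^4 \<Rightarrow> real"
  where "\<omega> x u = G x (D x u e5) (e6 x)"

definition \<beta> :: "real^4 \<Rightarrow> real^4 \<Rightarrow> real^4 \<Rightarrow> real"
  where "\<beta> x u v = G x (B x u v) (e6 x)"

lemma smooth_\<omega>: "smooth_on S (\<lambda>x. \<omega> x u)"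
  unfolding \<omega>_def by (intro smooth_G smooth_D smooth_e5 smooth_e6)

lemma linear_\<omega>: "x \<in> S \<Longrightarrow> linear (\<omega> x)"
  using linear_compose[OF linear_D[OF _ smooth_e5] linear_G(1)] unfolding \<omega>_def[abs_def] by (simp add: o_def)

lemma bilinear_\<beta>: "x \<in> S \<Longrightarrow> bilinear (\<beta> x)"
  using linear_compose[OF linear_second_ff(1) linear_G(1)] linear_compose[OF linear_second_ff(2) linear_G(1)]
  unfolding \<beta>_def[abs_def] by (simp add: o_def bilinear_def)

lemma \<beta>_commute: "x \<in> S \<Longrightarrow> \<beta> x u v = \<beta> x v u"
  by (simp add: \<beta>_def second_ff_commute[of x u])

lemma G_D_dF_e6: "x \<in> S \<Longrightarrow> G x (D x u (\<lambda>y. dF y v)) (e6 x) = \<beta> x u v"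
  by (simp add: \<beta>_def G_second_ff normal_e6)

text \<open>The mean curvature vector is a multiple of \<open>e5\<close> and so has no
  \<open>e6\<close> component.\<close>

lemma trace_\<beta>: "x \<in> S \<Longrightarrow> metric_trace (g x) (\<beta> x) = 0"
  unfolding \<beta>_def[abs_def] metric_trace_linear[OF linear_G(1)] metric_trace_second_ff
  by (simp add: H_eq frame_simps)

text \<open>A constant inner product has derivative 0; this exchanges the differentiated factor and
  yields each frame component from one already known.\<close>

lemma G_D_swap:
  assumes "x \<in> S" "smooth_on S V" "smooth_on S W" "\<And>y. y \<in> S \<Longrightarrow> G y (V y) (W y) = c"
  shows "G x (D x u V) (W x) = - G x (D x u W) (V x)"
  using D_metric[OF assms(1-3), of u] dirderiv_cong[OF open_S assms(1,4), where v = u]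
  by (simp add: G_commute[OF assms(1), of "V x" "D x u W"])

lemma D_e5:
  assumes x: "x \<in> S"
  shows "D x u e5 = - r x *\<^sub>R dF x u + \<omega> x u *\<^sub>R e6 x"
  by (rule frame_eqI[OF x x x x])
    (simp_all add: x frame_simps D_e5_dF D_e5_orthogonal \<omega>_def isometric)

lemma D_e6_dF: "x \<in> S \<Longrightarrow> G x (D x u e6) (dF x v) = - \<beta> x u v"
  using G_D_swap[OF _ smooth_e6 smooth_dF, of x v 0 u] by (simp add: normalD normal_e6 G_D_dF_e6)

lemma D_e6_e5: "x \<in> S \<Longrightarrow> G x (D x u e6) (e5 x) = - \<omega> x u"
  using G_D_swap[OF _ smooth_e6 smooth_e5 e6_e5] by (simp add: \<omega>_def)

lemma D_e6_e6: "x \<in> S \<Longrightarrow> G x (D x u e6) (e6 x) = 0"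
  using G_D_swap[OF _ smooth_e6 smooth_e6 e6_unit, of x u] by simp

text \<open>With \<open>D_e5\<close>, the field in \<open>Codazzi_e5\<close> is
  \<open>\<omega> y v *\<^sub>R e6 y\<close>; the derivative of \<open>\<omega>\<close> stays in the
  \<open>e6\<close> direction and drops out of the tangential part.\<close>

lemma Codazzi_frame:
  assumes x: "x \<in> S"
  shows "- dirderiv r x u * ip (g x) v z + dirderiv r x v * ip (g x) u z - \<omega> x v * \<beta> x u z + \<omega> x u * \<beta> x v z = 0"
proof -
  have "G x (D x u (\<lambda>y. D y v e5 + r y *\<^sub>R dF y v)) (dF x z) = - \<omega> x v * \<beta> x u z" for u v
  proof -
    have "D x u (\<lambda>y. D y v e5 + r y *\<^sub>R dF y v) = D x u (\<lambda>y. \<omega> y v *\<^sub>R e6 y)"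
      by (rule D_cong[OF x]) (simp add: D_e5)
    then show ?thesis
      by (simp add: D_scaleR x smooth_\<omega> smooth_e6 frame_simps D_e6_dF)
  qed
  with Codazzi_e5[OF x, of u v z] show ?thesis by (simp add: ip_simps)
qed

text \<open>Without \<open>\<omega>\<close> the Codazzi equation says that \<open>dr\<close>
  annihilates every vector, contrary to \<open>dr_nz\<close>.\<close>

lemma \<omega>_nz:
  assumes x: "x \<in> S"
  shows "sharp (g x) (\<omega> x) \<noteq> 0"
proof
  assume "sharp (g x) (\<omega> x) = 0"
  then have "\<omega> x u = 0" for u
    using ip_sharp[OF metric_g[OF x] linear_\<omega>[OF x], of u] by (simp add: ip_simps)
  then have "dirderiv r x u * ip (g x) v z = dirderiv r x v * ip (g x) u z" for u v z
    using Codazzi_frame[OF x, of u v z] by simp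
  then have "dirderiv r x u = 0" for u
    by (rule linear_form_vanishes[OF metric_g[OF x], of 0 "dirderiv r x"]) (simp add: ip_simps)
  with dr_nz[OF x] show False by simp
qed

section \<open>The distinguished tangent direction\<close>

definition w :: "real^4 \<Rightarrow> real"
  where "w x = sqrt (ip (g x) (sharp (g x) (\<omega> x)) (sharp (g x) (\<omega> x)))"

definition E :: "real^4 \<Rightarrow> real^4"
  where "E x = (1 / w x) *\<^sub>R sharp (g x) (\<omega> x)"

definition \<eta> :: "real^4 \<Rightarrow> real^4 \<Rightarrow> real"
  where "\<eta> x u = ip (g x) (E x) u"

text \<open>The ratio of \<open>dr\<close> to \<open>\<omega>\<close>, which Codazzi makes
  proportional. The same number turns out to be the eigenvalue of the \<open>e6\<close> shape
  operator on the complement of \<open>E\<close>.\<close>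

definition t :: "real^4 \<Rightarrow> real"
  where "t x = dirderiv r x (E x) / w x"

lemma w_pos: "x \<in> S \<Longrightarrow> w x > 0"
  by (simp add: w_def ip_pos \<omega>_nz)

lemma w_nz [simp]: "x \<in> S \<Longrightarrow> w x \<noteq> 0"
  using w_pos by fastforce

lemma smooth_sharp_\<omega>: "smooth_on S (\<lambda>x. sharp (g x) (\<omega> x))"
  by (intro smooth_on_sharp open_S smooth_g smooth_\<omega> metric_g)

lemma smooth_w: "smooth_on S w"
  unfolding w_def
  by (intro smooth_on_sqrt smooth_on_ip smooth_sharp_\<omega> smooth_g open_S) (simp add: ip_pos \<omega>_nz)

lemma smooth_E: "smooth_on S E"
  unfolding E_def
  by (intro smooth_on_scaleR smooth_on_divide smooth_on_const smooth_sharp_\<omega> smooth_w open_S w_nz)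

lemma smooth_\<eta>: "smooth_on S (\<lambda>x. \<eta> x u)"
  unfolding \<eta>_def by (intro smooth_on_ip smooth_on_const smooth_E smooth_g open_S)

lemma smooth_t: "smooth_on S t"
  unfolding t_def
  by (intro smooth_on_divide smooth_on_dirderiv_field smooth_E smooth_w smooth_r open_S w_nz)

lemma E_unit: "x \<in> S \<Longrightarrow> ip (g x) (E x) (E x) = 1"
proof -
  assume x: "x \<in> S"
  have "ip (g x) (sharp (g x) (\<omega> x)) (sharp (g x) (\<omega> x)) = w x * w x"
    using ip_nonneg[OF metric_g[OF x]] by (simp add: w_def)
  then show ?thesis using x by (simp add: E_def ip_simps)
qed

lemma \<omega>_eq: "x \<in> S \<Longrightarrow> \<omega> x u = w x * \<eta> x u"
  using ip_sharp[OF metric_g[of x] linear_\<omega>[of x], of u]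
  by (simp add: \<eta>_def E_def ip_simps ip_commute[of "g x" "sharp _ _" u])

lemma \<eta>_E: "x \<in> S \<Longrightarrow> \<eta> x (E x) = 1"
  by (simp add: \<eta>_def E_unit)

lemma linear_\<eta>: "linear (\<eta> x)"
  unfolding \<eta>_def[abs_def] using bilinear_ip[of "g x"] by (simp add: bilinear_def)

lemma
  assumes x: "x \<in> S"
  shows dr_eq: "dirderiv r x u = t x * w x * \<eta> x u"
    and \<beta>_eq: "\<beta> x u v = t x * (ip (g x) u v - 4 * \<eta> x u * \<eta> x v)"
proof -
  have "- dirderiv r x u * ip (g x) v z + dirderiv r x v * ip (g x) u z
      - w x * ip (g x) (E x) v * \<beta> x u z + w x * ip (g x) (E x) u * \<beta> x v z = 0" for u v z
    using Codazzi_frame[OF x, of u v z] by (simp add: \<omega>_eq[OF x] \<eta>_def)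
  note * = Codazzi_traceless[OF metric_g[OF x] linear_dirderiv_on[OF x smooth_r] bilinear_\<beta>[OF x]
    \<beta>_commute[OF x] trace_\<beta>[OF x] E_unit[OF x] w_pos[OF x] this]
  show "dirderiv r x u = t x * w x * \<eta> x u" using *(1)[of u] x by (simp add: t_def \<eta>_def)
  show "\<beta> x u v = t x * (ip (g x) u v - 4 * \<eta> x u * \<eta> x v)" using *(2)[of u v] by (simp add: t_def \<eta>_def)
qed

lemma t_nz [simp]: "x \<in> S \<Longrightarrow> t x \<noteq> 0"
  using dr_nz dr_eq by auto

section \<open>The covariant derivative of the distinguished direction\<close>

definition Eh :: "real^4 \<Rightarrow> real^6"
  where "Eh x = dF x (E x)"

text \<open>As \<open>Eh\<close> is tangent, the Gauss formula makes this the covariant derivative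
  of \<open>E\<close> on the submanifold, with its index lowered.\<close>

definition K :: "real^4 \<Rightarrow> real^4 \<Rightarrow> real^4 \<Rightarrow> real"
  where "K x u v = G x (D x u Eh) (dF x v)"

lemma smooth_Eh: "smooth_on S Eh"
  unfolding Eh_def by (rule smooth_dF_field[OF smooth_E])

lemma Eh_dF: "x \<in> S \<Longrightarrow> G x (Eh x) (dF x u) = \<eta> x u"
  by (simp add: Eh_def \<eta>_def isometric)

lemma dF_Eh: "x \<in> S \<Longrightarrow> G x (dF x u) (Eh x) = \<eta> x u"
  using Eh_dF G_commute by simp

lemma Eh_unit: "x \<in> S \<Longrightarrow> G x (Eh x) (Eh x) = 1"
  using Eh_dF[of x "E x"] \<eta>_E by (simp add: Eh_def)

lemma Eh_e5: "x \<in> S \<Longrightarrow> G x (Eh x) (e5 x) = 0"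
  and Eh_e6: "x \<in> S \<Longrightarrow> G x (Eh x) (e6 x) = 0"
  by (simp_all add: Eh_def frame_simps)

lemma e5_Eh: "x \<in> S \<Longrightarrow> G x (e5 x) (Eh x) = 0"
  and e6_Eh: "x \<in> S \<Longrightarrow> G x (e6 x) (Eh x) = 0"
  by (simp_all add: Eh_def frame_simps)

lemmas Eh_simps = Eh_dF dF_Eh Eh_unit Eh_e5 Eh_e6 e5_Eh e6_Eh

lemma bilinear_K:
  assumes x: "x \<in> S"
  shows "bilinear (K x)"
  using linear_compose[OF linear_D[OF x smooth_Eh] linear_G(1)] linear_compose[OF linear_dF[OF x] linear_G(2)]
  unfolding K_def[abs_def] by (simp add: o_def bilinear_def)

lemma K_E: "x \<in> S \<Longrightarrow> K x u (E x) = 0"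
  using G_D_swap[OF _ smooth_Eh smooth_Eh Eh_unit, of x u] by (simp add: K_def flip: Eh_def)

lemma d\<eta>:
  assumes x: "x \<in> S"
  shows "dirderiv (\<lambda>y. \<eta> y v) x u = K x u v + \<eta> x (christoffel g x u v)"
proof -
  have "dirderiv (\<lambda>y. \<eta> y v) x u = dirderiv (\<lambda>y. G y (Eh y) (dF y v)) x u"
    by (rule dirderiv_cong[OF open_S x]) (simp add: Eh_dF)
  also have "\<dots> = K x u v + G x (dF x (E x)) (D x u (\<lambda>y. dF y v))"
    by (simp add: D_metric x smooth_Eh smooth_dF K_def Eh_def[of x])
  finally show ?thesis
    using D_dF_tangential[OF x, of u v "E x"]
    by (simp add: \<eta>_def G_commute[OF x, of "dF x _"] ip_commute[OF metric_g[OF x], of "E x"])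
qed

lemma D_e6:
  assumes x: "x \<in> S"
  shows "D x u e6 = (- t x) *\<^sub>R dF x u + (4 * t x * \<eta> x u) *\<^sub>R Eh x + (- \<omega> x u) *\<^sub>R e5 x"
  by (rule frame_eqI[OF x x x x])
    (simp_all add: x frame_simps Eh_simps D_e6_dF D_e6_e5 D_e6_e6 \<beta>_eq algebra_simps flip: isometric)

lemma G_D_dF_dF: "x \<in> S \<Longrightarrow> G x (D x u (\<lambda>y. dF y v)) (dF x z) = G x (D x v (\<lambda>y. dF y u)) (dF x z)"
  by (simp add: D_dF_commute)

text \<open>The factor delivered by \<open>Codazzi_second\<close>, defined in advance so that it is
  visibly smooth. Geometrically it is the rate at which the directions orthogonal to
  \<open>E\<close> expand along \<open>E\<close>.\<close>

definition q :: "real^4 \<Rightarrow> real"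
  where "q x = - (dirderiv t x (E x) + r x * w x) / (4 * t x)"

lemma smooth_q: "smooth_on S q"
  unfolding q_def
  by (intro smooth_on_divide smooth_on_minus smooth_on_add smooth_on_mult smooth_on_const
    smooth_on_dirderiv_field smooth_E smooth_w smooth_r smooth_t open_S) simp

text \<open>The Codazzi equation of \<open>e6\<close>. The term \<open>r w\<close> comes from the
  tangential part of \<open>D e5\<close>, which enters because \<open>D e6\<close> has the component
  \<open>- \<omega>\<close> along \<open>e5\<close>; the Christoffel terms cancel by
  symmetry.\<close>

lemma K_eq:
  assumes x: "x \<in> S"
  shows "K x u v = q x * (ip (g x) u v - \<eta> x u * \<eta> x v)"
proof -
  have *: "G x (D x u (\<lambda>y. D y v e6)) (dF x z) =
    - dirderiv t x u * ip (g x) v z - t x * G x (D x u (\<lambda>y. dF y v)) (dF x z)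
    + 4 * (dirderiv t x u * \<eta> x v + t x * (K x u v + \<eta> x (christoffel g x u v))) * \<eta> x z
    + 4 * t x * \<eta> x v * K x u z + r x * w x * \<eta> x v * ip (g x) u z" for u v z
  proof -
    have "D x u (\<lambda>y. D y v e6) =
      D x u (\<lambda>y. ((- t y) *\<^sub>R dF y v + (4 * t y * \<eta> y v) *\<^sub>R Eh y) + (- \<omega> y v) *\<^sub>R e5 y)"
      by (rule D_cong[OF x]) (rule D_e6)
    also have "\<dots> = (dirderiv (\<lambda>y. - t y) x u *\<^sub>R dF x v + (- t x) *\<^sub>R D x u (\<lambda>y. dF y v))
      + (dirderiv (\<lambda>y. 4 * t y * \<eta> y v) x u *\<^sub>R Eh x + (4 * t x * \<eta> x v) *\<^sub>R D x u Eh)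
      + (dirderiv (\<lambda>y. - \<omega> y v) x u *\<^sub>R e5 x + (- \<omega> x v) *\<^sub>R D x u e5)"
      by (simp add: D_add D_scaleR x smooth_on_add smooth_on_scaleR smooth_on_mult smooth_on_minus
        smooth_on_const smooth_t smooth_\<eta> smooth_\<omega> smooth_dF smooth_Eh smooth_e5 open_S del: scaleR_minus_left)
    also have "dirderiv (\<lambda>y. - t y) x u = - dirderiv t x u"
      by (rule dirderiv_bounded_linear[OF bounded_linear_minus[OF bounded_linear_ident]
        smooth_on_differentiable[OF smooth_t x]])
    also have "dirderiv (\<lambda>y. 4 * t y * \<eta> y v) x u =
      4 * (dirderiv t x u * \<eta> x v + t x * (K x u v + \<eta> x (christoffel g x u v)))"
      using dirderiv_bilinear[OF bounded_bilinear_mult smooth_on_differentiable[OF smooth_t x]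
          smooth_on_differentiable[OF smooth_\<eta>[of v] x], of u]
        dirderiv_bounded_linear[OF bounded_linear_mult_right[of 4], of "\<lambda>y. t y * \<eta> y v" x u]
        smooth_on_differentiable[OF smooth_on_mult[OF open_S smooth_t smooth_\<eta>] x, of v]
      by (simp add: d\<eta>[OF x] mult.assoc algebra_simps)
    finally show ?thesis
      by (simp add: frame_simps x Eh_simps D_e5_dF \<omega>_eq isometric[symmetric] K_def[symmetric])
  qed
  have "D x u (\<lambda>y. D y v e6) - D x v (\<lambda>y. D y u e6) = 0" for u v
    by (simp add: D_curvature x smooth_e6 curvature normalD' normal_e6)
  then have Z: "G x (D x u (\<lambda>y. D y v e6)) (dF x z) - G x (D x v (\<lambda>y. D y u e6)) (dF x z) = 0" for u v z
    by simp
  have "- dirderiv t x u * ip (g x) v z + dirderiv t x v * ip (g x) u z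
      + 4 * (dirderiv t x u * ip (g x) (E x) v - dirderiv t x v * ip (g x) (E x) u
        + t x * (K x u v - K x v u)) * ip (g x) (E x) z
      + 4 * t x * (ip (g x) (E x) v * K x u z - ip (g x) (E x) u * K x v z)
      + r x * w x * (ip (g x) (E x) v * ip (g x) u z - ip (g x) (E x) u * ip (g x) v z) = 0" for u v z
    using Z[of u v z, unfolded *] G_D_dF_dF[OF x, of u v z] M.christoffel_commute[OF x, of u v]
    by (simp add: \<eta>_def[symmetric] algebra_simps)
  from Codazzi_second[OF metric_g[OF x] linear_dirderiv_on[OF x smooth_t] bilinear_K[OF x] K_E[OF x]
    E_unit[OF x] t_nz[OF x] this] show ?thesis
    by (simp add: q_def \<eta>_def)
qed

end

section \<open>Structure equations along the distinguished direction\<close>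

context framed_chart
begin

lemma D_Eh:
  assumes x: "x \<in> S"
  shows "D x u Eh = q x *\<^sub>R dF x u + (- (q x * \<eta> x u)) *\<^sub>R Eh x + (r x * \<eta> x u) *\<^sub>R e5 x
    + (- 3 * (t x * \<eta> x u)) *\<^sub>R e6 x"
proof (rule frame_eqI[OF x x x x])
  have "G x (D x u Eh) (e5 x) = r x * \<eta> x u"
    using G_D_swap[OF x smooth_Eh smooth_e5 Eh_e5, of u] x D_e5_dF[OF x, of u "E x"]
    by (simp add: Eh_def[of x] \<eta>_def ip_commute[OF metric_g[OF x], of u])
  then show "G x (D x u Eh) (e5 x) = G x (q x *\<^sub>R dF x u + (- (q x * \<eta> x u)) *\<^sub>R Eh x + (r x * \<eta> x u) *\<^sub>R e5 x
    + (- 3 * (t x * \<eta> x u)) *\<^sub>R e6 x) (e5 x)"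
    by (simp add: x frame_simps Eh_simps)
  have "G x (D x u Eh) (e6 x) = \<beta> x u (E x)"
    using G_D_swap[OF x smooth_Eh smooth_e6 Eh_e6, of u] x D_e6_dF[OF x, of u "E x"]
    by (simp add: Eh_def[of x])
  then have "G x (D x u Eh) (e6 x) = - 3 * (t x * \<eta> x u)"
    by (simp add: \<beta>_eq x \<eta>_E) (simp add: \<eta>_def ip_commute[OF metric_g[OF x], of u])
  then show "G x (D x u Eh) (e6 x) = G x (q x *\<^sub>R dF x u + (- (q x * \<eta> x u)) *\<^sub>R Eh x + (r x * \<eta> x u) *\<^sub>R e5 x
    + (- 3 * (t x * \<eta> x u)) *\<^sub>R e6 x) (e6 x)"
    by (simp add: x frame_simps Eh_simps)
  show "G x (D x u Eh) (dF x v) = G x (q x *\<^sub>R dF x u + (- (q x * \<eta> x u)) *\<^sub>R Eh x + (r x * \<eta> x u) *\<^sub>R e5 x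
    + (- 3 * (t x * \<eta> x u)) *\<^sub>R e6 x) (dF x v)" for v
    using K_eq[OF x, of u v]
    by (simp add: x frame_simps Eh_simps K_def isometric[symmetric] algebra_simps)
qed

text \<open>The Riccati equation \<open>q' + q^2 = - sec\<close>. By Gauss, the sectional curvature
  of a plane containing \<open>E\<close> is \<open>k + r^2 - 3 t^2\<close>, the last term being the
  product of the \<open>e6\<close> eigenvalues \<open>- 3 t\<close> and \<open>t\<close>.\<close>

lemma dq_E:
  assumes x: "x \<in> S"
  shows "dirderiv q x (E x) = 3 * (t x)\<^sup>2 - (r x)\<^sup>2 - k - (q x)\<^sup>2"
proof -
  have *: "G x (D x u (\<lambda>y. D y v Eh)) (dF x z) =
    dirderiv q x u * ip (g x) v z + q x * G x (D x u (\<lambda>y. dF y v)) (dF x z)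
    - (q x * dirderiv (\<lambda>y. \<eta> y v) x u + dirderiv q x u * \<eta> x v) * \<eta> x z - q x * \<eta> x v * K x u z
    - (r x)\<^sup>2 * \<eta> x v * ip (g x) u z + 3 * t x * \<eta> x v * \<beta> x u z" for u v z
  proof -
    have "D x u (\<lambda>y. D y v Eh) = D x u (\<lambda>y. ((q y *\<^sub>R dF y v + (- (q y * \<eta> y v)) *\<^sub>R Eh y)
      + (r y * \<eta> y v) *\<^sub>R e5 y) + (- 3 * (t y * \<eta> y v)) *\<^sub>R e6 y)"
      by (rule D_cong[OF x]) (rule D_Eh)
    also have "\<dots> = (dirderiv q x u *\<^sub>R dF x v + q x *\<^sub>R D x u (\<lambda>y. dF y v))
      + (dirderiv (\<lambda>y. - (q y * \<eta> y v)) x u *\<^sub>R Eh x + (- (q x * \<eta> x v)) *\<^sub>R D x u Eh)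
      + (dirderiv (\<lambda>y. r y * \<eta> y v) x u *\<^sub>R e5 x + (r x * \<eta> x v) *\<^sub>R D x u e5)
      + (dirderiv (\<lambda>y. - 3 * (t y * \<eta> y v)) x u *\<^sub>R e6 x + (- 3 * (t x * \<eta> x v)) *\<^sub>R D x u e6)"
      by (simp add: D_add D_scaleR x smooth_on_add smooth_on_scaleR smooth_on_mult smooth_on_minus
        smooth_on_const smooth_t smooth_\<eta> smooth_q smooth_r smooth_dF smooth_Eh smooth_e5 smooth_e6 open_S
        del: scaleR_minus_left)
    also have "dirderiv (\<lambda>y. - (q y * \<eta> y v)) x u = - (q x * dirderiv (\<lambda>y. \<eta> y v) x u + dirderiv q x u * \<eta> x v)"
      by (simp add: dirderiv_minus[OF x] dirderiv_mult[OF x] smooth_q smooth_\<eta> smooth_on_mult open_S)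
    finally show ?thesis
      by (simp add: frame_simps x Eh_simps D_e5_dF D_e6_dF power2_eq_square isometric[symmetric] K_def[symmetric])
        (simp add: algebra_simps)
  qed
  \<comment> \<open>Any direction orthogonal to \<open>E\<close> serves, since \<open>K\<close> and
    \<open>\<beta>\<close> are multiples of the metric on the complement.\<close>
  obtain u where u: "u \<noteq> 0" "ip (g x) (E x) u = 0"
    using exists_orthogonal_vector[OF metric_g[OF x], of "E x" "E x"] by blast
  then have \<eta>u: "\<eta> x u = 0" by (simp add: \<eta>_def)
  have "ip (g x) u (E x) = 0" using u ip_commute[OF metric_g[OF x]] by simp
  then have \<beta>: "\<beta> x u u = t x * ip (g x) u u" "\<beta> x (E x) u = 0" and K: "K x u u = q x * ip (g x) u u" "K x (E x) u = 0"
    using u \<eta>u by (simp_all add: \<beta>_eq K_eq x \<eta>_E)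
  have "D x u (\<lambda>y. D y (E x) Eh) - D x (E x) (\<lambda>y. D y u Eh) = k *\<^sub>R dF x u"
    using \<eta>u by (simp add: D_curvature x smooth_Eh curvature dF_Eh \<eta>_E)
  then have "G x (D x u (\<lambda>y. D y (E x) Eh)) (dF x u) - G x (D x (E x) (\<lambda>y. D y u Eh)) (dF x u) = k * ip (g x) u u"
    unfolding bilinear_lsub[OF bilinear_ip, symmetric] by (simp add: ip_simps isometric[OF x])
  then have "(3 * (t x)\<^sup>2 - (r x)\<^sup>2 - k - (q x)\<^sup>2 - dirderiv q x (E x)) * ip (g x) u u = 0"
    unfolding * using \<beta> K \<eta>u u \<eta>_E[OF x] G_D_dF_dF[OF x, of u "E x" u]
    by (simp add: power2_eq_square algebra_simps)
  then show ?thesis using u ip_eq_0[OF metric_g[OF x], of u] by simp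
qed

lemma dt_E: "x \<in> S \<Longrightarrow> dirderiv t x (E x) = - r x * w x - 4 * t x * q x"
  by (simp add: q_def field_simps)

section \<open>The normal Laplacian of H in the adapted frame\<close>

lemma NC_H:
  assumes x: "x \<in> S"
  shows "NC x v H = \<omega> x v *\<^sub>R (t x *\<^sub>R e5 x + r x *\<^sub>R e6 x)"
proof (rule frame_eqI[OF x x x x])
  have "D x v H = D x v (\<lambda>y. r y *\<^sub>R e5 y)" by (rule D_cong[OF x H_eq])
  then have DH: "D x v H = dirderiv r x v *\<^sub>R e5 x + r x *\<^sub>R D x v e5"
    by (simp add: D_scaleR x smooth_r smooth_e5)
  show "G x (NC x v H) (e5 x) = G x (\<omega> x v *\<^sub>R (t x *\<^sub>R e5 x + r x *\<^sub>R e6 x)) (e5 x)"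
    by (simp add: G_NC normal_e5 x DH D_e5_orthogonal frame_simps dr_eq \<omega>_eq)
  show "G x (NC x v H) (e6 x) = G x (\<omega> x v *\<^sub>R (t x *\<^sub>R e5 x + r x *\<^sub>R e6 x)) (e6 x)"
    by (simp add: G_NC normal_e6 x DH frame_simps \<omega>_def)
  show "G x (NC x v H) (dF x u) = G x (\<omega> x v *\<^sub>R (t x *\<^sub>R e5 x + r x *\<^sub>R e6 x)) (dF x u)" for u
    using normalD[OF normal_NC[OF x]] by (simp add: frame_simps x)
qed

text \<open>Besides the Christoffel term this is a multiple of the metric plus
  \<open>\<eta> x v\<close> times a linear form in \<open>u\<close>, the two shapes whose trace is
  known.\<close>

lemma d\<omega>:
  assumes x: "x \<in> S"
  shows "dirderiv (\<lambda>y. \<omega> y v) x u = \<omega> x (christoffel g x u v)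
    + w x * q x * ip (g x) u v + \<eta> x v * (dirderiv w x u - w x * q x * \<eta> x u)"
proof -
  have "dirderiv (\<lambda>y. \<omega> y v) x u = dirderiv (\<lambda>y. w y * \<eta> y v) x u"
    by (rule dirderiv_cong[OF open_S x \<omega>_eq])
  also have "\<dots> = w x * (K x u v + \<eta> x (christoffel g x u v)) + dirderiv w x u * \<eta> x v"
    by (simp add: dirderiv_mult[OF x] x smooth_w smooth_\<eta> d\<eta>)
  finally show ?thesis by (simp add: K_eq x \<omega>_eq algebra_simps)
qed

text \<open>By \<open>NC_H\<close> the normal derivative of \<open>H\<close> is
  \<open>\<omega>\<close> times one section. Its trace derivative is the divergence of
  \<open>\<omega>\<close>, namely \<open>w' + 3 q w\<close>, times that section, plus the derivative
  of the section along \<open>w E\<close>; \<open>a\<close> and \<open>b\<close> are the components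
  of both along \<open>n\<close>.\<close>

lemma normal_laplacian_component:
  assumes x: "x \<in> S" and n: "normal x n" and \<zeta>: "G x (t x *\<^sub>R e5 x + r x *\<^sub>R e6 x) n = a"
    and D\<zeta>: "\<And>u. G x (D x u (\<lambda>y. t y *\<^sub>R e5 y + r y *\<^sub>R e6 y)) n = b u"
  shows "G x (normal_laplacian g h F H x) n = (dirderiv w x (E x) + 3 * q x * w x) * a + w x * b (E x)"
proof -
  let ?Z = "\<lambda>y. t y *\<^sub>R e5 y + r y *\<^sub>R e6 y"
  have sZ: "smooth_on S ?Z"
    by (intro smooth_on_add smooth_on_scaleR smooth_t smooth_r smooth_e5 smooth_e6 open_S)
  have lb: "linear b"
    using linear_compose[OF linear_D[OF x sZ] linear_G(1)[of x n]] unfolding o_def D\<zeta> .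
  have NC: "G x (NC x u (\<lambda>y. NC y v H)) n = dirderiv (\<lambda>y. \<omega> y v) x u * a + \<omega> x v * b u" for u v
  proof -
    have "D x u (\<lambda>y. NC y v H) = D x u (\<lambda>y. \<omega> y v *\<^sub>R ?Z y)" by (rule D_cong[OF x NC_H])
    also have "\<dots> = dirderiv (\<lambda>y. \<omega> y v) x u *\<^sub>R ?Z x + \<omega> x v *\<^sub>R D x u ?Z"
      by (rule D_scaleR[OF x smooth_\<omega> sZ])
    finally have eq: "D x u (\<lambda>y. NC y v H) = dirderiv (\<lambda>y. \<omega> y v) x u *\<^sub>R ?Z x + \<omega> x v *\<^sub>R D x u ?Z" .
    have "G x (c *\<^sub>R V + d *\<^sub>R W) n = c * G x V n + d * G x W n" for c d V W
      by (simp add: ip_simps)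
    from this[of _ "?Z x" _ "D x u ?Z"] show ?thesis
      unfolding G_NC[OF x n] eq \<zeta> D\<zeta> .
  qed
  have NC': "G x (NC x v H) n = \<omega> x v * a" for v
    unfolding NC_H[OF x] by (simp only: bilinear_lmul[OF bilinear_ip] \<zeta> real_scaleR_def)
  let ?l = "\<lambda>u. (dirderiv w x u - w x * q x * \<eta> x u) * a + w x * b u"
  have ll: "linear ?l"
    by (rule linearI) (simp_all add: linear_add[OF linear_dirderiv_on[OF x smooth_w]] linear_add[OF linear_\<eta>]
      linear_add[OF lb] linear_cmul[OF linear_dirderiv_on[OF x smooth_w]] linear_cmul[OF linear_\<eta>]
      linear_cmul[OF lb] algebra_simps)
  have "G x (normal_laplacian g h F H x) n =
    metric_trace (g x) (\<lambda>u v. G x (NC x u (\<lambda>y. NC y v H) - NC x (cov g x u (\<lambda>_. v)) H) n)"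
    unfolding normal_laplacian_def by (rule metric_trace_linear[OF linear_G(1), symmetric])
  also have "\<dots> = metric_trace (g x) (\<lambda>u v. (w x * q x * a) *\<^sub>R ip (g x) u v + ip (g x) (E x) v *\<^sub>R ?l u)"
    \<comment> \<open>The Christoffel part of \<open>d\<omega>\<close> cancels against the
      correction term of the second covariant derivative.\<close>
    unfolding bilinear_lsub[OF bilinear_ip] NC NC' d\<omega>[OF x] cov_const
    by (simp add: \<omega>_eq x \<eta>_def algebra_simps)
  also have "\<dots> = (w x * q x * a) * 4 + ?l (E x)"
    unfolding metric_trace_add metric_trace_scale metric_trace_eta[OF metric_g[OF x] ll]
    by (simp add: metric_trace_ip x)
  finally show ?thesis by (simp add: \<eta>_E x algebra_simps)
qed

text \<open>Since \<open>normal_laplacian_eq\<close> has no \<open>e6\<close> component, the second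
  equation determines \<open>w'\<close>; inserted with \<open>t'\<close> into the first, it leaves a
  relation without derivatives.\<close>

lemma
  assumes x: "x \<in> S"
  shows normal_laplacian_e5: "(dirderiv w x (E x) + 3 * q x * w x) * t x + w x * (dirderiv t x (E x) - r x * w x)
      = 4 * ((r x)\<^sup>2 - k) * r x"
    and normal_laplacian_e6: "(dirderiv w x (E x) + 3 * q x * w x) * r x + 2 * t x * (w x)\<^sup>2 = 0"
proof -
  have D: "D x u (\<lambda>y. t y *\<^sub>R e5 y + r y *\<^sub>R e6 y) =
    (dirderiv t x u *\<^sub>R e5 x + t x *\<^sub>R D x u e5) + (dirderiv r x u *\<^sub>R e6 x + r x *\<^sub>R D x u e6)" for u
    by (simp add: D_add D_scaleR x smooth_on_scaleR smooth_t smooth_r smooth_e5 smooth_e6 open_S)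
  have "G x (normal_laplacian g h F H x) (e5 x) =
    (dirderiv w x (E x) + 3 * q x * w x) * t x + w x * (dirderiv t x (E x) - r x * \<omega> x (E x))"
    by (rule normal_laplacian_component[OF x normal_e5[OF x]])
      (simp_all add: D x frame_simps D_e5_orthogonal D_e6_e5)
  then show "(dirderiv w x (E x) + 3 * q x * w x) * t x + w x * (dirderiv t x (E x) - r x * w x)
      = 4 * ((r x)\<^sup>2 - k) * r x"
    by (simp add: normal_laplacian_eq x frame_simps \<omega>_eq \<eta>_E)
  have "G x (normal_laplacian g h F H x) (e6 x) =
    (dirderiv w x (E x) + 3 * q x * w x) * r x + w x * (t x * \<omega> x (E x) + dirderiv r x (E x))"
    by (rule normal_laplacian_component[OF x normal_e6[OF x]])
      (simp_all add: D x frame_simps D_e6_e6 \<omega>_def)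
  then show "(dirderiv w x (E x) + 3 * q x * w x) * r x + 2 * t x * (w x)\<^sup>2 = 0"
    by (simp add: normal_laplacian_eq x frame_simps \<omega>_eq \<eta>_E dr_eq power2_eq_square algebra_simps)
qed

lemma dw_E: "x \<in> S \<Longrightarrow> dirderiv w x (E x) = - 3 * q x * w x - 2 * t x * (w x)\<^sup>2 / r x"
  using normal_laplacian_e6[of x] by (simp add: field_simps)

lemma dr_E: "x \<in> S \<Longrightarrow> dirderiv r x (E x) = t x * w x"
  by (simp add: dr_eq \<eta>_E)

lemma constraint:
  assumes x: "x \<in> S"
  shows "1 + (t x / r x)\<^sup>2 + 2 * (t x / r x) * (q x / w x) + 2 * ((r x)\<^sup>2 / (w x)\<^sup>2) - 2 * (k / (w x)\<^sup>2) = 0"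
proof -
  have nz: "r x \<noteq> 0" "w x \<noteq> 0" using x by auto
  have "- 2 * t x * (w x)\<^sup>2 / r x * t x + w x * (- 2 * r x * w x - 4 * t x * q x) = 4 * ((r x)\<^sup>2 - k) * r x"
    using normal_laplacian_e5[OF x] unfolding dw_E[OF x] dt_E[OF x] by (simp add: algebra_simps)
  \<comment> \<open>The factor \<open>- 2 r w^2\<close> clears the denominators and turns the scaled
    constraint into the \<open>e5\<close> equation.\<close>
  moreover have "- 2 * (r x * (w x)\<^sup>2) * (1 + (t x / r x)\<^sup>2 + 2 * (t x / r x) * (q x / w x)
      + 2 * ((r x)\<^sup>2 / (w x)\<^sup>2) - 2 * (k / (w x)\<^sup>2)) =
    - 2 * t x * (w x)\<^sup>2 / r x * t x + w x * (- 2 * r x * w x - 4 * t x * q x) - 4 * ((r x)\<^sup>2 - k) * r x"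
    using nz by (simp add: field_simps power2_eq_square)
  ultimately have "- 2 * (r x * (w x)\<^sup>2) * (1 + (t x / r x)\<^sup>2 + 2 * (t x / r x) * (q x / w x)
      + 2 * ((r x)\<^sup>2 / (w x)\<^sup>2) - 2 * (k / (w x)\<^sup>2)) = 0" by simp
  then show ?thesis using nz by simp
qed

lemma domain_empty: "S = {}"
proof (rule ccontr)
  assume "S \<noteq> {}"
  then obtain x where x: "x \<in> S" by blast
  define V where "V y = (1 / w y) *\<^sub>R E y" for y
  let ?s = "\<lambda>y. t y / r y" and ?p = "\<lambda>y. q y / w y" and ?b = "\<lambda>y. (r y)\<^sup>2 / (w y)\<^sup>2" and ?c = "\<lambda>y. k / (w y)\<^sup>2"
  have V: "dirderiv \<phi> y (V y) = dirderiv \<phi> y (E y) / w y" if "y \<in> S" "smooth_on S \<phi>" for \<phi> :: "real^4 \<Rightarrow> real" and y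
    unfolding V_def linear_cmul[OF linear_dirderiv_on[OF that]] by simp
  note dV = V[OF _ smooth_t] V[OF _ smooth_r] V[OF _ smooth_w] V[OF _ smooth_q]
  have works: "(\<phi> has_derivative dirderiv \<phi> y) (at y)" if "y \<in> S" "smooth_on S \<phi>" for \<phi> :: "real^4 \<Rightarrow> real" and y
    by (rule dirderiv_works[OF smooth_on_differentiable[OF that(2,1)]])
  have ds: "(?s has_derivative (\<lambda>u. (dirderiv t y u * r y - t y * dirderiv r y u) / (r y * r y))) (at y)"
    and dp: "(?p has_derivative (\<lambda>u. (dirderiv q y u * w y - q y * dirderiv w y u) / (w y * w y))) (at y)"
    and db: "(?b has_derivative (\<lambda>u. (2 * r y * dirderiv r y u * (w y)\<^sup>2 - (r y)\<^sup>2 * (2 * w y * dirderiv w y u))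
      / ((w y)\<^sup>2 * (w y)\<^sup>2))) (at y)"
    and dc: "(?c has_derivative (\<lambda>u. - k * (2 * w y * dirderiv w y u) / ((w y)\<^sup>2 * (w y)\<^sup>2))) (at y)"
    if y: "y \<in> S" for y
    using y by (auto intro!: derivative_eq_intros works[OF y] smooth_t smooth_r smooth_q smooth_w)
  show False
  proof (rule constrained_flow_empty[OF open_S x, of ?s ?p ?b ?c V])
    fix y assume y: "y \<in> S"
    have nz: "r y \<noteq> 0" "w y \<noteq> 0" using y by auto
    show "?s differentiable at y" "?p differentiable at y" "?b differentiable at y" "?c differentiable at y"
      using ds[OF y] dp[OF y] db[OF y] dc[OF y] unfolding differentiable_def by blast+
    show "dirderiv ?s y (V y) = - (1 + (t y / r y)\<^sup>2) - 4 * (t y / r y) * (q y / w y)"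
      unfolding dirderiv_eq[OF ds[OF y]] dV[OF y] dt_E[OF y] dr_E[OF y]
      using nz by (simp add: field_simps power2_eq_square)
    show "dirderiv ?p y (V y) = (r y)\<^sup>2 / (w y)\<^sup>2 * (3 * (t y / r y)\<^sup>2 - 1) - k / (w y)\<^sup>2
        + 2 * (q y / w y)\<^sup>2 + 2 * (t y / r y) * (q y / w y)"
      unfolding dirderiv_eq[OF dp[OF y]] dV[OF y] dq_E[OF y] dw_E[OF y]
      using nz by (simp add: field_simps power2_eq_square)
    show "dirderiv ?b y (V y) = 6 * ((r y)\<^sup>2 / (w y)\<^sup>2) * (t y / r y + q y / w y)"
      unfolding dirderiv_eq[OF db[OF y]] dV[OF y] dr_E[OF y] dw_E[OF y]
      using nz by (simp add: field_simps power2_eq_square)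
    show "dirderiv ?c y (V y) = k / (w y)\<^sup>2 * (6 * (q y / w y) + 4 * (t y / r y))"
      unfolding dirderiv_eq[OF dc[OF y]] dV[OF y] dw_E[OF y]
      using nz by (simp add: field_simps power2_eq_square)
    show "1 + (t y / r y)\<^sup>2 + 2 * (t y / r y) * (q y / w y) + 2 * ((r y)\<^sup>2 / (w y)\<^sup>2) - 2 * (k / (w y)\<^sup>2) = 0"
      by (rule constraint[OF y])
  next
    have "r x \<noteq> 0" "w x \<noteq> 0" "t x \<noteq> 0" using x by auto
    then show "(r x)\<^sup>2 / (w x)\<^sup>2 > 0" "k / (w x)\<^sup>2 \<le> 0" "t x / r x \<noteq> 0"
      using k by (simp_all add: divide_nonpos_pos)
  qed
qed

end

section \<open>Globalization\<close>

lemma (in immersed_chart) restrict: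
  assumes "open S'" "S' \<subseteq> S"
  shows "immersed_chart h T F S' g"
proof
  show "F ` S' \<subseteq> T" using F_image assms by auto
qed (use assms isometric metric_g in \<open>auto intro: smooth_on_subset[OF smooth_F] smooth_on_subset[OF smooth_g]\<close>)

context pseudo_umbilical_chart
begin

lemma restrict:
  assumes "open S'" "S' \<subseteq> S"
  shows "pseudo_umbilical_chart h T F S' g k"
proof -
  interpret S': immersed_chart h T F S' g
    using assms by (rule restrict)
  show ?thesis
    using assms(2) curvature k H_nz umbilical biharmonic by unfold_locales auto
qed

text \<open>The second normal field is the normalized derivative \<open>Z u\<close> of
  \<open>e5\<close>: it is normal, orthogonal to \<open>e5\<close>, and smooth wherever it does not
  vanish. Only a neighbourhood of one point with \<open>dr\<close> nonzero is kept.\<close>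

lemma domain_empty: "S = {}"
proof (rule ccontr)
  assume "S \<noteq> {}"
  then obtain x0 u0 where x0: "x0 \<in> S" and u0: "dirderiv r x0 u0 \<noteq> 0"
    using r_not_constant by blast
  define Z where "Z u x = D x u e5 + r x *\<^sub>R dF x u" for u x
  have smooth_Z: "smooth_on S (Z u)" for u
    unfolding Z_def
    by (intro smooth_on_add smooth_on_scaleR smooth_D smooth_e5 smooth_r smooth_dF open_S)
  have Z_dF: "G x (Z u x) (dF x v) = 0" and Z_e5: "G x (Z u x) (e5 x) = 0" if "x \<in> S" for u v x
    using that by (simp_all add: Z_def ip_simps D_e5_dF isometric D_e5_orthogonal normalD' normal_e5)
  obtain u where u: "Z u x0 \<noteq> 0"
  proof -
    have "\<exists>u. Z u x0 \<noteq> 0"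
    proof (rule ccontr)
      assume "\<not> ?thesis"
      then have Z0: "Z u x0 = 0" for u by blast
      \<comment> \<open>\<open>Z\<close> is everywhere orthogonal to the tangent space; where
        \<open>Z\<close> vanishes, so does the tangential part of its derivative. The Codazzi
        equation then reduces to its \<open>dr\<close> terms.\<close>
      have "G x0 (D x0 u (Z v)) (dF x0 w) = 0" for u v w
        using D_metric[OF x0 smooth_Z[of v] smooth_dF[of w], of u]
          dirderiv_cong[OF open_S x0, of "\<lambda>y. G y (Z v y) (dF y w)" "\<lambda>_. 0" u, OF Z_dF] by (simp add: Z0 ip_simps)
      then have "dirderiv r x0 u * ip (g x0) v w = dirderiv r x0 v * ip (g x0) u w" for u v w
        using Codazzi_e5[OF x0, of u v w] unfolding Z_def[symmetric] by (simp add: ip_simps)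
      then have "dirderiv r x0 u0 = 0"
        by (rule linear_form_vanishes[OF metric_g[OF x0], of 0 "dirderiv r x0"]) (simp add: ip_simps)
      with u0 show False by simp
    qed
    then show ?thesis using that by blast
  qed
  \<comment> \<open>A single continuous function whose nonvanishing ensures both
    \<open>dr \<noteq> 0\<close> and \<open>Z u \<noteq> 0\<close>, hence an open domain for the
    frame.\<close>
  define \<phi> where "\<phi> x = dirderiv r x u0 * G x (Z u x) (Z u x)" for x
  define S' where "S' = S \<inter> \<phi> -` (- {0})"
  have "smooth_on S \<phi>"
    unfolding \<phi>_def by (intro smooth_on_mult smooth_on_dirderiv smooth_r smooth_G smooth_Z open_S)
  then have "open S'"
    unfolding S'_def by (intro continuous_open_preimage smooth_on_continuous open_S) auto
  have sub: "S' \<subseteq> S" by (auto simp: S'_def)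
  have pos: "G x (Z u x) (Z u x) > 0" and dr: "dirderiv r x u0 \<noteq> 0" if "x \<in> S'" for x
    using that sub by (auto simp: S'_def \<phi>_def ip_eq_0 intro!: ip_pos)
  define e6 where "e6 x = (1 / sqrt (G x (Z u x) (Z u x))) *\<^sub>R Z u x" for x
  interpret S': pseudo_umbilical_chart h T F S' g k
    by (rule restrict[OF \<open>open S'\<close> sub])
  interpret framed_chart h T F S' g k e6
  proof
    show "smooth_on S' e6"
      unfolding e6_def
      by (intro smooth_on_scaleR smooth_on_divide smooth_on_const smooth_on_sqrt S'.smooth_G S'.open_S
        smooth_on_subset[OF smooth_Z sub]) (auto dest: pos)
    fix x assume x: "x \<in> S'"
    then have "x \<in> S" using sub by auto
    show "normal x (e6 x)" "G x (e6 x) (e5 x) = 0"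
      using \<open>x \<in> S\<close> by (simp_all add: normal_def e6_def ip_simps Z_dF Z_e5)
    show "G x (e6 x) (e6 x) = 1"
      using pos[OF x] by (simp add: e6_def ip_simps)
    show "\<exists>u. dirderiv r x u \<noteq> 0" using dr[OF x] by blast
  qed
  \<comment> \<open>\<open>domain_empty\<close> here is the fact of the framed chart, so it says
    that \<open>S'\<close> is empty.\<close>
  have "x0 \<in> S'" using x0 u u0 by (simp add: S'_def \<phi>_def ip_eq_0)
  with domain_empty show False by simp
qed

end

section \<open>From manifolds to charts\<close>

lemma
  assumes M: "riemannian_manifold M" and f: "smooth_map M N f" and c: "c \<in> atlas M" and d: "d \<in> atlas N"
    and N: "riemannian_manifold N"
  shows open_local_dom: "open (local_dom c d f)"
    and local_rep_image: "local_rep c d f ` local_dom c d f \<subseteq> snd d ` fst d"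
proof -
  have hom: "homeomorphic_map (subtopology (underlying M) (fst c)) (top_of_set (snd c ` fst c)) (snd c)"
    and oc: "openin (underlying M) (fst c)" and oi: "open (snd c ` fst c)"
    using M c unfolding riemannian_manifold_def smooth_atlas_def by auto
  have sub: "fst c \<subseteq> topspace (underlying M)" using oc openin_subset by blast
  have "openin (underlying N) (fst d)"
    using N d unfolding riemannian_manifold_def smooth_atlas_def by auto
  then have "openin (underlying M) {x \<in> topspace (underlying M). f x \<in> fst d}"
    using f openin_continuous_map_preimage unfolding smooth_map_def by blast
  then have "openin (subtopology (underlying M) (fst c)) (fst c \<inter> {x \<in> topspace (underlying M). f x \<in> fst d})"
    by (simp add: openin_subtopology_Int2)
  moreover have "fst c \<inter> {x \<in> topspace (underlying M). f x \<in> fst d} = fst c \<inter> f -` fst d"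
    using sub by auto
  ultimately have "openin (top_of_set (snd c ` fst c)) (local_dom c d f)"
    using homeomorphic_imp_open_map[OF hom] unfolding local_dom_def open_map_def by auto
  then show "open (local_dom c d f)" using oi by (simp add: openin_open_eq)
  have "inj_on (snd c) (fst c)"
    using homeomorphic_imp_injective_map[OF hom] sub by (simp add: Int_absorb1)
  then show "local_rep c d f ` local_dom c d f \<subseteq> snd d ` fst d"
    by (auto simp: local_rep_def local_dom_def)
qed

theorem corollary1p5:
  fixes M :: "('a, 4) riemannian" and N :: "('b, 6) riemannian" and f :: "'a \<Rightarrow> 'b" and k :: real
  assumes "riemannian_manifold M" and "riemannian_manifold N"
    and "constant_sectional_curvature N k" and "k \<le> 0"
    and "isometric_immersion M N f"
    and "pseudo_umbilical M N f"
    and "biharmonic_submanifold k M N f"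
  shows "minimal_submanifold M N f"
  unfolding minimal_submanifold_def in_charts_def
proof (intro ballI)
  fix c d x
  assume c: "c \<in> atlas M" and d: "d \<in> atlas N" and x: "x \<in> local_dom c d f"
  define h where "h = gram N d"
  define g where "g = gram M c"
  define F where "F = local_rep c d f"
  define S where "S = local_dom c d f"
  define T where "T = snd d ` fst d"
  have sm: "smooth_map M N f" using assms(5) by (simp add: isometric_immersion_def)
  interpret N: metric_chart h T
    using assms(2) d unfolding riemannian_manifold_def smooth_atlas_def
    by unfold_locales (auto simp: h_def T_def metric_matrix_def)
  have ST: "open S" "F ` S \<subseteq> T"
    using open_local_dom[OF assms(1) sm c d assms(2)] local_rep_image[OF assms(1) sm c d assms(2)]
    by (auto simp: S_def F_def T_def)
  have S_sub: "S \<subseteq> snd c ` fst c" by (auto simp: S_def local_dom_def)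
  have Mc: "smooth_on (snd c ` fst c) g" "x \<in> snd c ` fst c \<Longrightarrow> metric_matrix (g x)" for x
    using assms(1) c by (auto simp: riemannian_manifold_def g_def metric_matrix_def)
  interpret immersed_chart h T F S g
  proof
    show "smooth_on S F" using sm c d by (simp add: smooth_map_def S_def F_def)
    show "smooth_on S g" by (rule smooth_on_subset[OF Mc(1) S_sub])
    show "metric_matrix (g x)" if "x \<in> S" for x using Mc(2) S_sub that by auto
    show "ip (g x) u v = ip (h (F x)) (dirderiv F x u) (dirderiv F x v)" if "x \<in> S" for x u v
      using assms(5) c d that by (simp add: isometric_immersion_def in_charts_def S_def F_def g_def h_def)
  qed (use ST in auto)
  \<comment> \<open>The points of the chart where \<open>H\<close> does not vanish. Its emptiness is
    the claim for this pair of charts, so no argument links different charts.\<close>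
  define S' where "S' = S \<inter> H -` (- {0})"
  have "open S'"
    unfolding S'_def by (intro continuous_open_preimage smooth_on_continuous smooth_H open_S) auto
  have "S' \<subseteq> S" by (auto simp: S'_def)
  interpret S': immersed_chart h T F S' g
    by (rule restrict) fact+
  interpret S': pseudo_umbilical_chart h T F S' g k
  proof
    show "curvature h y a b w = k *\<^sub>R (ip (h y) b w *\<^sub>R a - ip (h y) a w *\<^sub>R b)" if "y \<in> T" for y a b w
      using assms(3) d that
      by (intro N.constant_curvature) (auto simp: constant_sectional_curvature_def h_def T_def)
    show "k \<le> 0" by fact
    fix x assume "x \<in> S'"
    then have x: "x \<in> local_dom c d f" "H x \<noteq> 0" by (auto simp: S'_def S_def)
    then show "H x \<noteq> 0" by simp
    show "shape_op g h F x (H x) u = ip (h (F x)) (H x) (H x) *\<^sub>R u" for u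
      using assms(6) c d x(1) by (simp add: pseudo_umbilical_def in_charts_def Let_def F_def g_def h_def)
    show "normal_laplacian g h F H x - metric_trace (g x) (\<lambda>u v. B x (shape_op g h F x (H x) u) v)
        + (4 * k) *\<^sub>R H x = 0"
      using assms(7) c d x(1)
      by (simp add: biharmonic_submanifold_def in_charts_def Let_def F_def g_def h_def)
  qed
  show "mean_curvature (gram M c) (gram N d) (local_rep c d f) x = 0"
    using S'.domain_empty x by (auto simp: S'_def S_def F_def g_def h_def)
qed

end
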